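(* Let $d\ge 1$, $m \geq d$, and let $Z = \mathcal{Z}(\mathbf{g}_1,\ldots,\mathbf{g}_m) \subseteq \mathbb{R}^d$ be a lattice zonotope with generators $\mathbf{g}_1,\ldots,\mathbf{g}_m\in\mathbb{Z}^d$ such that $\operatorname{int}(Z) \cap \mathbb{Z}^d \neq \emptyset$. Then there exists an interior lattice point $\mathbf{w} \in \operatorname{int}(Z) \cap \mathbb{Z}^d$ such that \[ \operatorname{ca}(Z,\mathbf{w}) \leq w(d) - 1 , \] and $w(d)-1 \in \Theta(d \log\log d)$ as $d\to\infty$. Moreover, the bound is best possible: for every $d\ge1$, the number $w(d)-1$ cannot be replaced by any smaller number depending only on $d$.
   Context: For $\mathbf{g}_1,\ldots,\mathbf{g}_m \in \mathbb{R}^d$, the zonotope generated by them is the Minkowski sum $\mathcal{Z}(\mathbf{g}_1,\ldots,\mathbf{g}_m) := \sum_{j=1}^m [\mathbf{0},\mathbf{g}_j]$; it is a lattice zonotope if all $\mathbf{g}_j \in \mathbb{Z}^d$. For a convex body $K\subseteq\mathbb{R}^d$ and $\mathbf{w}\in\operatorname{int}(K)$, the coefficient of asymmetry is $\operatorname{ca}(K,\mathbf{w}) := \min\{\lambda\ge 1 : \mathbf{w}-K\subseteq\lambda(K-\mathbf{w})\}$. The function $w:\mathbb{Z}_{>0}\to\mathbb{Z}_{>0}$ is $w(d) := \max\{ z \in \mathbb{Z}_{>0} : \tfrac12 \varphi(z) + h(z) \leq d\}$, where $\varphi$ is Euler's totient function, $h(z)=0$ if $z$ is prime, and $h(z)$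 is the number of distinct prime divisors of $z$ if $z$ is composite (the value at $z=1$ is immaterial). *)

theory Defs
  imports
    "HOL-Analysis.Analysis"
    "HOL-Number_Theory.Totient"
    "HOL-Library.Landau_Symbols"
    "HOL-Library.Set_Algebras"
begin

definition lattice_point :: "real ^ 'n \<Rightarrow> bool" where
  "lattice_point x \<longleftrightarrow> (\<forall>i. x $ i \<in> \<int>)"

(* The sum is the Minkowski sum, taken in the additive monoid of sets of HOL-Library.Set_Algebras. *)
definition zonotope :: "nat \<Rightarrow> (nat \<Rightarrow> real ^ 'n) \<Rightarrow> (real ^ 'n) set" where
  "zonotope m g = (\<Sum>j\<in>{1..m}. closed_segment 0 (g j))"

(* Differences of a point and a set are written as images, since binary minus on sets is set
   difference. The lemma coeff_asym_least shows that the minimum is attained. *)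
definition coeff_asym :: "(real ^ 'n) set \<Rightarrow> real ^ 'n \<Rightarrow> real" where
  "coeff_asym K w =
     (LEAST c :: real. 1 \<le> c \<and> (\<lambda>x. w - x) ` K \<subseteq> (\<lambda>x. c *\<^sub>R (x - w)) ` K)"

lemma coeff_asym_least:
  fixes K :: "(real ^ 'n) set"
  assumes "compact K" "w \<in> interior K"
  defines "P \<equiv> \<lambda>c. 1 \<le> c \<and> (\<lambda>x. w - x) ` K \<subseteq> (\<lambda>x. c *\<^sub>R (x - w)) ` K"
  shows "P (coeff_asym K w)" "\<And>c. P c \<Longrightarrow> coeff_asym K w \<le> c"
proof -
  have iff: "P c \<longleftrightarrow> 1 \<le> c \<and> (\<forall>x\<in>K. w + (1 / c) *\<^sub>R (w - x) \<in> K)" for c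
  proof (cases "1 \<le> c")
    case True
    have "(w - x \<in> (\<lambda>x. c *\<^sub>R (x - w)) ` K) \<longleftrightarrow> w + (1 / c) *\<^sub>R (w - x) \<in> K" for x
    proof -
      have "w - x = c *\<^sub>R (y - w) \<longleftrightarrow> y = w + (1 / c) *\<^sub>R (w - x)" for y
        using True by (auto simp: scaleR_right_diff_distrib[symmetric])
      then show ?thesis by (auto simp: image_iff)
    qed
    then show ?thesis using True by (auto simp: P_def)
  qed (simp add: P_def)
  let ?S = "Collect P"
  have S: "?S = {1..} \<inter> (\<Inter>x\<in>K. {1..} \<inter> (\<lambda>c. w + (1 / c) *\<^sub>R (w - x)) -` K)"
    by (auto simp: iff)
  have "closed ?S" unfolding S
    using compact_imp_closed[OF assms(1)]
    by (intro closed_Int closed_INT closed_atLeast ballI continuous_closed_preimage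
        continuous_intros) auto
  obtain e where e: "e > 0" "ball w e \<subseteq> K"
    using assms(2) mem_interior by blast
  obtain R where R: "R > 0" "\<And>x. x \<in> K \<Longrightarrow> norm (w - x) \<le> R"
    using compact_imp_bounded[OF assms(1)] bounded_any_center[of K w]
    by (metis bounded_pos dist_norm dual_order.trans le_max_iff_disj max.cobounded2 zero_less_one less_max_iff_disj)
  define c where "c = max 1 (2 * R / e)"
  have c: "c \<ge> 1" "R / c < e" using e R by (auto simp: c_def field_simps max_def)
  have "P c" unfolding iff
  proof (intro conjI ballI c)
    fix x assume "x \<in> K"
    then have "norm ((1 / c) *\<^sub>R (w - x)) \<le> R / c" using R(2) c by (simp add: divide_right_mono)
    then have "w + (1 / c) *\<^sub>R (w - x) \<in> ball w e" using c by (auto simp: dist_norm)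
    then show "w + (1 / c) *\<^sub>R (w - x) \<in> K" using e by blast
  qed
  have bdd: "bdd_below ?S" by (rule bdd_belowI[of _ 1]) (auto simp: P_def)
  have inS: "Inf ?S \<in> ?S"
    using \<open>P c\<close> \<open>closed ?S\<close> bdd by (intro closed_contains_Inf) auto
  have low: "Inf ?S \<le> y" if "P y" for y using that bdd by (auto intro: cInf_lower)
  have "coeff_asym K w = Inf ?S"
    unfolding coeff_asym_def P_def[symmetric] using inS low by (intro Least_equality) auto
  then show "P (coeff_asym K w)" "\<And>c. P c \<Longrightarrow> coeff_asym K w \<le> c"
    using inS low by auto
qed

definition h_fun :: "nat \<Rightarrow> nat" where
  "h_fun z = (if prime z then 0 else card (prime_factors z))"

(* For d = 0 the set is empty and the value is unspecified. *)
definition w_fun :: "nat \<Rightarrow> nat" where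
  "w_fun d = Max {z :: nat. z > 0 \<and> real (totient z) / 2 + real (h_fun z) \<le> real d}"

lemma le_totient_fact:
  fixes z :: nat
  shows "z \<le> totient z * fact (Suc (totient z))"
proof (cases "z = 0")
  case False
  let ?P = "prime_factors z"
  have "p \<le> Suc (totient z)" "1 \<le> p" if "p \<in> ?P" for p
  proof -
    have p: "prime p" "p dvd z" using that by auto
    show "1 \<le> p" using p(1) prime_ge_1_nat by blast
    have "totient p dvd totient z" using p(2) by (rule totient_dvd)
    then have "totient p \<le> totient z" using False by (intro dvd_imp_le) auto
    then show "p \<le> Suc (totient z)" using totient_prime[OF p(1)] by simp
  qed
  then have sub: "?P \<subseteq> {1..Suc (totient z)}" by auto
  have "\<Prod>?P \<le> \<Prod>{1..Suc (totient z)}"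
    by (intro dvd_imp_le prod_dvd_prod_subset prod_pos) (use sub in auto)
  then have le: "\<Prod>?P \<le> fact (Suc (totient z))" by (simp add: fact_prod)
  have pos: "(\<Prod>p\<in>?P. p - 1) \<ge> 1"
    by (rule prod_ge_1) (auto dest!: in_prime_factors_imp_prime prime_ge_2_nat)
  have "z \<le> z * (\<Prod>p\<in>?P. p - 1)" using pos by simp
  also have "\<dots> = totient z * \<Prod>?P"
  proof -
    have "p ^ multiplicity p z = p ^ (multiplicity p z - 1) * p" if "p \<in> ?P" for p
      using that power_minus_mult[of "multiplicity p z" p] by (auto simp: prime_factors_multiplicity)
    then have "(\<Prod>p\<in>?P. p ^ multiplicity p z) = (\<Prod>p\<in>?P. p ^ (multiplicity p z - 1) * p)"
      by (rule prod.cong[OF refl])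
    then have "z = (\<Prod>p\<in>?P. p ^ (multiplicity p z - 1) * p)"
      using prime_factorization_nat[of z] False by simp
    then have "z * (\<Prod>p\<in>?P. p - 1) =
        (\<Prod>p\<in>?P. p ^ (multiplicity p z - 1) * p) * (\<Prod>p\<in>?P. p - 1)"
      by simp
    also have "\<dots> = (\<Prod>p\<in>?P. p ^ (multiplicity p z - 1) * (p - 1)) * \<Prod>?P"
      by (simp add: prod.distrib)
    finally show ?thesis using totient_formula1[of z] False by simp
  qed
  also have "\<dots> \<le> totient z * fact (Suc (totient z))" using le by (rule mult_le_mono2)
  finally show ?thesis .
qed simp

lemma finite_w_fun_set:
  "finite {z :: nat. z > 0 \<and> real (totient z) / 2 + real (h_fun z) \<le> real d}"
proof (rule finite_subset)
  show "{z :: nat. z > 0 \<and> real (totient z) / 2 + real (h_fun z) \<le> real d}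
    \<subseteq> {..2 * d * fact (Suc (2 * d))}"
  proof clarify
    fix z :: nat assume "real (totient z) / 2 + real (h_fun z) \<le> real d"
    then have t: "totient z \<le> 2 * d" by linarith
    have "z \<le> totient z * fact (Suc (totient z))" by (rule le_totient_fact)
    also have "\<dots> \<le> 2 * d * fact (Suc (2 * d))" using t by (intro mult_le_mono fact_mono) auto
    finally show "z \<le> 2 * d * fact (Suc (2 * d))" .
  qed
qed simp

lemma two_in_w_fun_set:
  assumes "d \<ge> 1"
  shows "2 \<in> {z :: nat. z > 0 \<and> real (totient z) / 2 + real (h_fun z) \<le> real d}"
  using assms by (simp add: h_fun_def)

end

theory Submission
  imports Defs "HOL-Real_Asymp.Real_Asymp"
begin

text \<open>
  A zonotope is symmetric about \<open>c = \<Sum>j. g j / 2\<close>, and \<open>ca(Z, w) \<le> N - 1\<close> holds as soon as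
  \<open>w = \<Sum>j. s j * g j\<close> with all \<open>s j \<in> [1 / N, 1 - 1 / N]\<close>. Starting from coefficients in \<open>(0, 1)\<close>, linearly dependent
  generators can be merged, so there are at most \<open>d\<close> independent ones; their coefficients are then
  rational, say \<open>a i / q\<close>, and the fractional parts of \<open>k * a i / q\<close> are again coefficients of a lattice point.
  It remains to find \<open>k\<close> keeping at most \<open>d\<close> such multiples at distance at least \<open>1 / N\<close> from the integers, \<open>N = w(d)\<close>.
  After replacing the \<open>a i / q\<close> by a multiple one may assume that each prime divisor of \<open>q\<close> is the order of
  some \<open>a i / q\<close>. For a random unit \<open>k\<close> modulo \<open>q\<close>, an index of order \<open>Q > N\<close> fails with probability
  \<open>2 u / \<phi>(Q)\<close>, where \<open>u\<close> is the number of units below \<open>Q / N\<close>, and the union bound succeeds because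
  \<open>\<phi>(Q)\<close> can be compared with \<open>u \<phi>(z)\<close> for a suitable \<open>z > N\<close>, for which \<open>\<phi>(z) / 2 + h(z) > d\<close> by maximality
  of \<open>N\<close>. For \<open>z = w(d)\<close> the coefficients \<open>a / z\<close>, \<open>a\<close> a unit, together with \<open>1 / p\<close>, \<open>p\<close> a prime divisor of \<open>z\<close>, yield a
  parallelepiped showing sharpness. The growth of \<open>w\<close> follows from \<open>\<phi>(z) \<ge> c z / log log z\<close> (Mertens)
  and, in the other direction, from multiples of a factorial.
\<close>

section \<open>Units in half periods\<close>

text \<open>Maximality of N = w(d) speaks about single numbers z > N, while the union bound meets
  every order Q > N together with the number u of units below Q / N, which has no convenient closed
  form. At half periods of a divisor e of Q a reflection bounds u by m * \<phi>(e) / 2; the modulus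
  z has to be chosen so that this bound suffices and z gains no prime that cannot be paid for. The
  summand h(z) comes from the small primes: a prime p \<le> N dividing q is itself the order of an
  index, and unit multiples of a fraction with denominator p stay at distance at least 1 / p \<ge> 1
  / N from the integers. Such indices never fail, so each small prime frees one index from the union
  bound. Primes above N cannot be paid for in this way; orders divisible by one are treated for all
  d indices at once, through elementary lower bounds on w(d) such as w(d) > 2 * d. That estimate is
  not strict, so one index with a strict inequality has to be found besides.\<close>

lemma card_coprime_below:
  fixes e :: nat assumes "e > 0"
  shows "card {x. x < e \<and> coprime x e} = totient e"
proof (cases "e = 1")
  case True
  \<comment> \<open>For e = 1 the residue is 0 whereas the only totative is 1; for larger e both
    sets agree.\<close>
  then have "{x. x < e \<and> coprime x e} = {0}" by auto
  with True show ?thesis by simp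
next
  case False
  then have "{x. x < e \<and> coprime x e} = totatives e"
    using assms totatives_less[of _ e] by (auto simp: in_totatives_iff intro!: gr0I)
  then show ?thesis by (simp add: totient_def)
qed

lemma card_coprime_below_mult:
  fixes e m :: nat assumes "e > 0"
  shows "card {x. x < m * e \<and> coprime x e} \<le> m * totient e"
proof -
  let ?A = "{x. x < m * e \<and> coprime x e}" and ?B = "{..<m} \<times> {x. x < e \<and> coprime x e}"
  have "inj_on (\<lambda>x. (x div e, x mod e)) ?A"
    by (rule inj_onI) (metis div_mult_mod_eq prod.inject)
  moreover have "(\<lambda>x. (x div e, x mod e)) ` ?A \<subseteq> ?B"
    using assms by (auto simp: less_mult_imp_div_less coprime_mod_left_iff)
  ultimately have "card ?A \<le> card ?B"
    by (intro card_inj_on_le[of "\<lambda>x. (x div e, x mod e)"]) auto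
  also have "\<dots> = m * totient e" using card_coprime_below[OF assms] by (simp add: card_cartesian_product)
  finally show ?thesis .
qed

lemma totient_mult_le: "totient (a * b) \<le> a * totient b"
proof (cases "a * b = 0")
  case False
  have "card {x. x < a * b \<and> coprime x (a * b)} \<le> card {x. x < a * b \<and> coprime x b}"
    by (intro card_mono) auto
  with False show ?thesis
    using card_coprime_below[of "a * b"] card_coprime_below_mult[of b a] by simp
qed auto

text \<open>For positive a and b with gcd g, the quotient of the two sides is g / \<phi>(g) \<ge>
  1.\<close>

lemma totient_mult_ge: "totient a * totient b \<le> totient (a * b)"
proof (cases "a * b = 0")
  case False
  then have "totient (gcd a b) > 0" by simp
  have "totient a * totient b * totient (gcd a b) \<le> totient a * totient b * gcd a b"
    by (intro mult_le_mono2 totient_le)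
  also have "\<dots> = totient (a * b) * totient (gcd a b)" by (simp add: totient_gcd)
  finally show ?thesis using \<open>totient (gcd a b) > 0\<close> by (simp del: totient_gt_0_iff)
qed auto

text \<open>\<phi>(n) / n depends only on the set of primes dividing n.\<close>

lemma totient_mult_prime_factors_subset:
  assumes "prime_factors e \<subseteq> prime_factors d" "e > 0" "d > 0"
  shows "totient (d * e) = e * totient d"
proof -
  have "prime_factors (d * e) = prime_factors d"
    using assms by (auto simp: prime_factors_product)
  then have "real (totient (d * e)) = real (e * totient d)"
    using assms by (simp add: totient_formula2)
  then show ?thesis using of_nat_eq_iff by blast
qed

text \<open>In both half-period counts below, \<open>f\<close> is a reflection that preserves
  coprimality to e but leaves the set being counted.\<close>

lemma card_reflect_le:
  assumes "finite B" "A \<subseteq> B" "inj_on f A" "f ` A \<subseteq> B - A"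
  shows "2 * card A \<le> card B"
proof -
  have "card (A \<union> f ` A) = card A + card (f ` A)"
    using assms finite_subset[OF assms(2,1)] by (intro card_Un_disjoint) auto
  moreover have "card (A \<union> f ` A) \<le> card B" using assms by (intro card_mono) auto
  ultimately show ?thesis using card_image[OF assms(3)] by simp
qed

lemma half_period_card:
  fixes e m :: nat assumes "e > 0"
  shows "2 * card {a. a > 0 \<and> 2 * a < m * e \<and> coprime a e} \<le> m * totient e"
proof -
  let ?A = "{a. a > 0 \<and> 2 * a < m * e \<and> coprime a e}"
  have "coprime (m * e - a) e" if "coprime a e" "2 * a < m * e" for a
  proof -
    have "gcd (m * e - a) e dvd gcd a e"
    proof (rule gcd_greatest)
      have "gcd (m * e - a) e dvd m * e - (m * e - a)" by (rule dvd_diff_nat) auto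
      moreover have "m * e - (m * e - a) = a" using that by linarith
      ultimately show "gcd (m * e - a) e dvd a" by metis
    qed simp
    with that show ?thesis by (simp add: coprime_iff_gcd_eq_1)
  qed
  then have "2 * card ?A \<le> card {x. x < m * e \<and> coprime x e}"
    by (intro card_reflect_le[where f = "\<lambda>a. m * e - a"]) (auto intro!: inj_onI)
  also have "\<dots> \<le> m * totient e" by (rule card_coprime_below_mult[OF assms])
  finally show ?thesis .
qed

text \<open>The reflection takes place inside each block of length e: for a = e * q + r the image e
  * q + (e - r) differs from a by e - 2 * r, which is odd, so odd units go to even ones of the same
  block. For e = 1 the remainder is 0 and the image would leave the block; there a - 1 is
  used.\<close>

lemma half_period_card_odd:
  fixes e m :: nat assumes "odd e"
  shows "2 * card {a. odd a \<and> a < m * e \<and> coprime a e} \<le> m * totient e"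
proof (cases "e = 1")
  case True
  have "2 * card {a. odd a \<and> a < m * e \<and> coprime a e} \<le> card {..<m}"
  proof (rule card_reflect_le[where f = "\<lambda>a. a - 1"])
    show "inj_on (\<lambda>a. a - 1) {a. odd a \<and> a < m * e \<and> coprime a e}"
      by (rule inj_onI) (metis (mono_tags, lifting) One_nat_def mem_Collect_eq odd_Suc_minus_one)
  qed (auto simp: True)
  then show ?thesis using True by simp
next
  case False
  have e: "e > 1" using False assms by (cases e) auto
  let ?A = "{a. odd a \<and> a < m * e \<and> coprime a e}"
  let ?f = "\<lambda>a. e * (a div e) + (e - a mod e)"
  have f: "?f a div e = a div e" "?f a mod e = e - a mod e" "even (?f a)" "coprime (?f a) e"
    if "a \<in> ?A" for a
  proof -
    have r: "coprime (a mod e) e" using that e by (simp add: coprime_mod_left_iff)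
    then have "a mod e \<noteq> 0" using e by (intro notI) simp
    then have lt: "0 < a mod e" "a mod e < e" "e - a mod e < e" using e by auto
    have eq: "?f a = (e - a mod e) + (a div e) * e" by simp
    have "?f a div e = (e - a mod e) div e + a div e" unfolding eq using e by (intro div_mult_self1[THEN trans]) auto
    then show "?f a div e = a div e" using lt by simp
    have "?f a mod e = (e - a mod e) mod e" unfolding eq by (rule mod_mult_self1)
    then show m: "?f a mod e = e - a mod e" using lt by simp
    have "?f a + 2 * (a mod e) = a + e"
      using lt mult_div_mod_eq[of e a] by linarith
    then have "even (?f a) \<longleftrightarrow> even (a + e)" by (metis dvd_add_left_iff dvd_triv_left)
    then show "even (?f a)" using that assms by simp
    have "gcd (e - a mod e) e = gcd (a mod e) e"
      using gcd_diff1_nat[of "a mod e" e] lt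
      by (metis gcd_diff2_nat gcd.commute less_imp_le)
    then have "coprime (?f a mod e) e" using r m by (simp add: coprime_iff_gcd_eq_1)
    then show "coprime (?f a) e" using e by (simp add: coprime_mod_left_iff)
  qed
  have "2 * card ?A \<le> card {x. x < m * e \<and> coprime x e}"
  proof (rule card_reflect_le[where f = ?f])
    show "inj_on ?f ?A"
    proof (rule inj_onI)
      fix a b assume a: "a \<in> ?A" and b: "b \<in> ?A" and "?f a = ?f b"
      then have "a div e = b div e" "e - a mod e = e - b mod e" using f by metis+
      moreover have "a mod e < e" "b mod e < e" using e by auto
      ultimately have "a div e = b div e" "a mod e = b mod e" by auto
      then show "a = b" by (metis div_mult_mod_eq)
    qed
    show "?f ` ?A \<subseteq> {x. x < m * e \<and> coprime x e} - ?A"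
    proof safe
      fix a assume a: "odd a" "a < m * e" "coprime a e"
      then have A: "a \<in> ?A" by simp
      have "?f a div e < m" using f(1)[OF A] a e by (simp add: less_mult_imp_div_less)
      then show "?f a < m * e" using e by (simp add: div_less_iff_less_mult)
      show "coprime (?f a) e" using f(4)[OF A] .
    next
      fix a assume a: "odd a" "a < m * e" "coprime a e" and odd: "odd (?f a)"
      have "even (?f a)" using a by (intro f(3)) simp
      with odd show False by blast
    qed
  qed auto
  also have "\<dots> \<le> m * totient e" using e by (intro card_coprime_below_mult) auto
  finally show ?thesis .
qed

section \<open>Comparing an order with a modulus above N\<close>

lemma dyadic_scale:
  fixes d N :: nat assumes "0 < d" "d \<le> N"
  obtains i where "2 ^ i * d \<le> N" "N < 2 ^ Suc i * d"
proof -
  let ?P = "\<lambda>i. N < 2 ^ Suc i * d"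
  have "N < 2 ^ N" by (rule less_exp)
  also have "\<dots> \<le> 2 ^ Suc N * d" using assms by (simp add: Suc_le_eq)
  finally have ex: "?P N" .
  define i where "i = (LEAST i. ?P i)"
  have i: "?P i" unfolding i_def by (rule LeastI[of ?P, OF ex])
  have "2 ^ i * d \<le> N"
  proof (cases i)
    case (Suc j)
    have "\<not> ?P j" using not_less_Least[of j ?P] Suc unfolding i_def[symmetric] by simp
    then show ?thesis using Suc by simp
  qed (use assms in simp)
  with i that show ?thesis by blast
qed

text \<open>\<open>m\<close> is the ceiling of M / N.\<close>

lemma ceiling_multiplier:
  fixes M N :: nat assumes "M > 0" "N > 0"
  obtains m where "(m - 1) * N < M" "M \<le> m * N" "m > 0"
proof
  let ?m = "(M - 1) div N + 1"
  have "(M - 1) div N * N \<le> M - 1" by (rule div_times_less_eq_dividend)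
  then have "(M - 1) div N * N < M" using assms(1) by linarith
  then show "(?m - 1) * N < M" by simp
  show "M \<le> ?m * N"
    using div_mult_mod_eq[of "M - 1" N] mod_less_divisor[OF assms(2), of "M - 1"] assms(1)
    unfolding add_mult_distrib by linarith
qed simp

text \<open>
  In the application \<open>u\<close> counts the units below \<open>Q / N\<close>, where \<open>2 ^ Suc a * R\<close> is \<open>Q\<close> or \<open>2 * Q\<close>,
  and the hypothesis is the half-period estimate for the divisors \<open>e\<close> of \<open>R\<close>. The conclusion supplies
  a modulus \<open>z = 2 ^ Suc k * d > N\<close> or \<open>z = 3 * 2 ^ k * d > N\<close> with \<open>u * totient z\<close> at most \<open>totient Q\<close>. Let \<open>e\<close> be the
  largest divisor of \<open>R\<close> with \<open>e * N < 2 ^ (a + 2) * R\<close>. If it is not too small, \<open>R div e\<close> times a power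
  of two works. Otherwise every prime \<open>p\<close> dividing \<open>R div e\<close> exceeds \<open>2 ^ (a + 2)\<close>, in particular
  3 does not divide \<open>d = R div (e * p)\<close>; depending on where \<open>N / d\<close> lies between two consecutive powers
  of two, \<open>d\<close> times a power of two or three times a power of two works.
\<close>

lemma comparison_modulus:
  fixes a R N u :: nat
  assumes "odd R" "N > 0" "N < 2 ^ Suc a * R"
    and U': "\<forall>e m. e dvd R \<longrightarrow> 2 ^ Suc a * R \<le> m * e * N \<longrightarrow> 2 * u \<le> m * totient e"
  obtains (same) d e k where "R = d * e" "e = 1 \<Longrightarrow> R \<le> N" "N < 2 ^ Suc k * d"
      "u * 2 ^ k \<le> 2 ^ a * totient e"
    | (triple) d e p k where "R = d * (p * e)" "prime p" "p > 2 ^ (a + 2)" "\<not> 3 dvd d"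
      "k \<ge> 1" "N < 3 * 2 ^ k * d" "4 * u * 2 ^ k < (2 ^ Suc a + 1) * p * totient e"
proof -
  note U = U'[rule_format]
  have R: "R > 0" using assms(1) by (auto intro: odd_pos)
  let ?S = "{e. e dvd R \<and> e * N < 2 * (2 ^ Suc a * R)}"
  have fin: "finite ?S" using R by (auto intro: finite_subset[OF _ finite_divisors_nat])
  have "1 \<in> ?S" using assms(3) by simp
  define e where "e = Max ?S"
  have e: "e \<in> ?S" unfolding e_def using fin \<open>1 \<in> ?S\<close> by (intro Max_in) auto
  then obtain f where f: "R = e * f" by auto
  have pos: "e > 0" "f > 0" using R f by auto
  show thesis
  proof (cases "2 ^ Suc a * R \<le> 2 ^ Suc a * (e * N)")
    case True
    then have "f \<le> N" using f pos by simp
    \<comment> \<open>2 ^ Suc i * f is the first number of this shape above N. Because i \<le> a +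
      1, the half-period estimate can be applied with the integral multiplier 2 ^ (Suc a -
      i).\<close>
    then obtain i where i: "2 ^ i * f \<le> N" "N < 2 ^ Suc i * f" using dyadic_scale pos by blast
    have "e * N < e * (2 ^ Suc (Suc a) * f)" using e f by (simp add: algebra_simps)
    then have "N < 2 ^ Suc (Suc a) * f" using pos by simp
    with i(1) have "2 ^ i * f < 2 ^ Suc (Suc a) * f" by linarith
    then have "i < Suc (Suc a)" using pos power_less_imp_less_exp[of "2::nat" i "Suc (Suc a)"] by simp
    then have split: "(2::nat) ^ Suc a = 2 ^ (Suc a - i) * 2 ^ i" by (simp flip: power_add)
    have "2 ^ Suc a * R = 2 ^ (Suc a - i) * e * (2 ^ i * f)" unfolding f split by (simp add: algebra_simps)
    also have "\<dots> \<le> 2 ^ (Suc a - i) * e * N" using i(1) by (rule mult_le_mono2)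
    finally have "2 * u \<le> 2 ^ (Suc a - i) * totient e" using e by (intro U) auto
    then have "2 * u * 2 ^ i \<le> 2 ^ (Suc a - i) * totient e * 2 ^ i" by (rule mult_le_mono1)
    also have "\<dots> = 2 ^ Suc a * totient e" unfolding split by (simp add: algebra_simps)
    finally have "u * 2 ^ i \<le> 2 ^ a * totient e" by simp
    then show thesis using i f True by (intro same[of f e i]) (auto simp: algebra_simps)
  next
    case False
    then have gap: "2 ^ Suc a * (e * N) < 2 ^ Suc a * R" by simp
    have big: "q > 2 ^ (a + 2)" if "prime q" "q dvd f" for q
    proof -
      have q: "q > 1" "e * q dvd R" using that f prime_gt_1_nat by auto
      have "\<not> e * q \<le> e" using q pos by simp
      then have "e * q \<notin> ?S" using Max_ge[OF fin, of "e * q"] unfolding e_def[symmetric] by blast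
      then have "2 * (2 ^ Suc a * R) \<le> e * q * N" using q by simp
      then have "2 * (2 ^ Suc a * (e * N)) < e * q * N" using gap by linarith
      then have "2 ^ (a + 2) * (e * N) < q * (e * N)" by (simp add: algebra_simps)
      then show ?thesis by simp
    qed
    have "f \<noteq> 1" using gap f pos assms(2) by auto
    then obtain p where p: "prime p" "p dvd f" using prime_factor_nat by blast
    then obtain d where d: "f = p * d" by auto
    have "d > 0" using d pos by simp
    have R_eq: "R = d * (p * e)" using f d by (simp add: algebra_simps)
    have pb: "p > 2 ^ (a + 2)" using big p by blast
    have three: "\<not> 3 dvd d"
    proof
      assume "3 dvd d"
      then have "2 ^ (a + 2) < (3::nat)" using big[of 3] d by auto
      moreover have "(4::nat) \<le> 2 ^ (a + 2)" by simp
      ultimately show False by linarith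
    qed
    have "p > 1" using p(1) prime_gt_1_nat by blast
    have "e * p \<notin> ?S" using Max_ge[OF fin, of "e * p"] \<open>p > 1\<close> pos unfolding e_def[symmetric] by auto
    moreover have "e * p dvd R" unfolding R_eq by simp
    ultimately have "\<not> e * p * N < 2 * (2 ^ Suc a * R)" by blast
    then have "2 * (2 ^ Suc a * R) \<le> e * p * N" by (rule leI)
    then have "(e * p) * (2 ^ (a + 2) * d) \<le> (e * p) * N" unfolding R_eq by (simp add: algebra_simps)
    then have dN: "2 ^ (a + 2) * d \<le> N" using pos \<open>p > 1\<close> by simp
    moreover have "1 * d \<le> 2 ^ (a + 2) * d" by (intro mult_le_mono1) simp
    ultimately have "d \<le> N" by linarith
    then obtain i where i: "2 ^ i * d \<le> N" "N < 2 ^ Suc i * d" using dyadic_scale \<open>d > 0\<close> by blast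
    have "2 ^ (a + 2) * d < 2 ^ Suc i * d" using dN i by linarith
    then have "a + 2 < Suc i" using power_less_imp_less_exp[of "2::nat" "a + 2" "Suc i"] by simp
    then have ia: "i \<ge> a + 2" by simp
    have "e * N < e * (p * d)" using gap unfolding R_eq by (simp add: algebra_simps)
    then have Np: "N < p * d" by simp
    obtain m where m: "(m - 1) * N < 2 ^ Suc a * p * d" "2 ^ Suc a * p * d \<le> m * N" "m > 0"
      using ceiling_multiplier[of "2 ^ Suc a * p * d" N] \<open>p > 1\<close> \<open>d > 0\<close> assms(2) by auto
    have "2 ^ Suc a * R = e * (2 ^ Suc a * p * d)" unfolding R_eq by (simp add: algebra_simps)
    also have "\<dots> \<le> e * (m * N)" using m(2) by (rule mult_le_mono2)
    finally have um: "2 * u \<le> m * totient e" using e by (intro U) (auto simp: algebra_simps)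
    \<comment> \<open>Halfway between 2 ^ i * d and 2 ^ Suc i * d lies 3 * 2 ^ (i - 1) * d; for odd
      d prime to 3 its totient 2 ^ (i - 1) * \<phi>(d) is only half of the totient of 2 ^ Suc i * d.
      It serves as z unless N has already reached it.\<close>
    show thesis
    proof (cases "3 * (2 ^ i * d) \<le> 2 * N")
      case True
      have "2 ^ i * 3 * d * ((m - 1) * N) \<le> 2 * N * ((m - 1) * N)"
        using True by (intro mult_le_mono1) (simp add: algebra_simps)
      also have "\<dots> \<le> 2 * N * (2 ^ Suc a * p * d)" using m(1) by (intro mult_le_mono2) simp
      finally have "(d * N) * (3 * 2 ^ i * (m - 1)) \<le> (d * N) * (2 ^ Suc a * 2 * p)"
        by (simp add: algebra_simps)
      then have 1: "3 * 2 ^ i * (m - 1) \<le> 2 ^ Suc a * 2 * p" using \<open>d > 0\<close> assms(2) by simp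
      have "(3 * 2 ^ i) * d < (2 * p) * d" using True Np by (simp only: mult.assoc)
      then have 2: "3 * 2 ^ i < 2 * p" by (rule mult_less_cancel2[THEN iffD1, THEN conjunct2])
      have "m = (m - 1) + 1" using m(3) by simp
      then have "3 * 2 ^ i * m = 3 * 2 ^ i * (m - 1) + 3 * 2 ^ i" by (metis distrib_left mult.right_neutral)
      with 1 2 have "3 * (2 ^ i * m) < 2 ^ Suc a * 2 * p + 2 * p" by simp
      moreover have "2 * p \<le> 2 ^ Suc a * p" by simp
      ultimately have lt: "2 ^ i * m < 2 ^ Suc a * p" by linarith
      \<comment> \<open>Both sides of the strict inequality are multiples of 2 ^ Suc a; dividing and
        rounding down replaces p by p - 1 = \<phi>(p).\<close>
      have split: "(2::nat) ^ i = 2 ^ Suc a * 2 ^ (i - Suc a)" using ia by (simp flip: power_add power_Suc)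
      have "2 ^ (i - Suc a) * m < p" using lt unfolding split by (simp add: mult.assoc)
      then have "2 ^ (i - Suc a) * m \<le> p - 1" by linarith
      then have "2 ^ i * m \<le> 2 ^ Suc a * (p - 1)" unfolding split mult.assoc by (rule mult_le_mono2)
      have "2 * u * 2 ^ i \<le> m * totient e * 2 ^ i" using um by (rule mult_le_mono1)
      also have "\<dots> = 2 ^ i * m * totient e" by (simp add: algebra_simps)
      also have "\<dots> \<le> 2 ^ Suc a * (p - 1) * totient e" by (rule mult_le_mono1) fact
      also have "\<dots> \<le> 2 ^ Suc a * totient (p * e)"
        using totient_mult_ge[of p e] totient_prime[OF p(1)] by simp
      finally have "u * 2 ^ i \<le> 2 ^ a * totient (p * e)" by simp
      then show thesis using i R_eq \<open>p > 1\<close> by (intro same[of d "p * e" i]) auto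
    next
      case False
      define k where "k = i - 1"
      have k: "i = Suc k" "k \<ge> 1" using ia k_def by auto
      have "2 ^ i * d * ((m - 1) * N) \<le> N * ((m - 1) * N)"
        using i by (intro mult_le_mono1)
      also have "\<dots> \<le> N * (2 ^ Suc a * p * d)" using m(1) by (intro mult_le_mono2) simp
      finally have "(d * N) * (2 ^ i * (m - 1)) \<le> (d * N) * (2 ^ Suc a * p)"
        by (simp add: algebra_simps)
      then have 1: "2 ^ i * (m - 1) \<le> 2 ^ Suc a * p" using \<open>d > 0\<close> assms(2) by simp
      have "2 ^ i * d < p * d" using i Np by linarith
      then have 2: "2 ^ i < p" by simp
      have "m = (m - 1) + 1" using m(3) by simp
      then have "2 ^ i * m = 2 ^ i * (m - 1) + 2 ^ i" by (metis distrib_left mult.right_neutral)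
      with 1 2 have lt: "2 ^ i * m < (2 ^ Suc a + 1) * p" by simp
      have "4 * u * 2 ^ k = 2 * u * 2 ^ i" using k by simp
      also have "\<dots> \<le> m * totient e * 2 ^ i" using um by (rule mult_le_mono1)
      also have "\<dots> = 2 ^ i * m * totient e" by (simp add: algebra_simps)
      also have "\<dots> < (2 ^ Suc a + 1) * p * totient e" using lt pos by simp
      finally have "4 * u * 2 ^ k < (2 ^ Suc a + 1) * p * totient e" .
      moreover have "N < 3 * 2 ^ k * d" using False unfolding k(1) by (simp add: algebra_simps)
      ultimately show thesis using k(2) R_eq p(1) pb three by (intro triple[of d p e k])
    qed
  qed
qed

lemma prime_factors_two_power_mult:
  fixes d :: nat assumes "d > 0"
  shows "prime_factors (2 ^ Suc k * d) = insert 2 (prime_factors d)"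
proof -
  have "prime_factors ((2::nat) ^ Suc k) = {2}"
    by (subst prime_factorization_prime_power) auto
  with assms show ?thesis by (simp add: prime_factors_product del: power_Suc)
qed

lemma totient_two_power_mult:
  assumes "odd d" shows "totient (2 ^ Suc k * d) = 2 ^ k * totient d"
proof -
  have "coprime (2 ^ Suc k) d" using assms by simp
  then show ?thesis using totient_prime_power_Suc[of 2 k] by (simp add: totient_mult_coprime del: power_Suc)
qed

lemma odd_part:
  fixes Q :: nat assumes "even Q" "Q > 0"
  obtains a R where "Q = 2 ^ Suc a * R" "odd R"
proof -
  obtain R where R: "Q = 2 ^ multiplicity 2 Q * R" "odd R"
    using multiplicity_decompose'[of Q 2] assms by auto
  have "multiplicity 2 Q > 0" using assms by (simp add: prime_multiplicity_gt_zero_iff)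
  then obtain a where "multiplicity 2 Q = Suc a" using gr0_implies_Suc by blast
  with R that show thesis by metis
qed

abbreviation omega :: "nat \<Rightarrow> nat" where "omega z \<equiv> card (prime_factors z)"

text \<open>For Q > 1 these and their negatives are the unit residues r modulo Q for which r / Q is
  closer than 1 / N to an integer.\<close>

definition small_units :: "nat \<Rightarrow> nat \<Rightarrow> nat set" where
  "small_units N Q = {a. a > 0 \<and> a * N < Q \<and> coprime a Q}"

lemma finite_small_units: "N > 0 \<Longrightarrow> finite (small_units N Q)"
proof (rule finite_subset)
  assume "N > 0"
  have "a \<le> Q" if "a * N < Q" for a
    using that \<open>N > 0\<close> mult_le_mono2[of 1 N a] by linarith
  then show "small_units N Q \<subseteq> {..Q}"
    unfolding small_units_def by auto
qed simp

text \<open>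
  Passing from \<open>Q\<close> to \<open>z = 3 * 2 ^ k * d\<close> may add the primes 2 and 3. This is paid for by the prime \<open>p\<close>
  lost on the way, or else by the larger factor \<open>p\<close> instead of \<open>p - 1\<close> in \<open>totient Q\<close>.
\<close>

lemma triple_bound:
  fixes b n u A :: nat
  assumes big: "\<And>z. z > N \<Longrightarrow> totient z + 2 * omega z > 2 * n"
    and "b + omega Q \<le> n"
    and Q: "totient Q = A * totient (d * (p * e))" "prime_factors (d * (p * e)) \<subseteq> prime_factors Q"
    and d: "odd d" "\<not> 3 dvd d" and e: "e > 0"
    and p: "prime p" "p > 4 * A" and A: "A \<ge> 1"
    and k: "k \<ge> 1" "N < 3 * 2 ^ k * d" and u: "4 * u * 2 ^ k < (2 * A + 1) * p * totient e"
  shows "2 * b * u < totient Q"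
proof -
  let ?z = "3 * 2 ^ k * d"
  have d0: "d > 0" using d by (auto intro: odd_pos)
  obtain j where j: "k = Suc j" using k(1) by (cases k) auto
  have "coprime (3::nat) (2 ^ k * d)"
    using d prime_imp_coprime[of 3 d] by (simp add: coprime_power_right_iff)
  then have "totient ?z = totient 3 * totient (2 ^ k * d)"
    by (simp add: totient_mult_coprime mult.assoc)
  then have tz: "totient ?z = 2 ^ k * totient d"
    unfolding j totient_two_power_mult[OF d(1)] by (simp add: totient_prime)
  have "prime_factors ?z = insert 3 (prime_factors (2 ^ k * d))"
    using d0 by (simp add: mult.assoc prime_factors_product prime_prime_factors)
  then have pz: "prime_factors ?z = insert 3 (insert 2 (prime_factors d))"
    unfolding j prime_factors_two_power_mult[OF d0] .
  have oz: "omega ?z \<le> omega d + 2"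
    unfolding pz by (simp add: card_insert_if)
  have lt: "2 * b + 2 * omega Q < totient ?z + 2 * omega ?z"
    using big[OF k(2)] assms(2) by linarith
  have "3 * 1 * 1 \<le> ?z" using d0 by (intro mult_le_mono) auto
  then have "?z > 2" by linarith
  then have ev: "even (totient ?z)" by (rule totient_even)
  have pd: "prime_factors d \<subseteq> prime_factors Q" "p \<in> prime_factors Q"
    using Q(2) d0 e p(1) by (auto simp: prime_factors_product prime_prime_factors prime_gt_0_nat)
  have uz: "4 * u * totient ?z < (2 * A + 1) * p * totient e * totient d"
    using u d0 unfolding tz by (simp add: mult.assoc[symmetric])
  have p4: "p > 4" using p(2) A by linarith
  show ?thesis
  proof (cases "p dvd d")
    case False
    then have "card (insert p (prime_factors d)) \<le> omega Q"
      using pd by (intro card_mono) auto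
    moreover have "p \<notin> prime_factors d" using False by auto
    ultimately have "omega d + 1 \<le> omega Q" by simp
    \<comment> \<open>One prime too many costs 2, which parity absorbs: both sides are even.\<close>
    then have "2 * b < totient ?z + 2" using lt oz by linarith
    then have b: "2 * b \<le> totient ?z" using ev by presburger
    have tQ: "A * ((p - 1) * totient e * totient d) \<le> totient Q"
    proof -
      have "(p - 1) * totient e * totient d \<le> totient (p * e) * totient d"
        using totient_mult_ge[of p e] totient_prime[OF p(1)] by simp
      also have "\<dots> \<le> totient (d * (p * e))"
        using totient_mult_ge[of d "p * e"] by (simp add: mult.commute)
      finally show ?thesis using Q(1) by simp
    qed
    have "(2 * A + 1) * p \<le> 4 * A * (p - 1)"
    proof -
      obtain q where q: "p = Suc q" "q \<ge> 4 * A" using p(2) by (cases p) auto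
      obtain B where B: "A = Suc B" using A by (cases A) auto
      show ?thesis unfolding q(1) using q(2) unfolding B by (simp add: algebra_simps)
    qed
    then have "(2 * A + 1) * p * (totient e * totient d) \<le> 4 * A * (p - 1) * (totient e * totient d)"
      by (rule mult_le_mono1)
    also have "\<dots> = 4 * (A * ((p - 1) * totient e * totient d))" by (simp add: algebra_simps)
    finally have "(2 * A + 1) * p * totient e * totient d \<le> 4 * totient Q"
      using tQ by (simp only: mult.assoc)
    moreover have "4 * (2 * b * u) \<le> 4 * u * totient ?z" using mult_le_mono2[OF b, of "4 * u"] by (simp add: algebra_simps)
    ultimately show ?thesis using uz by linarith
  next
    case True
    have "omega d \<le> omega Q" using pd by (intro card_mono) auto
    then have "2 * b < totient ?z + 4" using lt oz by linarith
    then have b: "2 * b \<le> totient ?z + 2" using ev by presburger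
    have "p - 1 \<le> totient d"
      using totient_dvd[OF True] totient_prime[OF p(1)] d0 by (simp add: dvd_imp_le)
    then have "4 \<le> totient d" using p4 by linarith
    moreover have "(2::nat) ^ 1 \<le> 2 ^ k" using k(1) by (intro power_increasing) auto
    ultimately have "2 * 4 \<le> totient ?z" unfolding tz by (intro mult_le_mono) auto
    \<comment> \<open>Here z may have two primes more than Q. The surplus 2 is at most a quarter of
      \<open>totient ?z\<close>; the factor 5 / 4 is affordable because p enters \<phi>(Q)
      undiminished and 5 * (2 * A + 1) \<le> 16 * A.\<close>
    with b have b: "8 * b \<le> 5 * totient ?z" by linarith
    have tQ: "A * (p * totient e * totient d) \<le> totient Q"
    proof -
      have "prime_factors p \<subseteq> prime_factors d"
        using True d0 p(1) by (simp add: dvd_prime_factors)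
      then have "totient (d * p) = p * totient d"
        using d0 p(1) by (intro totient_mult_prime_factors_subset) (auto simp: prime_gt_0_nat)
      then have "p * totient e * totient d \<le> totient (d * (p * e))"
        using totient_mult_ge[of "d * p" e] by (simp add: algebra_simps)
      then show ?thesis using Q(1) by simp
    qed
    have "5 * (2 * A + 1) \<le> 16 * A" using A by simp
    then have "5 * (2 * A + 1) * (p * totient e * totient d) \<le> 16 * A * (p * totient e * totient d)"
      by (rule mult_le_mono1)
    also have "\<dots> \<le> 16 * totient Q" using tQ by (simp add: mult.assoc)
    finally have 1: "5 * ((2 * A + 1) * p * totient e * totient d) \<le> 16 * totient Q" by (simp only: mult.assoc)
    have 2: "16 * (2 * b * u) \<le> 5 * (4 * u * totient ?z)"
      using mult_le_mono2[OF b, of "4 * u"] by (simp add: algebra_simps)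
    show ?thesis using 1 2 uz by linarith
  qed
qed

text \<open>Counting negatives, at most 2 * u of the \<phi>(Q) unit residues are bad, so failure
  becomes less likely than 1 / b. If z > N has at most as many primes as Q and u * \<phi>(z) \<le>
  \<phi>(Q), then \<open>big\<close> gives 2 * b < \<phi>(z), and multiplying by u finishes. The
  remaining cases are those in which z has more primes.\<close>

lemma small_units_bound:
  fixes b n N Q :: nat
  assumes big: "\<And>z. z > N \<Longrightarrow> totient z + 2 * omega z > 2 * n"
    and b: "b + omega Q \<le> n" and N: "N > 0" "N < Q"
  shows "2 * b * card (small_units N Q) < totient Q"
proof -
  let ?A = "small_units N Q"
  define u where "u = card ?A"
  have "1 \<in> ?A" using N by (simp add: small_units_def)
  then have u0: "u > 0" using finite_small_units[OF N(1)] unfolding u_def card_gt_0_iff by blast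
  have concl: "2 * b * u < totient Q"
    if "z > N" "omega z \<le> omega Q" "u * totient z \<le> totient Q" for z
  proof -
    have "2 * b < totient z" using big[OF that(1)] that(2) b by linarith
    then have "2 * b * u < totient z * u" using u0 by simp
    also have "\<dots> = u * totient z" by (rule mult.commute)
    also note that(3)
    finally show ?thesis .
  qed
  have "2 * b * u < totient Q"
  proof (cases "even Q")
    case True
    obtain a R where Q: "Q = 2 ^ Suc a * R" "odd R" using odd_part[OF True] N by auto
    have R0: "R > 0" using Q(2) by (auto intro: odd_pos)
    have tQ: "totient Q = 2 ^ a * totient R" unfolding Q(1) by (rule totient_two_power_mult[OF Q(2)])
    have pQ: "prime_factors Q = insert 2 (prime_factors R)"
      unfolding Q(1) by (rule prime_factors_two_power_mult[OF R0])
    have U: "2 * u \<le> m * totient e" if "e dvd R" "2 ^ Suc a * R \<le> m * e * N" for e m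
    proof -
      have "odd e" using that(1) Q(2) by auto
      have "?A \<subseteq> {a. odd a \<and> a < m * e \<and> coprime a e}"
      proof
        fix x assume "x \<in> ?A"
        then have x: "x * N < Q" "coprime x Q" by (auto simp: small_units_def)
        have "x * N < m * e * N" using x(1) that(2) Q(1) by linarith
        moreover have "coprime x 2" using x(2) True by (rule coprime_divisors[OF dvd_refl, rotated])
        moreover have "e dvd Q" using that(1) Q(1) by simp
        then have "coprime x e" using x(2) by (rule coprime_divisors[OF dvd_refl])
        ultimately show "x \<in> {a. odd a \<and> a < m * e \<and> coprime a e}" by (auto simp: coprime_right_2_iff_odd)
      qed
      then have "u \<le> card {a. odd a \<and> a < m * e \<and> coprime a e}"
        unfolding u_def by (intro card_mono) auto
      with half_period_card_odd[OF \<open>odd e\<close>, of m] show ?thesis by linarith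
    qed
    have "N < 2 ^ Suc a * R" using N Q by simp
    moreover have "\<forall>e m. e dvd R \<longrightarrow> 2 ^ Suc a * R \<le> m * e * N \<longrightarrow> 2 * u \<le> m * totient e"
      using U by blast
    ultimately show ?thesis
    proof (rule comparison_modulus[OF Q(2) N(1)], goal_cases same triple)
      case (same d e k)
      have d: "odd d" "d > 0" using same(1) Q(2) R0 by auto
      have "prime_factors (2 ^ Suc k * d) \<subseteq> prime_factors Q"
        unfolding prime_factors_two_power_mult[OF d(2)] pQ using same(1) R0 by (auto simp: prime_factors_product)
      then have 1: "omega (2 ^ Suc k * d) \<le> omega Q" by (intro card_mono) auto
      have "u * totient (2 ^ Suc k * d) = u * 2 ^ k * totient d"
        unfolding totient_two_power_mult[OF d(1)] by simp
      also have "\<dots> \<le> 2 ^ a * totient e * totient d" using same(4) by (rule mult_le_mono1)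
      also have "\<dots> \<le> totient Q"
        using totient_mult_ge[of d e] unfolding tQ same(1) by (simp add: algebra_simps)
      finally show ?thesis using concl[OF same(3) 1] by blast
    next
      case (triple d e p k)
      have "odd d" "e > 0" using triple(1) Q(2) R0 by auto
      then show ?thesis using triple tQ pQ
        by (intro triple_bound[OF big b, where A = "2 ^ a" and d = d and p = p and e = e and k = k]) auto
    qed
  next
    case False
    \<comment> \<open>For even Q the factor 2 came from the oddness of units; here it comes from the
      reflection in the middle of m periods, which is why 2 * Q takes the place of Q.\<close>
    have U: "2 * u \<le> m * totient e" if "e dvd Q" "2 ^ Suc 0 * Q \<le> m * e * N" for e m
    proof -
      have "e > 0" using that(1) N by (intro Nat.gr0I) auto
      have "?A \<subseteq> {a. a > 0 \<and> 2 * a < m * e \<and> coprime a e}"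
      proof
        fix x assume "x \<in> ?A"
        then have x: "x > 0" "x * N < Q" "coprime x Q" by (auto simp: small_units_def)
        have "2 * (x * N) < m * e * N" using x(2) that(2) unfolding power_Suc power_0 by linarith
        then have "2 * x < m * e" by (metis mult.assoc mult_less_cancel2)
        moreover have "coprime x e" using that(1) x(3) by (rule coprime_divisors[OF dvd_refl])
        ultimately show "x \<in> {a. a > 0 \<and> 2 * a < m * e \<and> coprime a e}" using x(1) by auto
      qed
      moreover have "finite {a. a > 0 \<and> 2 * a < m * e \<and> coprime a e}"
        by (rule finite_subset[of _ "{..m * e}"]) auto
      ultimately have "u \<le> card {a. a > 0 \<and> 2 * a < m * e \<and> coprime a e}"
        unfolding u_def by (intro card_mono)
      with half_period_card[OF \<open>e > 0\<close>, of m] show ?thesis by linarith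
    qed
    have "N < 2 ^ Suc 0 * Q" using N by simp
    moreover have "\<forall>e m. e dvd Q \<longrightarrow> 2 ^ Suc 0 * Q \<le> m * e * N \<longrightarrow> 2 * u \<le> m * totient e"
      using U by blast
    ultimately show ?thesis
    proof (rule comparison_modulus[OF False N(1)], goal_cases same triple)
      case (same d e k)
      have "odd e" and d: "odd d" "d > 0" "e > 0" using same(1) False by (auto intro: odd_pos)
      have "e > 1" using same(2) N d(3) by (cases "e = 1") auto
      have pz: "prime_factors (2 ^ Suc k * d) = insert 2 (prime_factors d)"
        by (rule prime_factors_two_power_mult[OF d(2)])
      have oz: "omega (2 ^ Suc k * d) \<le> omega d + 1" unfolding pz by (simp add: card_insert_if)
      have pQ: "prime_factors Q = prime_factors d \<union> prime_factors e"
        using same(1) d by (simp add: prime_factors_product)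
      have uz: "u * totient (2 ^ Suc k * d) \<le> totient d * totient e"
        using mult_le_mono1[OF same(4), of "totient d"]
        unfolding totient_two_power_mult[OF d(1)] by (simp add: algebra_simps)
      show ?thesis
      proof (cases "prime_factors e \<subseteq> prime_factors d")
        case True
        \<comment> \<open>The prime 2 is new and no prime is lost. Parity makes up for it, and
          strictness comes from \<phi>(e) < e in \<phi>(Q) = e * \<phi>(d).\<close>
        have "omega (2 ^ Suc k * d) \<le> omega Q + 1" using oz pQ True by (simp add: Un_absorb2)
        then have lt: "2 * b < totient (2 ^ Suc k * d) + 2"
          using big[OF same(3)] b by linarith
        have "2 * b \<le> totient (2 ^ Suc k * d)"
        proof (cases "2 ^ Suc k * d > 2")
          case True
          have parity: "even t \<Longrightarrow> 2 * b < t + 2 \<Longrightarrow> 2 * b \<le> t" for t :: nat by presburger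
          show ?thesis using parity[OF totient_even[OF True] lt] .
        next
          case 2: False
          moreover have "1 * d \<le> 2 ^ k * d" by (intro mult_le_mono1) simp
          moreover have "2 ^ Suc k * d = 2 * (2 ^ k * d)" by simp
          ultimately have "d = 1" using d(2) by linarith
          then have "prime_factors e = {}" using True by simp
          then have "e = 1" using d(3) by (simp add: prime_factorization_empty_iff)
          then show ?thesis using \<open>e > 1\<close> by simp
        qed
        then have "2 * b * u \<le> u * totient (2 ^ Suc k * d)" by (simp add: mult.commute)
        also have "\<dots> \<le> totient d * totient e" by (rule uz)
        also have "\<dots> < totient d * e" using totient_less[OF \<open>e > 1\<close>] d(2) by simp
        also have "\<dots> = totient Q"
          unfolding same(1) using totient_mult_prime_factors_subset[OF True d(3,2)] by simp
        finally show ?thesis .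
      next
        case False
        then obtain q where q: "q \<in> prime_factors e" "q \<notin> prime_factors d" by blast
        then have "card (insert q (prime_factors d)) \<le> omega Q" using pQ by (intro card_mono) auto
        then have "omega (2 ^ Suc k * d) \<le> omega Q" using oz q(2) by simp
        moreover have "u * totient (2 ^ Suc k * d) \<le> totient Q"
          using uz totient_mult_ge[of d e] unfolding same(1) by linarith
        ultimately show ?thesis using concl[OF same(3)] by blast
      qed
    next
      case (triple d e p k)
      have "odd d" "e > 0" using triple(1) False by (auto intro: odd_pos)
      then show ?thesis using triple
        by (intro triple_bound[OF big b, where A = "2 ^ 0" and d = d and p = p and e = e and k = k]) auto
    qed
  qed
  then show ?thesis unfolding u_def .
qed

section \<open>The function w\<close>

lemma h_fun_le_omega: "h_fun z \<le> omega z"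
  by (simp add: h_fun_def)

lemma w_fun_ge:
  assumes "z > 0" "totient z + 2 * h_fun z \<le> 2 * d" shows "z \<le> w_fun d"
proof -
  have "real (totient z + 2 * h_fun z) \<le> real (2 * d)" using assms(2) by (subst of_nat_le_iff)
  then show ?thesis unfolding w_fun_def
    using assms(1) by (intro Max_ge[OF finite_w_fun_set]) simp
qed

lemma w_fun_gt:
  assumes "z > w_fun d" shows "totient z + 2 * omega z > 2 * d"
  using w_fun_ge[of z d] assms h_fun_le_omega[of z] by linarith

lemma w_fun_attains:
  assumes "d \<ge> 1" shows "totient (w_fun d) + 2 * h_fun (w_fun d) \<le> 2 * d"
proof -
  have "w_fun d \<in> {z :: nat. z > 0 \<and> real (totient z) / 2 + real (h_fun z) \<le> real d}"
    unfolding w_fun_def using two_in_w_fun_set[OF assms] by (intro Max_in[OF finite_w_fun_set]) blast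
  then have "real (totient (w_fun d) + 2 * h_fun (w_fun d)) \<le> real (2 * d)" by simp
  then show ?thesis by (subst (asm) of_nat_le_iff)
qed

lemma w_fun_ge_omega:
  assumes "z > 0" "totient z + 2 * omega z \<le> 2 * d" shows "z \<le> w_fun d"
  using assms h_fun_le_omega[of z] by (intro w_fun_ge) linarith+

lemma w_fun_ge_two_power:
  assumes "odd r" "r > 0" "2 ^ k * totient r + 2 * (omega r + 1) \<le> 2 * d"
  shows "2 ^ Suc k * r \<le> w_fun d"
proof -
  define z where "z = 2 ^ Suc k * r"
  have "omega z \<le> omega r + 1"
    unfolding z_def prime_factors_two_power_mult[OF assms(2)] by (simp add: card_insert_if)
  moreover have "totient z = 2 ^ k * totient r" unfolding z_def by (rule totient_two_power_mult[OF assms(1)])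
  ultimately have "totient z + 2 * omega z \<le> 2 * d" using assms(3) by simp
  moreover have "z > 0" using assms(2) by (simp add: z_def)
  ultimately show ?thesis unfolding z_def[symmetric] by (rule w_fun_ge_omega[rotated])
qed

section \<open>Elementary lower bounds on \<open>w_fun\<close> and orders with a large prime
  divisor\<close>

lemma omega_prime: "prime p \<Longrightarrow> omega p = 1"
  by (simp add: prime_prime_factors)

lemma w_fun_small: "w_fun 1 \<ge> 3" "w_fun 2 \<ge> 5" "w_fun 3 \<ge> 8" "w_fun 4 \<ge> 12"
proof -
  show "w_fun 1 \<ge> 3" by (rule w_fun_ge) (auto simp: h_fun_def totient_prime)
  show "w_fun 2 \<ge> 5" by (rule w_fun_ge) (auto simp: h_fun_def totient_prime)
  show "w_fun 3 \<ge> 8" using w_fun_ge_two_power[of 1 2 3] by simp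
  show "w_fun 4 \<ge> 12" using w_fun_ge_two_power[of 3 1 4] omega_prime[of 3] by (simp add: totient_prime)
qed

text \<open>Let 2 ^ l be the largest power of two up to n. The witnesses are 3 * 2 ^ (l + 1) for n
  \<ge> 2 ^ l + 2, 2 ^ (l + 2) for n = 2 ^ l + 1, and 15 * 2 ^ (l - 2) for n = 2 ^ l.\<close>

lemma w_fun_ge_three_mult:
  assumes "n \<ge> 5" shows "3 * n + 1 \<le> w_fun n"
proof -
  obtain l where l: "2 ^ l \<le> n" "n < 2 ^ Suc l" using dyadic_scale[of 1 n] assms by auto
  have three: "totient 3 = 2" "omega 3 = 1" by (simp_all add: totient_prime omega_prime)
  have "l \<ge> 2"
  proof (rule ccontr)
    assume "\<not> l \<ge> 2"
    then have "(2::nat) ^ Suc l \<le> 2 ^ 2" by (intro power_increasing) auto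
    with l assms show False by simp
  qed
  consider "n = 2 ^ l" | "n = 2 ^ l + 1" | "n \<ge> 2 ^ l + 2" using l by linarith
  then show ?thesis
  proof cases
    case 1
    with assms have "l \<noteq> 2" by auto
    with \<open>l \<ge> 2\<close> obtain k where k: "l = Suc (Suc (Suc k))"
      by (metis Suc_diff_le Suc_le_D le_antisym not_less_eq_eq numeral_2_eq_2)
    have "totient (3 * 5) = 2 * 4"
      by (subst totient_mult_coprime) (auto simp: totient_prime intro!: primes_coprime)
    then have t: "totient 15 = 8" by simp
    have "prime_factors (3 * 5) = {3, 5::nat}" by (subst prime_factors_product) (auto simp: prime_prime_factors)
    then have o: "omega 15 = 2" by simp
    have "(1::nat) \<le> 2 ^ k" by simp
    then have "3 \<le> 4 * (2::nat) ^ k" by linarith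
    then have "2 ^ Suc k * 15 \<le> w_fun n" using 1 k t o by (intro w_fun_ge_two_power) auto
    with 1 k \<open>3 \<le> 4 * 2 ^ k\<close> show ?thesis by simp
  next
    case 2
    have "2 ^ Suc (Suc l) * 1 \<le> w_fun n" using 2 by (intro w_fun_ge_two_power) auto
    with 2 assms show ?thesis by simp
  next
    case 3
    have "2 ^ Suc l * 3 \<le> w_fun n" using 3 three by (intro w_fun_ge_two_power) auto
    with l show ?thesis by simp
  qed
qed

lemma w_fun_gt_double: "n \<ge> 1 \<Longrightarrow> 2 * n < w_fun n"
proof -
  assume "n \<ge> 1"
  then consider "n = 1" | "n = 2" | "n = 3" | "n = 4" | "n \<ge> 5" by linarith
  then show ?thesis using w_fun_small w_fun_ge_three_mult[of n] by cases auto
qed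

text \<open>If N = w(n) \<ge> 3 * n + 1, then (m - 1) * N \<le> 2 * P - 1 and N \<le> P - 1 add up
  to m * N \<le> 3 * P - 2, hence 3 * n * m \<le> m * (N - 1) \<le> 3 * (P - 1). Otherwise n \<le>
  4, and \<open>w_fun_small\<close> suffices once composite values of P near N are excluded.\<close>

lemma large_prime_multiplier:
  assumes n: "n \<ge> 1" and P: "prime P" "P > w_fun n" and m: "(m - 1) * w_fun n < 2 * P" "m > 0"
  shows "n * m \<le> P - 1"
proof -
  define N where "N = w_fun n"
  obtain k where k: "m = Suc k" using m(2) gr0_implies_Suc by blast
  have kN: "k * N < 2 * P" "N < P" using m P k by (auto simp: N_def)
  have np: "\<not> prime (4::nat)" "\<not> prime (6::nat)" "\<not> prime (8::nat)" "\<not> prime (9::nat)"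
    "\<not> prime (10::nat)" "\<not> prime (12::nat)" "\<not> prime (14::nat)"
    by simp_all
  have excl: "P \<noteq> 4" "P \<noteq> 6" "P \<noteq> 8" "P \<noteq> 9" "P \<noteq> 10" "P \<noteq> 12" "P \<noteq> 14"
    using P(1) np by metis+
  show ?thesis
  proof (cases "3 * n + 1 \<le> N")
    case True
    then have "3 * n * m \<le> (N - 1) * m" by (intro mult_le_mono1) linarith
    moreover obtain N' where "N = Suc N'" using True by (cases N) auto
    ultimately have "3 * n * m \<le> k * N + N - 1" unfolding k by (simp add: algebra_simps)
    with kN have "3 * (n * m) \<le> 3 * (P - 1)" by linarith
    then show ?thesis by simp
  next
    case False
    have "n \<le> 4" using w_fun_ge_three_mult[of n] False unfolding N_def by linarith
    then consider "n = 1" | "n = 2" | "n = 3" | "n = 4" using n by linarith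
    then show ?thesis
    proof cases
      case 1
      then have N: "N \<ge> 3" using w_fun_small by (simp add: N_def)
      then have "k * 3 < 2 * P" using kN(1) mult_le_mono2[of 3 N k] by linarith
      moreover have "P \<ge> 5" using N kN(2) excl(1) by linarith
      ultimately show ?thesis using 1 k by simp
    next
      case 2
      then have N: "N \<ge> 5" using w_fun_small by (simp add: N_def)
      then have "k * 5 < 2 * P" using kN(1) mult_le_mono2[of 5 N k] by linarith
      moreover consider "P \<ge> 13" | "P = 7" | "P = 11" using N kN(2) excl by linarith
      then have "k * 5 < 2 * P \<Longrightarrow> 2 * Suc k \<le> P - 1" by cases simp_all
      ultimately show ?thesis using 2 k by simp
    next
      case 3
      then have N: "N \<ge> 8" using w_fun_small by (simp add: N_def)
      then have "k * 8 < 2 * P" using kN(1) mult_le_mono2[of 8 N k] by linarith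
      moreover consider "P \<ge> 15" | "P = 11" | "P = 13" using N kN(2) excl by linarith
      then have "k * 8 < 2 * P \<Longrightarrow> 3 * Suc k \<le> P - 1" by cases simp_all
      ultimately show ?thesis using 3 k by simp
    next
      case 4
      then have N: "N \<ge> 12" using w_fun_small by (simp add: N_def)
      then have "k * 12 < 2 * P" using kN(1) mult_le_mono2[of 12 N k] by linarith
      moreover consider "P \<ge> 15" | "P = 13" using N kN(2) excl by linarith
      then have "k * 12 < 2 * P \<Longrightarrow> 4 * Suc k \<le> P - 1" by cases simp_all
      ultimately show ?thesis using 4 k by simp
    qed
  qed
qed

text \<open>A prime above N is not repaid by an index of small order, so the estimate is made for
  all n indices. With Q = P * e and m the ceiling of 2 * P / N, the units below Q / N lie in the
  first half of m periods of length e.\<close>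

lemma small_units_bound_large_prime:
  assumes n: "n \<ge> 1" and P: "prime P" "P > w_fun n" "P dvd Q" and Q: "Q > 0"
  shows "2 * n * card (small_units (w_fun n) Q) \<le> totient Q"
proof -
  let ?N = "w_fun n" and ?A = "small_units (w_fun n) Q"
  obtain e where e: "Q = P * e" using P(3) by auto
  have e0: "e > 0" using e Q by simp
  have N0: "?N > 0" using w_fun_gt_double[OF n] by linarith
  have "2 * P > 0" using P(1) prime_gt_0_nat by simp
  then obtain m where m: "(m - 1) * ?N < 2 * P" "2 * P \<le> m * ?N" "m > 0"
    using ceiling_multiplier N0 by blast
  have "?A \<subseteq> {a. a > 0 \<and> 2 * a < m * e \<and> coprime a e}"
  proof
    fix a assume "a \<in> ?A"
    then have a: "a > 0" "a * ?N < P * e" "coprime a (P * e)" unfolding small_units_def e by auto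
    have "2 * a * ?N < 2 * P * e" using a(2) by simp
    also have "\<dots> \<le> m * ?N * e" using m(2) by (rule mult_le_mono1)
    finally have "(2 * a) * ?N < (m * e) * ?N" by (simp add: algebra_simps)
    then have "2 * a < m * e" by (metis mult_less_cancel2)
    then show "a \<in> {a. a > 0 \<and> 2 * a < m * e \<and> coprime a e}" using a by auto
  qed
  moreover have "finite {a. a > 0 \<and> 2 * a < m * e \<and> coprime a e}"
    by (rule finite_subset[of _ "{..m * e}"]) auto
  ultimately have "card ?A \<le> card {a. a > 0 \<and> 2 * a < m * e \<and> coprime a e}" by (intro card_mono)
  then have "2 * card ?A \<le> m * totient e" using half_period_card[OF e0, of m] by linarith
  then have "n * (2 * card ?A) \<le> n * (m * totient e)" by (rule mult_le_mono2)
  also have "\<dots> = n * m * totient e" by simp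
  also have "\<dots> \<le> (P - 1) * totient e"
    using large_prime_multiplier[OF n P(1,2) m(1,3)] by (rule mult_le_mono1)
  also have "\<dots> \<le> totient Q"
    unfolding e using totient_mult_ge[of P e] totient_prime[OF P(1)] by simp
  finally show ?thesis by (simp add: algebra_simps)
qed

text \<open>Supplies strictness in the union bound when q has no prime divisor up to N: there are at
  most (P - 1) / N small units, and N > 2 * n.\<close>

lemma small_units_bound_prime:
  assumes n: "n \<ge> 1" and P: "prime P" "P > w_fun n"
  shows "2 * n * card (small_units (w_fun n) P) < totient P"
proof -
  let ?N = "w_fun n" and ?A = "small_units (w_fun n) P"
  have N: "2 * n < ?N" by (rule w_fun_gt_double[OF n])
  have "?A \<subseteq> {1..(P - 1) div ?N}"
    using N by (auto simp: small_units_def less_eq_div_iff_mult_less_eq)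
  then have "card ?A \<le> (P - 1) div ?N" using card_mono[of "{1..(P - 1) div ?N}" ?A] by simp
  then have "card ?A * ?N \<le> P - 1"
    using N by (simp add: less_eq_div_iff_mult_less_eq)
  moreover have "1 \<in> ?A" using P by (simp add: small_units_def)
  then have "card ?A > 0" using finite_small_units[of ?N P] N unfolding card_gt_0_iff by auto
  then have "card ?A * (2 * n) < card ?A * ?N" using N by simp
  ultimately have "card ?A * (2 * n) < P - 1" by linarith
  then show ?thesis using totient_prime[OF P(1)] by (simp add: mult.commute)
qed

section \<open>Lonely rabbits\<close>

lemma coprime_if_no_common_prime:
  fixes x q :: nat
  assumes "\<And>p. prime p \<Longrightarrow> p dvd q \<Longrightarrow> \<not> p dvd x" shows "coprime x q"
  using assms by (metis coprime_iff_gcd_eq_1 gcd_dvd1 gcd_dvd2 prime_factor_nat dvd_trans)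

text \<open>With t the product of the primes of q that do not divide g, every prime divisor of q
  divides exactly one of the two summands of g + Q * t.\<close>

lemma coprime_lift:
  fixes g Q q :: nat assumes "Q dvd q" "coprime g Q" "q > 0"
  obtains g' where "coprime g' q" "[g' = g] (mod Q)"
proof
  define t where "t = \<Prod>{p \<in> prime_factors q. \<not> p dvd g}"
  have dvd_t: "p dvd t" if "prime p" "p dvd q" "\<not> p dvd g" for p
    unfolding t_def using that assms(3) by (intro dvd_prodI[where f = id, simplified]) (auto simp: prime_factors_dvd)
  have not_dvd_t: "\<not> p dvd t" if "prime p" "p dvd g" for p
  proof
    assume "p dvd t"
    have "finite {p \<in> prime_factors q. \<not> p dvd g}" by simp
    from prime_dvd_prod_iff[OF this that(1), THEN iffD1, OF \<open>p dvd t\<close>[unfolded t_def]]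
    obtain r where "r \<in> prime_factors q" "\<not> r dvd g" "p dvd r" by blast
    then show False using that primes_dvd_imp_eq[of p r] by auto
  qed
  have "\<not> p dvd g + Q * t" if p: "prime p" "p dvd q" for p
  proof (cases "p dvd g")
    case True
    have "\<not> p dvd Q" using True assms(2) p(1) by (meson coprime_common_divisor_nat not_prime_unit coprime_common_divisor)
    then have "\<not> p dvd Q * t" using not_dvd_t[OF p(1) True] p(1) by (simp add: prime_dvd_mult_iff)
    then show ?thesis using True by (simp add: dvd_add_right_iff)
  next
    case False
    then show ?thesis using dvd_t[OF p False] by (metis dvd_add_left_iff dvd_mult)
  qed
  then show "coprime (g + Q * t) q" by (rule coprime_if_no_common_prime)
  show "[g + Q * t = g] (mod Q)" by (simp add: cong_def)
qed

text \<open>For a unit residue s modulo Q, multiplication by a unit g modulo q with g * r congruent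
  to s modulo Q (from \<open>coprime_lift\<close>) embeds the fibre over r into the fibre over s. So
  none of the \<phi>(Q) disjoint fibres is smaller than the one over r.\<close>

lemma card_unit_fibre:
  fixes Q q c r :: nat
  assumes Q: "Q dvd q" "q > 0" and c: "coprime c Q" and r: "coprime r Q" "r < Q"
  shows "totient Q * card {k. k < q \<and> coprime k q \<and> k * c mod Q = r} \<le> totient q"
proof -
  define F where "F = (\<lambda>r. {k. k < q \<and> coprime k q \<and> k * c mod Q = r})"
  have fin: "finite (F s)" for s by (rule finite_subset[of _ "{..<q}"]) (auto simp: F_def)
  have le: "card (F r) \<le> card (F s)" if s: "coprime s Q" "s < Q" for s
  proof -
    obtain r' where r': "[r * r' = 1] (mod Q)" using cong_solve_coprime_nat[OF r(1)] by auto
    have "coprime (s * r') Q"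
      using s(1) r' by (metis coprime_1_left cong_imp_coprime cong_sym coprime_mult_left_iff)
    then obtain g where g: "coprime g q" "[g = s * r'] (mod Q)" using coprime_lift[OF Q(1) _ Q(2)] by blast
    have gr: "[g * r = s] (mod Q)"
    proof -
      have "[g * r = s * r' * r] (mod Q)" using g(2) by (rule cong_scalar_right)
      also have "s * r' * r = s * (r * r')" by simp
      also have "[\<dots> = s * 1] (mod Q)" using r' by (rule cong_scalar_left)
      finally show ?thesis by simp
    qed
    show ?thesis
    proof (rule card_inj_on_le[where f = "\<lambda>k. g * k mod q"])
      show "inj_on (\<lambda>k. g * k mod q) (F r)"
      proof (rule inj_onI)
        fix x y assume xy: "x \<in> F r" "y \<in> F r" "g * x mod q = g * y mod q"
        then have "[g * x = g * y] (mod q)" by (simp add: cong_def)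
        then have "[x = y] (mod q)" using g(1) by (simp add: cong_mult_lcancel_nat)
        then show "x = y" using xy by (simp add: F_def cong_def)
      qed
      show "(\<lambda>k. g * k mod q) ` F r \<subseteq> F s"
      proof clarify
        fix k assume k: "k \<in> F r"
        have "[g * k mod q * c = g * k * c] (mod Q)"
          using Q(1) by (intro cong_scalar_right) (auto simp: cong_def mod_mod_cancel)
        also have "g * k * c = g * (k * c)" by simp
        also have "[\<dots> = g * r] (mod Q)"
          using k r(2) by (intro cong_scalar_left) (auto simp: F_def cong_def)
        also note gr
        finally have "g * k mod q * c mod Q = s" using s(2) by (simp add: cong_def)
        moreover have "coprime (g * k mod q) q" using k g(1) Q(2) by (simp add: F_def coprime_mod_left_iff)
        ultimately show "g * k mod q \<in> F s" using Q(2) by (simp add: F_def)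
      qed
    qed (rule fin)
  qed
  have "Q > 0" using Q by (auto intro: dvd_pos_nat)
  then have "totient Q * card (F r) = (\<Sum>s | s < Q \<and> coprime s Q. card (F r))"
    using card_coprime_below[of Q] by simp
  also have "\<dots> \<le> (\<Sum>s | s < Q \<and> coprime s Q. card (F s))" using le by (intro sum_mono) auto
  also have "\<dots> = card (\<Union>s\<in>{s. s < Q \<and> coprime s Q}. F s)"
    using fin by (intro card_UN_disjoint[symmetric]) (auto simp: F_def)
  also have "\<dots> \<le> card {k. k < q \<and> coprime k q}" by (intro card_mono) (auto simp: F_def)
  also have "\<dots> = totient q" by (rule card_coprime_below[OF Q(2)])
  finally show ?thesis unfolding F_def .
qed

text \<open>Union bound over the units modulo q: by \<open>card_unit_fibre\<close> the index i
  excludes at most card (S i) * \<phi>(q) / \<phi>(Q i) \<le> \<phi>(q) / b of them, and some index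
  excludes strictly fewer than \<phi>(q) / b.\<close>

lemma exists_unit_avoiding:
  fixes q :: nat and b :: nat
  assumes "finite B" "q > 0" "card B = b" "b > 0"
    and Q: "\<And>i. i \<in> B \<Longrightarrow> Q i dvd q" "\<And>i. i \<in> B \<Longrightarrow> coprime (c i) (Q i)"
    and S: "\<And>i. i \<in> B \<Longrightarrow> finite (S i)" "\<And>i s. i \<in> B \<Longrightarrow> s \<in> S i \<Longrightarrow> s < Q i"
       "\<And>i. i \<in> B \<Longrightarrow> b * card (S i) \<le> totient (Q i)"
    and strict: "\<exists>i\<in>B. b * card (S i) < totient (Q i)"
  shows "\<exists>k. coprime k q \<and> (\<forall>i\<in>B. k * c i mod Q i \<notin> S i)"
proof -
  define U where "U = {k. k < q \<and> coprime k q}"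
  define V where "V = (\<lambda>i. {k \<in> U. k * c i mod Q i \<in> S i})"
  have finU: "finite U" unfolding U_def by (rule finite_subset[of _ "{..<q}"]) auto
  then have finV: "finite (V i)" for i by (simp add: V_def)
  have cU: "card U = totient q" unfolding U_def by (rule card_coprime_below[OF assms(2)])
  have Q0: "Q i > 0" if "i \<in> B" for i using Q(1)[OF that] assms(2) by (auto intro: dvd_pos_nat)
  have V: "totient (Q i) * card (V i) \<le> card (S i) * totient q" if i: "i \<in> B" for i
  proof -
    let ?F = "\<lambda>r. {k. k < q \<and> coprime k q \<and> k * c i mod Q i = r}"
    have finF: "finite (?F r)" for r by (rule finite_subset[of _ "{..<q}"]) auto
    have "V i \<subseteq> (\<Union>r\<in>{r \<in> S i. coprime r (Q i)}. ?F r)"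
    proof
      fix k assume k: "k \<in> V i"
      then have "coprime k (Q i)" using coprime_divisors[OF dvd_refl Q(1)[OF i]] by (simp add: V_def U_def)
      then have "coprime (k * c i mod Q i) (Q i)" using Q(2)[OF i] Q0[OF i] by (simp add: coprime_mod_left_iff)
      with k show "k \<in> (\<Union>r\<in>{r \<in> S i. coprime r (Q i)}. ?F r)" by (auto simp: V_def U_def)
    qed
    then have "card (V i) \<le> card (\<Union>r\<in>{r \<in> S i. coprime r (Q i)}. ?F r)"
      using S(1)[OF i] finF by (intro card_mono) auto
    also have "\<dots> \<le> (\<Sum>r\<in>{r \<in> S i. coprime r (Q i)}. card (?F r))"
      using S(1)[OF i] by (intro card_UN_le) auto
    finally have "totient (Q i) * card (V i) \<le> (\<Sum>r\<in>{r \<in> S i. coprime r (Q i)}. totient (Q i) * card (?F r))"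
      by (simp add: sum_distrib_left[symmetric])
    also have "\<dots> \<le> (\<Sum>r\<in>{r \<in> S i. coprime r (Q i)}. totient q)"
      using Q(1)[OF i] Q(2)[OF i] S(2)[OF i] assms(2) by (intro sum_mono card_unit_fibre) simp_all
    also have "\<dots> = card {r \<in> S i. coprime r (Q i)} * totient q" by simp
    also have "\<dots> \<le> card (S i) * totient q"
      using S(1)[OF i] by (intro mult_le_mono1 card_mono) auto
    finally show ?thesis .
  qed
  have le: "b * card (V i) \<le> totient q" if i: "i \<in> B" for i
  proof -
    have "totient (Q i) * (b * card (V i)) \<le> b * card (S i) * totient q"
      using mult_le_mono2[OF V[OF i], of b] by (simp add: algebra_simps)
    also have "\<dots> \<le> totient (Q i) * totient q" using S(3)[OF i] by (rule mult_le_mono1)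
    finally show ?thesis using Q0[OF i] by simp
  qed
  obtain j where j: "j \<in> B" "b * card (S j) < totient (Q j)" using strict by blast
  have lt: "b * card (V j) < totient q"
  proof -
    have "totient (Q j) * (b * card (V j)) \<le> b * card (S j) * totient q"
      using mult_le_mono2[OF V[OF j(1)], of b] by (simp add: algebra_simps)
    also have "\<dots> < totient (Q j) * totient q" using j(2) assms(2) by simp
    finally show ?thesis by simp
  qed
  have "(\<Sum>i\<in>B. b * card (V i)) < (\<Sum>i\<in>B. totient q)"
    using le lt j(1) by (intro sum_strict_mono_ex1[OF assms(1)]) blast+
  then have "b * (\<Sum>i\<in>B. card (V i)) < b * totient q" using assms(3) by (simp add: sum_distrib_left)
  then have "(\<Sum>i\<in>B. card (V i)) < card U" using cU by simp
  moreover have "card (\<Union>i\<in>B. V i) \<le> (\<Sum>i\<in>B. card (V i))" by (rule card_UN_le[OF assms(1)])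
  moreover have "finite (\<Union>i\<in>B. V i)" using finV assms(1) by blast
  ultimately have "\<not> U \<subseteq> (\<Union>i\<in>B. V i)"
    using card_mono[of "\<Union>i\<in>B. V i" U] by linarith
  then obtain k where "k \<in> U" "k \<notin> (\<Union>i\<in>B. V i)" by blast
  then show ?thesis by (intro exI[of _ k]) (auto simp: U_def V_def)
qed

text \<open>The fractional part of \<open>x / q\<close> lies in \<open>[1 / N, 1 - 1 / N]\<close>.\<close>

definition margin :: "nat \<Rightarrow> nat \<Rightarrow> nat \<Rightarrow> bool" where
  "margin N q x \<longleftrightarrow> q \<le> N * (x mod q) \<and> q \<le> N * (q - x mod q)"

lemma margin_mult: "c > 0 \<Longrightarrow> margin N (c * q) (c * x) \<longleftrightarrow> margin N q x"
  by (simp add: margin_def mult_mod_right[symmetric] right_diff_distrib'[symmetric] mult.left_commute[of N c])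

lemma margin_if_not_small_unit:
  assumes "Q > 1" "coprime x Q" "x mod Q \<notin> small_units N Q \<union> (\<lambda>a. Q - a) ` small_units N Q"
  shows "margin N Q x"
proof -
  let ?r = "x mod Q"
  have r: "coprime ?r Q" "?r < Q" using assms by (auto simp: coprime_mod_left_iff)
  then have "?r > 0" using assms(1) by (intro Nat.gr0I) auto
  have "\<not> ?r * N < Q" using assms(3) r \<open>?r > 0\<close> by (auto simp: small_units_def)
  moreover have "\<not> (Q - ?r) * N < Q"
  proof
    assume lt: "(Q - ?r) * N < Q"
    have "gcd (Q - ?r) Q = gcd ?r Q"
      using r(2) gcd_diff2_nat[of ?r Q] by (metis gcd.commute gcd_diff1_nat less_imp_le)
    then have "Q - ?r \<in> small_units N Q"
      using lt r by (auto simp: small_units_def coprime_iff_gcd_eq_1)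
    then have "Q - (Q - ?r) \<in> (\<lambda>a. Q - a) ` small_units N Q" by (rule imageI)
    then show False using assms(3) r(2) by simp
  qed
  ultimately show ?thesis by (simp add: margin_def mult.commute)
qed

text \<open>
  Average over the units \<open>k\<close> modulo \<open>q\<close>. Indices whose order \<open>Q i\<close> is at most \<open>N\<close> never fail; since every
  prime divisor of \<open>q\<close> is the order of some index, there are at least as many of them as primes
  \<open>p \<le> N\<close> dividing \<open>q\<close>. For each of the \<open>b\<close> remaining indices the failure probability is at most \<open>1 / b\<close>,
  with strict inequality for at least one of them.
\<close>

lemma large_order_margin:
  fixes n q :: nat and a :: "'i \<Rightarrow> nat"
  assumes I: "finite I" "card I \<le> n" and n: "n \<ge> 1" and q: "q > 1"
    and a: "\<And>i. i \<in> I \<Longrightarrow> \<not> q dvd a i"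
    and prime_order: "\<And>p. prime p \<Longrightarrow> p dvd q \<Longrightarrow> \<exists>i\<in>I. q dvd p * a i"
  shows "\<exists>k. \<forall>i\<in>I. margin (w_fun n) q (k * a i)"
proof -
  define N where "N = w_fun n"
  have N0: "N > 0" using w_fun_gt_double[OF n] by (simp add: N_def)
  have big: "totient z + 2 * omega z > 2 * n" if "z > N" for z
    using w_fun_gt that unfolding N_def .
  define g where "g i = gcd (a i) q" for i
  define Q where "Q i = q div g i" for i
  define c where "c i = a i div g i" for i
  have g: "g i > 0" for i using q by (simp add: g_def)
  have qQ: "q = g i * Q i" "a i = g i * c i" for i by (simp_all add: g_def Q_def c_def)
  have Qpos: "Q i > 0" for i using qQ(1)[of i] q by (cases "Q i") auto
  have cop: "coprime (c i) (Q i)" for i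
    unfolding c_def Q_def g_def using q by (intro div_gcd_coprime) auto
  have Q1: "Q i > 1" if "i \<in> I" for i
  proof (rule ccontr)
    assume "\<not> Q i > 1"
    then have "Q i = 1" using Qpos[of i] by linarith
    then show False using a[OF that] qQ[of i] by simp
  qed
  have Q_dvd: "Q i dvd q" for i using qQ(1)[of i] by (metis dvd_triv_right)
  have Q_prime: "\<exists>i\<in>I. Q i = p" if p: "prime p" "p dvd q" for p
  proof -
    obtain i where i: "i \<in> I" "q dvd p * a i" using prime_order[OF p] by blast
    then have "g i * Q i dvd g i * (p * c i)" using qQ[of i] by (metis mult.left_commute)
    then have "Q i dvd p * c i" using g[of i] by simp
    then have "Q i dvd p" using cop[of i] by (metis coprime_commute coprime_dvd_mult_left_iff)
    then show ?thesis using p(1) i(1) Q1[OF i(1)] by (metis prime_nat_iff less_irrefl)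
  qed
  have reduce: "margin N q (k * a i)" if "margin N (Q i) (k * c i)" for k i
  proof -
    have "margin N (g i * Q i) (g i * (k * c i))" using that g by (simp add: margin_mult)
    moreover have "g i * Q i = q" "g i * (k * c i) = k * a i" using qQ[of i] by (simp_all add: ac_simps)
    ultimately show ?thesis by simp
  qed
  define S where "S i = small_units N (Q i) \<union> (\<lambda>a. Q i - a) ` small_units N (Q i)" for i
  have ok: "margin N q (k * a i)" if "i \<in> I" "coprime k q" "k * c i mod Q i \<notin> S i" for k i
  proof (intro reduce margin_if_not_small_unit)
    have "coprime k (Q i)" using that(2) Q_dvd coprime_divisors[OF dvd_refl] by blast
    then show "coprime (k * c i) (Q i)" using cop by simp
  qed (use that Q1 S_def in auto)
  define B where "B = {i \<in> I. N < Q i}"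
  have S_good: "S i = {}" if "i \<in> I - B" for i
  proof -
    have "\<not> x * N < Q i" if "x > 0" for x
    proof -
      have "1 * N \<le> x * N" using that by (intro mult_le_mono1) simp
      moreover have "\<not> N < Q i" using \<open>i \<in> I - B\<close> by (simp add: B_def)
      ultimately show ?thesis by linarith
    qed
    then show ?thesis by (auto simp: S_def small_units_def)
  qed
  have finB: "finite B" using I(1) by (simp add: B_def)
  define b where "b = card B"
  define P where "P = {p. prime p \<and> p dvd q \<and> p \<le> N}"
  have "P \<subseteq> Q ` (I - B)"
  proof
    fix p assume p: "p \<in> P"
    then obtain i where "i \<in> I" "Q i = p" using Q_prime by (auto simp: P_def)
    then show "p \<in> Q ` (I - B)" using p by (auto simp: P_def B_def)
  qed
  then have "card P \<le> card (Q ` (I - B))" using I(1) by (intro card_mono) auto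
  also have "\<dots> \<le> card (I - B)" using I(1) by (intro card_image_le) auto
  also have "\<dots> = card I - b" unfolding b_def using finB by (intro card_Diff_subset) (auto simp: B_def)
  finally have bP: "b + card P \<le> n"
    using I(2) card_mono[OF I(1), of B] unfolding b_def B_def by force
  have finP: "finite P" unfolding P_def by (rule finite_subset[of _ "{..N}"]) auto
  have u0: "card (small_units N (Q i)) > 0" if "i \<in> B" for i
  proof -
    have "1 \<in> small_units N (Q i)" using that by (simp add: B_def small_units_def)
    then show ?thesis using finite_small_units[OF N0] unfolding card_gt_0_iff by auto
  qed
  have cS: "card (S i) \<le> 2 * card (small_units N (Q i))" for i
    using card_Un_le[of "small_units N (Q i)" "(\<lambda>a. Q i - a) ` small_units N (Q i)"]
      card_image_le[OF finite_small_units[OF N0], of "\<lambda>a. Q i - a" "Q i"]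
    unfolding S_def by linarith
  \<comment> \<open>A prime divisor of \<open>Q i\<close> above N is missing from \<open>P\<close>,
    and then \<open>card P\<close> need not bound \<open>omega (Q i)\<close>; the estimate for all n
    indices takes over.\<close>
  have le_or_lt: "2 * b * card (small_units N (Q i)) < totient (Q i) \<or>
      b = n \<and> 2 * b * card (small_units N (Q i)) \<le> totient (Q i)" if i: "i \<in> B" for i
  proof (cases "\<exists>p. prime p \<and> p dvd Q i \<and> p > N")
    case True
    then obtain p where p: "prime p" "p dvd Q i" "p > N" by blast
    have le: "2 * n * card (small_units N (Q i)) \<le> totient (Q i)"
      using small_units_bound_large_prime[OF n p(1) p(3)[unfolded N_def] p(2) Qpos] unfolding N_def .
    show ?thesis
    proof (cases "b = n")
      case False
      then have "2 * b < 2 * n" using bP by linarith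
      then have "2 * b * card (small_units N (Q i)) < 2 * n * card (small_units N (Q i))"
        using u0[OF i] by (intro mult_strict_right_mono)
      with le show ?thesis by linarith
    qed (use le in simp)
  next
    case False
    have "prime_factors (Q i) \<subseteq> P"
      using False Q_dvd[of i] by (auto simp: P_def in_prime_factors_iff not_less intro: dvd_trans)
    then have "omega (Q i) \<le> card P" using finP by (intro card_mono)
    then have "b + omega (Q i) \<le> n" using bP by linarith
    then show ?thesis using small_units_bound[OF big _ N0] i by (simp add: B_def)
  qed
  have strict: "\<exists>i\<in>B. 2 * b * card (small_units N (Q i)) < totient (Q i)" if "B \<noteq> {}"
  proof (cases "b = n")
    case False
    then show ?thesis using le_or_lt that by blast
  next
    case True
    \<comment> \<open>With b = n all prime divisors of q exceed N, and any of them is the order of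
      some index; that index is the strict one.\<close>
    then have "card P = 0" using bP by simp
    then have "P = {}" using finP by simp
    obtain p where p: "prime p" "p dvd q" using prime_factor_nat[of q] q by auto
    then have pN: "p > N" using \<open>P = {}\<close> unfolding P_def by (auto simp: not_le)
    obtain i where i: "i \<in> I" "Q i = p" using Q_prime p by blast
    then have "i \<in> B" using pN by (simp add: B_def)
    moreover have "2 * n * card (small_units N p) < totient p"
      using small_units_bound_prime[OF n p(1)] pN unfolding N_def by blast
    ultimately show ?thesis using i True by blast
  qed
  have bS: "b * card (S i) \<le> 2 * b * card (small_units N (Q i))" for i
    using mult_le_mono2[OF cS, of b i] by (simp add: mult.left_commute mult.assoc)
  have "\<exists>k. coprime k q \<and> (\<forall>i\<in>B. k * c i mod Q i \<notin> S i)"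
  proof (cases "B = {}")
    case True
    then show ?thesis by (intro exI[of _ 1]) auto
  next
    case False
    show ?thesis
    proof (rule exists_unit_avoiding)
      show "finite B" "card B = b" "q > 0" "b > 0" using finB q False by (auto simp: b_def card_gt_0_iff)
      show "Q i dvd q" "coprime (c i) (Q i)" for i using Q_dvd cop by auto
      show "finite (S i)" for i using finite_small_units[OF N0] by (simp add: S_def)
      show "s < Q i" if "i \<in> B" "s \<in> S i" for i s
      proof -
        have "x < Q i" "x > 0" if "x \<in> small_units N (Q i)" for x
        proof -
          have "x * 1 \<le> x * N" using N0 by (intro mult_le_mono2) simp
          moreover have "x * N < Q i" "x > 0" using that unfolding small_units_def by blast+
          ultimately show "x < Q i" "x > 0" by linarith+
        qed
        then show ?thesis using that unfolding S_def by fastforce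
      qed
      show "b * card (S i) \<le> totient (Q i)" if "i \<in> B" for i
        using le_or_lt[OF that] bS[of i] by linarith
      show "\<exists>i\<in>B. b * card (S i) < totient (Q i)"
        using strict[OF False] bS le_less_trans by blast
    qed
  qed
  then obtain k where k: "coprime k q" "\<And>i. i \<in> B \<Longrightarrow> k * c i mod Q i \<notin> S i" by blast
  have "margin N q (k * a i)" if "i \<in> I" for i
    using ok[OF that k(1)] k(2)[of i] S_good[of i] that by blast
  then show ?thesis unfolding N_def by blast
qed

text \<open>Rabbits start together on a circular track of length q and jump a i at a time; k is a
  number of jumps after which all are far from the start. Induction on q: if a prime p dividing q is
  no order, the p * a i / q are still non-integral and have denominator q div p, and a solution k
  there gives p * k.\<close>

lemma lonely_rabbits:
  fixes n q :: nat and a :: "'i \<Rightarrow> nat"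
  assumes I: "finite I" "card I \<le> n" and n: "n \<ge> 1" and q: "q > 0"
    and a: "\<And>i. i \<in> I \<Longrightarrow> \<not> q dvd a i"
  shows "\<exists>k. \<forall>i\<in>I. margin (w_fun n) q (k * a i)"
  using q a
proof (induction q rule: less_induct)
  case (less q)
  show ?case
  proof (cases "q = 1")
    case True
    then have "I = {}" using less.prems(2) by auto
    then show ?thesis by simp
  next
    case False
    show ?thesis
    proof (cases "\<exists>p. prime p \<and> p dvd q \<and> (\<forall>i\<in>I. \<not> q dvd p * a i)")
      case True
      then obtain p where p: "prime p" "p dvd q" "\<And>i. i \<in> I \<Longrightarrow> \<not> q dvd p * a i" by blast
      then obtain q' where q': "q = p * q'" by auto
      have pp: "p > 1" using p(1) prime_gt_1_nat by blast
      then have "q' < q" "q' > 0" using q' less.prems(1) by auto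
      moreover have "\<not> q' dvd a i" if "i \<in> I" for i using p(3)[OF that] unfolding q' by auto
      ultimately obtain k where "\<forall>i\<in>I. margin (w_fun n) q' (k * a i)" using less.IH by blast
      then have "\<forall>i\<in>I. margin (w_fun n) q (p * (k * a i))" unfolding q' using pp by (simp add: margin_mult)
      then show ?thesis by (intro exI[of _ "p * k"]) (simp add: mult.assoc)
    next
      case no_prime: False
      show ?thesis
        using no_prime less.prems False by (intro large_order_margin[OF I n]) auto
    qed
  qed
qed

section \<open>Deep lattice points of zonotopes\<close>

text \<open>On [0, 1] this is the distance to the nearest integer. Equality of two values is exactly
  the merging condition x = y or x = 1 - y, in a form open to the intermediate value
  theorem.\<close>

definition tent :: "real \<Rightarrow> real" where "tent x = min x (1 - x)"

lemma tent_eq_iff: "tent x = tent y \<longleftrightarrow> x = y \<or> x = 1 - y"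
  by (auto simp: tent_def min_def)

lemma continuous_on_tent: "continuous_on A f \<Longrightarrow> continuous_on A (\<lambda>x. tent (f x))"
  unfolding tent_def by (intro continuous_intros)

lemma tent_zero_between:
  fixes a b p q x y :: real
  assumes "a < b"
    and "tent (p + a * x) \<le> tent (q + a * y)" "tent (p + b * x) \<ge> tent (q + b * y)"
  obtains s where "a \<le> s" "s \<le> b" "tent (p + s * x) = tent (q + s * y)"
proof -
  have "continuous_on {a..b} (\<lambda>s. tent (p + s * x) - tent (q + s * y))"
    by (intro continuous_intros continuous_on_tent)
  then have "\<exists>s\<ge>a. s \<le> b \<and> tent (p + s * x) - tent (q + s * y) = 0"
    using assms by (intro IVT') auto
  then show thesis using that by auto
qed

text \<open>\<open>h i\<close> is the time at which t i + s * u i leaves (0, 1), and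
  \<open>b\<close> is the earliest such time.\<close>

lemma line_exit:
  fixes t u :: "'i \<Rightarrow> real"
  assumes J: "finite J" "J \<noteq> {}" and u: "\<And>i. i \<in> J \<Longrightarrow> u i \<noteq> 0"
    and t: "\<And>i. i \<in> J \<Longrightarrow> 0 < t i \<and> t i < 1"
  obtains b i where "b > 0" "i \<in> J" "tent (t i + b * u i) = 0"
    "\<And>s j. j \<in> J \<Longrightarrow> 0 \<le> s \<Longrightarrow> s < b \<Longrightarrow> 0 < t j + s * u j \<and> t j + s * u j < 1"
    "\<And>j. j \<in> J \<Longrightarrow> 0 \<le> t j + b * u j \<and> t j + b * u j \<le> 1"
proof -
  define h where "h i = (if u i > 0 then (1 - t i) / u i else t i / - u i)" for i
  have h0: "h i > 0" if "i \<in> J" for i using u[OF that] t[OF that] by (auto simp: h_def divide_pos_neg intro: divide_neg_neg)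
  define b where "b = Min (h ` J)"
  have "b \<in> h ` J" unfolding b_def using J by (intro Min_in) auto
  then obtain i where i: "i \<in> J" "b = h i" by auto
  have bh: "b \<le> h j" if "j \<in> J" for j unfolding b_def using that J by (intro Min_le) auto
  have lt: "0 < t j + s * u j \<and> t j + s * u j < 1" if "j \<in> J" "0 \<le> s" "s < h j" for s j
  proof (cases "u j > 0")
    case True
    then have "s * u j < 1 - t j" using that by (simp add: h_def pos_less_divide_eq)
    then show ?thesis using True that t[OF that(1)] by (auto intro: add_pos_nonneg)
  next
    case False
    then have neg: "- u j > 0" using u[OF that(1)] by linarith
    then have "s * (- u j) < t j" using that(3) False pos_less_divide_eq[OF neg, of s "t j"] by (simp add: h_def)
    moreover have "s * (- u j) \<ge> 0" using neg that(2) by (intro mult_nonneg_nonneg) auto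
    ultimately show ?thesis using t[OF that(1)] by auto
  qed
  have end_pt: "t j + h j * u j = (if u j > 0 then 1 else 0)" if "j \<in> J" for j
    using u[OF that] by (auto simp: h_def)
  show thesis
  proof
    show "b > 0" "i \<in> J" using i h0 by auto
    show "tent (t i + b * u i) = 0" using end_pt[OF i(1)] i(2) by (auto simp: tent_def)
    show "0 < t j + s * u j \<and> t j + s * u j < 1" if "j \<in> J" "0 \<le> s" "s < b" for s j
      using lt that bh[OF that(1)] by auto
    show "0 \<le> t j + b * u j \<and> t j + b * u j \<le> 1" if "j \<in> J" for j
    proof (cases "b < h j")
      case True
      then show ?thesis using lt[OF that, of b] h0[OF i(1)] i(2) by auto
    next
      case False
      then have "b = h j" using bh[OF that] by linarith
      then show ?thesis using end_pt[OF that] by auto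
    qed
  qed
qed

text \<open>Let a < 0 < b be the times at which the line leaves the open cube. If no coordinate
  reaches the boundary at both, the tents of one reaching it at a and one reaching it at b differ by
  a function that changes sign. A coordinate l reaching it at both equals 1 / 2 at the midpoint,
  where its tent is maximal; any other coordinate then meets it inside one half, or at the midpoint
  if it also runs from boundary to boundary.\<close>

lemma line_coincidence:
  fixes t u :: "'i \<Rightarrow> real"
  assumes J: "finite J" and u: "\<And>i. i \<in> J \<Longrightarrow> u i \<noteq> 0"
    and ij: "i0 \<in> J" "j0 \<in> J" "i0 \<noteq> j0"
    and t: "\<And>i. i \<in> J \<Longrightarrow> 0 < t i \<and> t i < 1"
  obtains s i j where "i \<in> J" "j \<in> J" "i \<noteq> j" "tent (t i + s * u i) = tent (t j + s * u j)"
    "\<And>j. j \<in> J \<Longrightarrow> 0 < t j + s * u j \<and> t j + s * u j < 1"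
proof -
  have Jne: "J \<noteq> {}" using ij by auto
  obtain b i where b: "b > 0" "i \<in> J" "tent (t i + b * u i) = 0"
    "\<And>s j. j \<in> J \<Longrightarrow> 0 \<le> s \<Longrightarrow> s < b \<Longrightarrow> 0 < t j + s * u j \<and> t j + s * u j < 1"
    "\<And>j. j \<in> J \<Longrightarrow> 0 \<le> t j + b * u j \<and> t j + b * u j \<le> 1"
    by (rule line_exit[of J u t]) (use J Jne u t in auto)
  obtain a' j where a': "a' > 0" "j \<in> J" "tent (t j + a' * - u j) = 0"
    "\<And>s j. j \<in> J \<Longrightarrow> 0 \<le> s \<Longrightarrow> s < a' \<Longrightarrow> 0 < t j + s * - u j \<and> t j + s * - u j < 1"
    "\<And>j. j \<in> J \<Longrightarrow> 0 \<le> t j + a' * - u j \<and> t j + a' * - u j \<le> 1"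
    by (rule line_exit[of J "\<lambda>i. - u i" t]) (use J Jne u t in auto)
  define a where "a = - a'"
  have a: "a < 0" "tent (t j + a * u j) = 0" using a' by (auto simp: a_def)
  have inside: "0 < t l + s * u l \<and> t l + s * u l < 1" if "l \<in> J" "a < s" "s < b" for l s
  proof (cases "s \<ge> 0")
    case False
    then show ?thesis using a'(4)[OF that(1), of "- s"] that by (auto simp: a_def)
  qed (use b(4) that in auto)
  have ge0: "tent (t l + b * u l) \<ge> 0" "tent (t l + a * u l) \<ge> 0" if "l \<in> J" for l
    using b(5)[OF that] a'(5)[OF that] by (auto simp: tent_def a_def)
  have ab: "a < b" using a(1) b(1) by linarith
  have le_half: "tent x \<le> 1 / 2" for x by (simp add: tent_def min_def)
  define c where "c = (a + b) / 2"
  have c: "a < c" "c < b" using ab by (auto simp: c_def)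
  have mid: "t l + c * u l = 1 / 2" if "l \<in> J" "tent (t l + a * u l) = 0" "tent (t l + b * u l) = 0" for l
  proof -
    have "t l + a * u l = 0 \<or> t l + a * u l = 1" "t l + b * u l = 0 \<or> t l + b * u l = 1"
      using that(2,3) by (auto simp: tent_def min_def split: if_splits)
    moreover have "t l + a * u l \<noteq> t l + b * u l" using ab u[OF that(1)] by auto
    moreover have "X = 0 \<or> X = 1 \<Longrightarrow> Y = 0 \<or> Y = 1 \<Longrightarrow> X \<noteq> Y \<Longrightarrow> X + Y = 1" for X Y :: real by auto
    ultimately have "(t l + a * u l) + (t l + b * u l) = 1" by blast
    then show ?thesis by (simp add: c_def field_simps)
  qed
  show thesis
  proof (cases "\<exists>l\<in>J. tent (t l + a * u l) = 0 \<and> tent (t l + b * u l) = 0")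
    case True
    then obtain l where l: "l \<in> J" "tent (t l + a * u l) = 0" "tent (t l + b * u l) = 0" by blast
    obtain k where k: "k \<in> J" "k \<noteq> l" using ij by metis
    have top: "tent (t l + c * u l) = 1 / 2" using mid[OF l] by (simp add: tent_def)
    have kc: "tent (t k + c * u k) \<le> tent (t l + c * u l)" unfolding top by (rule le_half)
    consider "tent (t k + a * u k) > 0" | "tent (t k + b * u k) > 0"
      | "tent (t k + a * u k) = 0" "tent (t k + b * u k) = 0" using ge0[OF k(1)] by linarith
    then obtain s where "a < s" "s < b" "tent (t l + s * u l) = tent (t k + s * u k)"
    proof cases
      case 1
      obtain s where s: "a \<le> s" "s \<le> c" "tent (t l + s * u l) = tent (t k + s * u k)"
        by (rule tent_zero_between[OF c(1), of "t l" "u l" "t k" "u k"]) (use l 1 kc in auto)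
      then have "s \<noteq> a" using 1 l by auto
      then show thesis using s c by (intro that[of s]) auto
    next
      case 2
      obtain s where s: "c \<le> s" "s \<le> b" "tent (t k + s * u k) = tent (t l + s * u l)"
        by (rule tent_zero_between[OF c(2), of "t k" "u k" "t l" "u l"]) (use l 2 kc in auto)
      then have "s \<noteq> b" using 2 l by auto
      then show thesis using s c by (intro that[of s]) auto
    next
      case 3
      then have "tent (t l + c * u l) = tent (t k + c * u k)"
        unfolding mid[OF k(1) 3] mid[OF l] by simp
      then show thesis using c by (intro that[of c])
    qed
    then show thesis using l k inside by (intro that[of l k s]) auto
  next
    case False
    then have ne: "tent (t j + b * u j) > 0" "tent (t i + a * u i) > 0" "i \<noteq> j"
      using ge0 a b a' by (force simp: less_le)+
    obtain s where s: "a \<le> s" "s \<le> b" "tent (t j + s * u j) = tent (t i + s * u i)"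
      by (rule tent_zero_between[OF ab, of "t j" "u j" "t i" "u i"]) (use ne a b in auto)
    then have "s \<noteq> a" "s \<noteq> b" using ne a b by auto
    then show thesis using s ne a' b inside by (intro that[of i j s]) auto
  qed
qed

section \<open>Integer points and rational coefficients\<close>

lemma lattice_point_add: "lattice_point x \<Longrightarrow> lattice_point y \<Longrightarrow> lattice_point (x + y)"
  and lattice_point_diff: "lattice_point x \<Longrightarrow> lattice_point y \<Longrightarrow> lattice_point (x - y)"
  by (simp_all add: lattice_point_def)

lemma lattice_point_scaleR: "c \<in> \<int> \<Longrightarrow> lattice_point x \<Longrightarrow> lattice_point (c *\<^sub>R x)"
  by (simp add: lattice_point_def)

lemma lattice_point_sum: "(\<And>i. i \<in> I \<Longrightarrow> lattice_point (f i)) \<Longrightarrow> lattice_point (\<Sum>i\<in>I. f i)"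
  by (simp add: lattice_point_def Ints_sum)

lemma finite_lattice_points_bounded: "finite {x :: real ^ 'n. lattice_point x \<and> norm x \<le> R}"
proof -
  define A where "A = real_of_int ` {\<lfloor>- R\<rfloor>..\<lceil>R\<rceil>}"
  have "finite (vec_lambda ` (PiE (UNIV :: 'n set) (\<lambda>_. A)))"
    by (intro finite_imageI finite_PiE) (auto simp: A_def)
  moreover have "{x :: real ^ 'n. lattice_point x \<and> norm x \<le> R} \<subseteq> vec_lambda ` (PiE UNIV (\<lambda>_. A))"
  proof
    fix x :: "real ^ 'n" assume x: "x \<in> {x. lattice_point x \<and> norm x \<le> R}"
    have "x $ i \<in> A" for i
    proof -
      obtain z where z: "x $ i = of_int z" using x by (auto simp: lattice_point_def elim: Ints_cases)
      have "\<bar>x $ i\<bar> \<le> R" using x component_le_norm_cart[of x i] by auto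
      then have "\<lfloor>- R\<rfloor> \<le> z" "z \<le> \<lceil>R\<rceil>" unfolding z by (auto simp: floor_le_iff le_ceiling_iff)
      then show ?thesis unfolding A_def z by auto
    qed
    then show "x \<in> vec_lambda ` (PiE UNIV (\<lambda>_. A))"
      by (intro image_eqI[of _ _ "vec_nth x"]) auto
  qed
  ultimately show ?thesis by (rule finite_subset[rotated])
qed

lemma independent_family_card:
  fixes g :: "'i \<Rightarrow> 'a :: euclidean_space"
  assumes "finite I" and indep: "\<And>u. (\<Sum>i\<in>I. u i *\<^sub>R g i) = 0 \<Longrightarrow> \<forall>i\<in>I. u i = 0"
  shows "card I \<le> DIM('a)"
proof -
  have inj: "inj_on g I"
  proof (rule inj_onI, rule ccontr)
    fix i j assume ij: "i \<in> I" "j \<in> I" "g i = g j" "i \<noteq> j"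
    define u where "u = (\<lambda>k. (if k = i then 1 else 0) - (if k = j then 1 else 0) :: real)"
    have "(\<Sum>k\<in>I. u k *\<^sub>R g k) = (\<Sum>k\<in>I. (if k = i then g k else 0)) - (\<Sum>k\<in>I. (if k = j then g k else 0))"
      unfolding sum_subtractf[symmetric] by (intro sum.cong) (auto simp: u_def)
    also have "\<dots> = 0" using ij assms(1) by (simp add: sum.delta)
    finally have "u i = 0" using indep ij(1) by blast
    then show False using ij(4) by (simp add: u_def)
  qed
  have "independent (g ` I)"
  proof
    assume "dependent (g ` I)"
    then obtain u v where u: "v \<in> g ` I" "u v \<noteq> 0" "(\<Sum>v\<in>g ` I. u v *\<^sub>R v) = 0"
      using assms(1) by (auto simp: dependent_finite)
    then have "(\<Sum>i\<in>I. u (g i) *\<^sub>R g i) = 0" using inj by (simp add: sum.reindex)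
    then have "\<forall>i\<in>I. u (g i) = 0" by (rule indep[of "\<lambda>i. u (g i)"])
    with u show False by auto
  qed
  then have "card (g ` I) \<le> DIM('a)" using independent_bound by blast
  then show ?thesis using card_image[OF inj] by simp
qed

text \<open>Pigeonhole: reducing the coefficients of the k-fold point to their fractional parts
  gives lattice points in a bounded set, so two values of k give the same point. Independence then
  equates the fractional parts, and the difference of the two values is a common
  denominator.\<close>

lemma lattice_combination_rational:
  fixes g :: "'i \<Rightarrow> real ^ 'n"
  assumes "finite I" and indep: "\<And>u. (\<Sum>i\<in>I. u i *\<^sub>R g i) = 0 \<Longrightarrow> \<forall>i\<in>I. u i = 0"
    and g: "\<And>i. i \<in> I \<Longrightarrow> lattice_point (g i)"
    and t: "lattice_point (\<Sum>i\<in>I. t i *\<^sub>R g i)"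
  obtains q :: nat where "q > 0" "\<And>i. i \<in> I \<Longrightarrow> real q * t i \<in> \<int>"
proof -
  define F where "F k = (\<Sum>i\<in>I. frac (real k * t i) *\<^sub>R g i)" for k :: nat
  define R where "R = (\<Sum>i\<in>I. norm (g i))"
  have "F k \<in> {x. lattice_point x \<and> norm x \<le> R}" for k
  proof -
    have "F k = real k *\<^sub>R (\<Sum>i\<in>I. t i *\<^sub>R g i) - (\<Sum>i\<in>I. of_int \<lfloor>real k * t i\<rfloor> *\<^sub>R g i)"
      unfolding F_def frac_def by (simp add: scaleR_sum_right scaleR_diff_left sum_subtractf)
    then have "lattice_point (F k)"
      using t g by (auto intro!: lattice_point_diff lattice_point_scaleR lattice_point_sum)
    moreover have "norm (F k) \<le> R"
      unfolding F_def R_def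
    proof (rule sum_norm_le)
      fix i assume "i \<in> I"
      have "frac (real k * t i) * norm (g i) \<le> 1 * norm (g i)"
        by (intro mult_right_mono) (auto intro: less_imp_le frac_lt_1)
      then show "norm (frac (real k * t i) *\<^sub>R g i) \<le> norm (g i)" by simp
    qed
    ultimately show ?thesis by simp
  qed
  then have "finite (range F)" using finite_lattice_points_bounded[of R] finite_subset[of "range F"] by blast
  then have "\<not> inj F" using finite_imageD infinite_UNIV_nat by blast
  then obtain k l where kl: "F k = F l" "k < l" unfolding inj_def by (metis nat_neq_iff)
  have "(\<Sum>i\<in>I. (frac (real l * t i) - frac (real k * t i)) *\<^sub>R g i) = F l - F k"
    unfolding F_def by (simp add: scaleR_diff_left sum_subtractf)
  then have eq: "\<forall>i\<in>I. frac (real l * t i) - frac (real k * t i) = 0"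
    using kl(1) by (intro indep) simp
  show thesis
  proof
    show "l - k > 0" using kl by simp
    fix i assume "i \<in> I"
    have "real (l - k) * t i = (real l * t i - frac (real l * t i)) - (real k * t i - frac (real k * t i))"
      using eq \<open>i \<in> I\<close> kl(2) by (simp add: of_nat_diff algebra_simps)
    also have "\<dots> = of_int (\<lfloor>real l * t i\<rfloor> - \<lfloor>real k * t i\<rfloor>)" by (simp add: frac_def)
    finally show "real (l - k) * t i \<in> \<int>" by simp
  qed
qed

lemma deep_combination_independent:
  fixes g :: "'i \<Rightarrow> real ^ 'n"
  defines "N \<equiv> real (w_fun CARD('n))"
  assumes I: "finite I" and indep: "\<And>u. (\<Sum>i\<in>I. u i *\<^sub>R g i) = 0 \<Longrightarrow> \<forall>i\<in>I. u i = 0"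
    and g: "\<And>i. i \<in> I \<Longrightarrow> lattice_point (g i)"
    and t: "\<And>i. i \<in> I \<Longrightarrow> 0 < t i \<and> t i < 1" "lattice_point (\<Sum>i\<in>I. t i *\<^sub>R g i)"
  shows "\<exists>s. (\<forall>i\<in>I. 1 / N \<le> s i \<and> s i \<le> 1 - 1 / N) \<and> lattice_point (\<Sum>i\<in>I. s i *\<^sub>R g i)"
proof -
  define n where "n = CARD('n)"
  have n: "n \<ge> 1" by (simp add: n_def Suc_le_eq)
  have N0: "N > 0" using w_fun_gt_double[OF n] by (simp add: N_def n_def)
  have "card I \<le> DIM(real ^ 'n)" by (rule independent_family_card[OF I, of g]) (rule indep)
  then have card: "card I \<le> n" by (simp add: n_def)
  obtain q where q: "q > 0" "\<And>i. i \<in> I \<Longrightarrow> real q * t i \<in> \<int>"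
    using lattice_combination_rational[OF I indep g t(2)] by blast
  define a where "a i = nat \<lfloor>real q * t i\<rfloor>" for i
  have a: "real (a i) = real q * t i" if "i \<in> I" for i
    using q(2)[OF that] t(1)[OF that] by (auto simp: a_def elim!: Ints_cases)
  have "\<not> q dvd a i" if "i \<in> I" for i
  proof
    assume dvd: "q dvd a i"
    have "real (a i) < real q" "real (a i) > 0" using a[OF that] t(1)[OF that] q(1) by auto
    then show False using dvd_imp_le[OF dvd] by simp
  qed
  then obtain k where k: "\<And>i. i \<in> I \<Longrightarrow> margin (w_fun n) q (k * a i)"
    using lonely_rabbits[OF I card n q(1)] by blast
  define s where "s i = real (k * a i mod q) / real q" for i
  have "1 / N \<le> s i \<and> s i \<le> 1 - 1 / N" if "i \<in> I" for i
  proof -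
    define r where "r = k * a i mod q"
    have "r < q" using q(1) by (simp add: r_def)
    have "q \<le> w_fun n * r" "q \<le> w_fun n * (q - r)" using k[OF that] by (simp_all add: margin_def r_def)
    then have "real q \<le> real (w_fun n * r)" "real q \<le> real (w_fun n * (q - r))" by (simp_all only: of_nat_le_iff)
    then have "real q \<le> N * real r" "real q \<le> N * (real q - real r)"
      using \<open>r < q\<close> by (simp_all add: N_def n_def of_nat_diff)
    then show ?thesis using N0 q(1) by (simp add: s_def r_def[symmetric] field_simps)
  qed
  moreover have "lattice_point (\<Sum>i\<in>I. s i *\<^sub>R g i)"
  proof -
    have s: "s i = real k * t i - real (k * a i div q)" if "i \<in> I" for i
    proof -
      have "real k * real (a i) = real (k * a i div q) * real q + real (k * a i mod q)"
        by (metis of_nat_add of_nat_mult div_mult_mod_eq)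
      then have "real k * t i * real q = real (k * a i div q) * real q + real (k * a i mod q)"
        using a[OF that] by (simp add: ac_simps)
      then show ?thesis using q(1) by (simp add: s_def field_simps)
    qed
    have "(\<Sum>i\<in>I. s i *\<^sub>R g i) = (\<Sum>i\<in>I. (real k * t i - real (k * a i div q)) *\<^sub>R g i)"
      using s by (intro sum.cong) auto
    also have "\<dots> = real k *\<^sub>R (\<Sum>i\<in>I. t i *\<^sub>R g i) - (\<Sum>i\<in>I. real (k * a i div q) *\<^sub>R g i)"
      by (simp add: scaleR_sum_right scaleR_diff_left sum_subtractf)
    finally show ?thesis
      using t(2) g by (auto intro!: lattice_point_diff lattice_point_scaleR lattice_point_sum)
  qed
  ultimately show ?thesis by blast
qed

text \<open>
  A linear dependency allows to move \<open>t\<close> inside the open cube until two coefficients satisfy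
  \<open>t i = t j\<close> or \<open>t i = 1 - t j\<close>; then \<open>g i\<close> and \<open>g j\<close> are merged into \<open>g i + g j\<close> or \<open>g i - g j\<close>.
\<close>

lemma deep_combination:
  fixes g :: "'i \<Rightarrow> real ^ 'n"
  defines "N \<equiv> real (w_fun CARD('n))"
  assumes I: "finite I" and g: "\<And>i. i \<in> I \<Longrightarrow> lattice_point (g i)"
    and t: "\<And>i. i \<in> I \<Longrightarrow> 0 < t i \<and> t i < 1" "lattice_point (\<Sum>i\<in>I. t i *\<^sub>R g i)"
  shows "\<exists>s. (\<forall>i\<in>I. 1 / N \<le> s i \<and> s i \<le> 1 - 1 / N) \<and> lattice_point (\<Sum>i\<in>I. s i *\<^sub>R g i)"
  using I g t
proof (induction I arbitrary: g t rule: finite_psubset_induct)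
  case (psubset I)
  have card: "CARD('n) \<ge> 1" by (simp add: Suc_le_eq)
  have "2 < w_fun CARD('n)" using w_fun_gt_double[OF card] card by linarith
  then have N: "N > 2" by (simp add: N_def)
  show ?case
  proof (cases "\<forall>u. (\<Sum>i\<in>I. u i *\<^sub>R g i) = 0 \<longrightarrow> (\<forall>i\<in>I. u i = 0)")
    case True
    then show ?thesis
      unfolding N_def using psubset.prems psubset.hyps
      by (intro deep_combination_independent[where t = t]) blast+
  next
    case False
    then obtain u where u: "(\<Sum>i\<in>I. u i *\<^sub>R g i) = 0" "\<exists>i\<in>I. u i \<noteq> 0" by blast
    define J where "J = {i \<in> I. u i \<noteq> 0}"
    have J: "finite J" "J \<subseteq> I" using psubset.hyps by (auto simp: J_def)
    obtain i0 where i0: "i0 \<in> J" using u(2) by (auto simp: J_def)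
    show ?thesis
    proof (cases "J = {i0}")
      case True
      have "(\<Sum>i\<in>I. u i *\<^sub>R g i) = (\<Sum>i\<in>J. u i *\<^sub>R g i)"
        using psubset.hyps J(2) by (intro sum.mono_neutral_right) (auto simp: J_def)
      then have "u i0 *\<^sub>R g i0 = 0" using u(1) True by simp
      then have g0: "g i0 = 0" using i0 by (simp add: J_def)
      have split: "(\<Sum>i\<in>I. f i *\<^sub>R g i) = (\<Sum>i\<in>I - {i0}. f i *\<^sub>R g i)" for f :: "'i \<Rightarrow> real"
        using psubset.hyps i0 J(2) g0 by (subst sum.remove[of I i0]) auto
      have "\<exists>s. (\<forall>i\<in>I - {i0}. 1 / N \<le> s i \<and> s i \<le> 1 - 1 / N) \<and> lattice_point (\<Sum>i\<in>I - {i0}. s i *\<^sub>R g i)"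
        using psubset.prems i0 J(2) split[of t] by (intro psubset.IH[of _ g t]) auto
      then obtain s where s: "\<forall>i\<in>I - {i0}. 1 / N \<le> s i \<and> s i \<le> 1 - 1 / N"
        "lattice_point (\<Sum>i\<in>I - {i0}. s i *\<^sub>R g i)" by blast
      \<comment> \<open>The generator \<open>g i0\<close> vanishes and its coefficient is free; 1 /
        2 is admissible because N > 2.\<close>
      have "(\<Sum>i\<in>I. (s(i0 := 1 / 2)) i *\<^sub>R g i) = (\<Sum>i\<in>I - {i0}. s i *\<^sub>R g i)"
        unfolding split by (intro sum.cong) auto
      then show ?thesis using s N by (intro exI[of _ "s(i0 := 1 / 2)"]) (auto simp: field_simps)
    next
      case False
      then obtain j0 where j0: "j0 \<in> J" "i0 \<noteq> j0" using i0 by blast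
      obtain r i j where ij: "i \<in> J" "j \<in> J" "i \<noteq> j" "tent (t i + r * u i) = tent (t j + r * u j)"
        and r: "\<And>j. j \<in> J \<Longrightarrow> 0 < t j + r * u j \<and> t j + r * u j < 1"
      proof (rule line_coincidence[of J u i0 j0 t])
        show "0 < t i \<and> t i < 1" if "i \<in> J" for i using psubset.prems(2) J(2) that by blast
        show "u i \<noteq> 0" if "i \<in> J" for i using that by (simp add: J_def)
      qed (use J i0 j0 in auto)
      define t' where "t' k = t k + r * u k" for k
      have t': "0 < t' k \<and> t' k < 1" if "k \<in> I" for k
        using r[of k] psubset.prems(2)[OF that] that by (cases "u k = 0") (auto simp: J_def t'_def)
      have sum_t': "(\<Sum>k\<in>I. t' k *\<^sub>R g k) = (\<Sum>k\<in>I. t k *\<^sub>R g k)"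
      proof -
        have "(\<Sum>k\<in>I. t' k *\<^sub>R g k) = (\<Sum>k\<in>I. t k *\<^sub>R g k) + r *\<^sub>R (\<Sum>k\<in>I. u k *\<^sub>R g k)"
          by (simp add: t'_def scaleR_add_left sum.distrib scaleR_sum_right)
        then show ?thesis using u(1) by simp
      qed
      have inI: "i \<in> I" "j \<in> I" using ij J by auto
      define I' where "I' = I - {j}"
      have I': "I' \<subset> I" "i \<in> I'" "finite I'" using inI ij(3) psubset.hyps by (auto simp: I'_def)
      have split: "(\<Sum>k\<in>I. f k *\<^sub>R g k) = f j *\<^sub>R g j + (f i *\<^sub>R g i + (\<Sum>k\<in>I' - {i}. f k *\<^sub>R g k))" for f :: "'i \<Rightarrow> real"
        using psubset.hyps inI I' unfolding I'_def by (simp add: sum.remove[of I j] sum.remove[of "I - {j}" i])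
      have "t' i = t' j \<or> t' i = 1 - t' j" using ij(4) unfolding tent_eq_iff t'_def .
      \<comment> \<open>Both cases become t' j = e + \<sigma> * t' i with (e, \<sigma>) = (0, 1) or
        (1, -1): g i turns into g i + \<sigma> * g j, the integral vector e * g j splits off, and
        [1 / N, 1 - 1 / N] is invariant under x \<mapsto> e + \<sigma> * x.\<close>
      then have "\<exists>e :: real. e = 0 \<and> t' j = t' i \<or> e = 1 \<and> t' j = 1 - t' i" by auto
      then obtain e :: real where e: "e = 0 \<and> t' j = t' i \<or> e = 1 \<and> t' j = 1 - t' i" by blast
      define \<sigma> where "\<sigma> = 1 - 2 * e"
      have t'j: "t' j = e + \<sigma> * t' i" using e by (auto simp: \<sigma>_def)
      have eZ: "e \<in> \<int>" "\<sigma> \<in> \<int>" using e by (auto simp: \<sigma>_def)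
      define g' where "g' = g(i := g i + \<sigma> *\<^sub>R g j)"
      have merged: "(\<Sum>k\<in>I. f k *\<^sub>R g k) = e *\<^sub>R g j + (\<Sum>k\<in>I'. f k *\<^sub>R g' k)" if "f j = e + \<sigma> * f i" for f
      proof -
        have "(\<Sum>k\<in>I'. f k *\<^sub>R g' k) = f i *\<^sub>R g' i + (\<Sum>k\<in>I' - {i}. f k *\<^sub>R g' k)"
          using I' by (intro sum.remove) auto
        also have "(\<Sum>k\<in>I' - {i}. f k *\<^sub>R g' k) = (\<Sum>k\<in>I' - {i}. f k *\<^sub>R g k)"
          by (intro sum.cong) (auto simp: g'_def)
        finally show ?thesis unfolding split that by (simp add: g'_def algebra_simps)
      qed
      have lat_e: "lattice_point (e *\<^sub>R g j)" using eZ psubset.prems(1)[OF inI(2)] by (intro lattice_point_scaleR)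
      have "\<exists>s. (\<forall>k\<in>I'. 1 / N \<le> s k \<and> s k \<le> 1 - 1 / N) \<and> lattice_point (\<Sum>k\<in>I'. s k *\<^sub>R g' k)"
      proof (rule psubset.IH[of I' g' t'])
        show "lattice_point (g' k)" if "k \<in> I'" for k
          using that I'(1) psubset.prems(1) inI eZ by (auto simp: g'_def intro!: lattice_point_add lattice_point_scaleR)
        have "(\<Sum>k\<in>I'. t' k *\<^sub>R g' k) = (\<Sum>k\<in>I. t k *\<^sub>R g k) - e *\<^sub>R g j"
          using merged[OF t'j] sum_t' by simp
        then show "lattice_point (\<Sum>k\<in>I'. t' k *\<^sub>R g' k)"
          using lat_e psubset.prems(3) by (simp add: lattice_point_diff)
      qed (use I' t' in auto)
      then obtain s where s: "\<And>k. k \<in> I' \<Longrightarrow> 1 / N \<le> s k \<and> s k \<le> 1 - 1 / N"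
        "lattice_point (\<Sum>k\<in>I'. s k *\<^sub>R g' k)" by blast
      define s' where "s' = s(j := e + \<sigma> * s i)"
      have "s' j = e + \<sigma> * s' i" using ij(3) by (simp add: s'_def)
      then have "(\<Sum>k\<in>I. s' k *\<^sub>R g k) = e *\<^sub>R g j + (\<Sum>k\<in>I'. s' k *\<^sub>R g' k)" by (rule merged)
      also have "(\<Sum>k\<in>I'. s' k *\<^sub>R g' k) = (\<Sum>k\<in>I'. s k *\<^sub>R g' k)"
        by (intro sum.cong) (auto simp: s'_def I'_def)
      finally have "lattice_point (\<Sum>k\<in>I. s' k *\<^sub>R g k)" using lat_e s(2) by (simp add: lattice_point_add)
      moreover have "1 / N \<le> s' k \<and> s' k \<le> 1 - 1 / N" if "k \<in> I" for k
      proof (cases "k = j")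
        case True
        then show ?thesis using s(1)[OF I'(2)] e by (auto simp: s'_def \<sigma>_def)
      next
        case False
        then show ?thesis using s(1)[of k] that by (auto simp: s'_def I'_def)
      qed
      ultimately show ?thesis by blast
    qed
  qed
qed

section \<open>Coefficient vectors of points of a zonotope\<close>

lemma mem_zonotope:
  "x \<in> zonotope m g \<longleftrightarrow> (\<exists>t. (\<forall>j\<in>{1..m}. 0 \<le> t j \<and> t j \<le> 1) \<and> x = (\<Sum>j\<in>{1..m}. t j *\<^sub>R g j))"
proof
  assume "x \<in> zonotope m g"
  then obtain s where s: "x = sum s {1..m}" "\<forall>j\<in>{1..m}. s j \<in> closed_segment 0 (g j)"
    unfolding zonotope_def set_sum_alt[OF finite_atLeastAtMost] by auto
  then have "\<forall>j\<in>{1..m}. \<exists>t. 0 \<le> t \<and> t \<le> 1 \<and> s j = t *\<^sub>R g j" by (auto simp: in_segment)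
  then obtain t where "\<forall>j\<in>{1..m}. 0 \<le> t j \<and> t j \<le> 1 \<and> s j = t j *\<^sub>R g j" by metis
  then show "\<exists>t. (\<forall>j\<in>{1..m}. 0 \<le> t j \<and> t j \<le> 1) \<and> x = (\<Sum>j\<in>{1..m}. t j *\<^sub>R g j)"
    using s(1) by (intro exI[of _ t]) auto
next
  assume "\<exists>t. (\<forall>j\<in>{1..m}. 0 \<le> t j \<and> t j \<le> 1) \<and> x = (\<Sum>j\<in>{1..m}. t j *\<^sub>R g j)"
  then obtain t where "\<forall>j\<in>{1..m}. 0 \<le> t j \<and> t j \<le> 1" "x = (\<Sum>j\<in>{1..m}. t j *\<^sub>R g j)" by blast
  then show "x \<in> zonotope m g"
    unfolding zonotope_def set_sum_alt[OF finite_atLeastAtMost]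
    by (auto simp: in_segment intro!: exI[of _ "\<lambda>j. t j *\<^sub>R g j"])
qed

lemma mem_zonotopeI:
  "(\<And>j. j \<in> {1..m} \<Longrightarrow> 0 \<le> t j \<and> t j \<le> 1) \<Longrightarrow> (\<Sum>j\<in>{1..m}. t j *\<^sub>R g j) \<in> zonotope m g"
  unfolding mem_zonotope by blast

lemma convex_zonotope: "convex (zonotope m g)"
  unfolding zonotope_def by (intro convex_set_sum) auto

lemma compact_zonotope: "compact (zonotope m g)"
proof -
  have "compact (\<Sum>j\<in>A. closed_segment 0 (g j))" if "finite A" for A
    using that
  proof induction
    case (insert x F)
    then have "compact {a + b |a b. a \<in> closed_segment 0 (g x) \<and> b \<in> (\<Sum>j\<in>F. closed_segment 0 (g j))}"
      by (intro compact_sums) auto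
    also have "{a + b |a b. a \<in> closed_segment 0 (g x) \<and> b \<in> (\<Sum>j\<in>F. closed_segment 0 (g j))}
        = closed_segment 0 (g x) + (\<Sum>j\<in>F. closed_segment 0 (g j))"
      by (auto simp: set_plus_def)
    finally show ?case using insert by simp
  qed (simp add: set_zero)
  then show ?thesis by (simp add: zonotope_def)
qed

text \<open>Complementing the coefficients reflects w in the centre, which is thus the midpoint of
  an interior point and a point of the zonotope.\<close>

lemma zonotope_center_interior:
  assumes "w \<in> interior (zonotope m g)"
  shows "(\<Sum>j\<in>{1..m}. (1/2) *\<^sub>R g j) \<in> interior (zonotope m g)"
proof -
  obtain t where t: "\<forall>j\<in>{1..m}. 0 \<le> t j \<and> t j \<le> 1" "w = (\<Sum>j\<in>{1..m}. t j *\<^sub>R g j)"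
    using assms interior_subset mem_zonotope by blast
  define x where "x = (\<Sum>j\<in>{1..m}. (1 - t j) *\<^sub>R g j)"
  have "x \<in> zonotope m g" unfolding x_def using t(1) by (intro mem_zonotopeI) auto
  then have "x - (1/2) *\<^sub>R (x - w) \<in> interior (zonotope m g)"
    using assms by (intro mem_interior_convex_shrink convex_zonotope) auto
  also have "x - (1/2) *\<^sub>R (x - w) = (1/2) *\<^sub>R (x + w)"
    by (simp add: algebra_simps flip: scaleR_2)
  also have "x + w = (\<Sum>j\<in>{1..m}. g j)"
    unfolding x_def t(2) sum.distrib[symmetric] by (simp flip: scaleR_left_distrib)
  finally show ?thesis by (simp add: scaleR_sum_right)
qed

text \<open>Coefficients of an interior point may touch 0 or 1 when the generators are dependent. So
  w is first moved away from the centre inside the zonotope, represented there, and pulled back;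
  averaging with the coefficients 1 / 2 of the centre makes all of them strict.\<close>

lemma interior_zonotope_coords:
  assumes "w \<in> interior (zonotope m g)"
  obtains t where "\<And>j. j \<in> {1..m} \<Longrightarrow> 0 < t j \<and> t j < 1" "w = (\<Sum>j\<in>{1..m}. t j *\<^sub>R g j)"
proof -
  define c where "c = (\<Sum>j\<in>{1..m}. (1/2) *\<^sub>R g j)"
  obtain e where e: "e > 0" "ball w e \<subseteq> zonotope m g" using assms mem_interior by blast
  define \<delta> where "\<delta> = e / (norm (w - c) + 1)"
  have d: "\<delta> > 0" using e by (simp add: \<delta>_def add_nonneg_pos)
  have "norm (\<delta> *\<^sub>R (w - c)) = \<delta> * norm (w - c)" using d by simp
  also have "\<dots> < \<delta> * (norm (w - c) + 1)" using d by simp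
  also have "\<dots> = e" unfolding \<delta>_def by (simp add: add_nonneg_pos less_imp_neq[OF add_nonneg_pos, symmetric])
  finally have "w + \<delta> *\<^sub>R (w - c) \<in> ball w e" by (simp add: dist_norm)
  then obtain s where s: "\<forall>j\<in>{1..m}. 0 \<le> s j \<and> s j \<le> 1" "w + \<delta> *\<^sub>R (w - c) = (\<Sum>j\<in>{1..m}. s j *\<^sub>R g j)"
    using e(2) mem_zonotope by blast
  define t where "t j = (s j + \<delta> / 2) / (1 + \<delta>)" for j
  show thesis
  proof
    show "0 < t j \<and> t j < 1" if "j \<in> {1..m}" for j
    proof -
      have "0 \<le> s j" "s j \<le> 1" using s(1) that by auto
      then have "0 < s j + \<delta> / 2" "s j + \<delta> / 2 < 1 + \<delta>" using d by linarith+
      then show ?thesis using d by (simp add: t_def)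
    qed
    have "(1 + \<delta>) *\<^sub>R w = (w + \<delta> *\<^sub>R (w - c)) + \<delta> *\<^sub>R c" by (simp add: algebra_simps)
    also have "\<dots> = (\<Sum>j\<in>{1..m}. s j *\<^sub>R g j) + \<delta> *\<^sub>R c" unfolding s(2) ..
    also have "\<dots> = (\<Sum>j\<in>{1..m}. (s j + \<delta> / 2) *\<^sub>R g j)"
      unfolding c_def by (simp add: scaleR_sum_right scaleR_add_left sum.distrib)
    also have "\<dots> = (1 + \<delta>) *\<^sub>R (\<Sum>j\<in>{1..m}. t j *\<^sub>R g j)"
      unfolding scaleR_sum_right using d by (intro sum.cong) (auto simp: t_def)
    finally show "w = (\<Sum>j\<in>{1..m}. t j *\<^sub>R g j)" using d by simp
  qed
qed

lemma deep_point_coeff_asym: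
  fixes N :: real
  assumes N: "N > 2" and ne: "interior (zonotope m g) \<noteq> {}"
    and s: "\<And>j. j \<in> {1..m} \<Longrightarrow> 1 / N \<le> s j \<and> s j \<le> 1 - 1 / N"
  defines "w \<equiv> \<Sum>j\<in>{1..m}. s j *\<^sub>R g j"
  shows "w \<in> interior (zonotope m g)" "coeff_asym (zonotope m g) w \<le> N - 1"
proof -
  let ?Z = "zonotope m g" and ?c = "\<Sum>j\<in>{1..m}. (1/2) *\<^sub>R g j"
  have sN: "1 \<le> N * s j" "N * s j \<le> N - 1" if "j \<in> {1..m}" for j
    using s[OF that] N by (simp_all add: field_simps)
  \<comment> \<open>This stretches [1 / N, 1 - 1 / N] to [0, 1] about 1 / 2; contracting back
    towards the interior centre shows that w is interior.\<close>
  define z where "z j = (N * s j - 1) / (N - 2)" for j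
  have "(\<Sum>j\<in>{1..m}. z j *\<^sub>R g j) \<in> ?Z"
    using sN N by (intro mem_zonotopeI) (auto simp: z_def field_simps)
  moreover have "?c \<in> interior ?Z" using ne zonotope_center_interior by blast
  ultimately have "(\<Sum>j\<in>{1..m}. z j *\<^sub>R g j) - (2 / N) *\<^sub>R ((\<Sum>j\<in>{1..m}. z j *\<^sub>R g j) - ?c) \<in> interior ?Z"
    using N by (intro mem_interior_convex_shrink convex_zonotope) auto
  also have "(\<Sum>j\<in>{1..m}. z j *\<^sub>R g j) - (2 / N) *\<^sub>R ((\<Sum>j\<in>{1..m}. z j *\<^sub>R g j) - ?c) = w"
  proof -
    have "z j - (2 / N) * (z j - 1 / 2) = s j" for j
      using N by (simp add: z_def divide_simps) (simp add: algebra_simps)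
    then have "(z j *\<^sub>R g j) - (2 / N) *\<^sub>R (z j *\<^sub>R g j - (1/2) *\<^sub>R g j) = s j *\<^sub>R g j" for j
      by (metis scaleR_left_diff_distrib scaleR_scaleR)
    then show ?thesis unfolding w_def sum_subtractf[symmetric] scaleR_sum_right by simp
  qed
  finally show w: "w \<in> interior ?Z" .
  have "(\<lambda>x. w - x) ` ?Z \<subseteq> (\<lambda>x. (N - 1) *\<^sub>R (x - w)) ` ?Z"
  proof clarify
    fix x assume "x \<in> ?Z"
    then obtain t where t: "\<forall>j\<in>{1..m}. 0 \<le> t j \<and> t j \<le> 1" "x = (\<Sum>j\<in>{1..m}. t j *\<^sub>R g j)"
      unfolding mem_zonotope by blast
    \<comment> \<open>The solution of (N - 1) * (y j - s j) = s j - t j; it stays in [0, 1] because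
      1 \<le> N * s j \<le> N - 1.\<close>
    define y where "y j = (N * s j - t j) / (N - 1)" for j
    have yZ: "(\<Sum>j\<in>{1..m}. y j *\<^sub>R g j) \<in> ?Z"
    proof (rule mem_zonotopeI)
      fix j assume j: "j \<in> {1..m}"
      then have "0 \<le> t j" "t j \<le> 1" using t(1) by auto
      then have "0 \<le> N * s j - t j" "N * s j - t j \<le> N - 1" using sN[OF j] by linarith+
      then show "0 \<le> y j \<and> y j \<le> 1" using N by (simp add: y_def)
    qed
    have "(N - 1) * (y j - s j) = s j - t j" for j
      using N by (simp add: y_def field_simps)
    then have "(N - 1) *\<^sub>R (y j *\<^sub>R g j - s j *\<^sub>R g j) = s j *\<^sub>R g j - t j *\<^sub>R g j" for j
      by (metis scaleR_left_diff_distrib scaleR_scaleR)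
    then have "w - x = (N - 1) *\<^sub>R ((\<Sum>j\<in>{1..m}. y j *\<^sub>R g j) - w)"
      unfolding w_def t(2) sum_subtractf[symmetric] scaleR_sum_right by simp
    with yZ show "w - x \<in> (\<lambda>x. (N - 1) *\<^sub>R (x - w)) ` ?Z" by blast
  qed
  then show "coeff_asym ?Z w \<le> N - 1"
    using N by (intro coeff_asym_least(2)[OF compact_zonotope w]) auto
qed

lemma w_fun_gt_2: "n \<ge> 1 \<Longrightarrow> w_fun n > 2"
  using w_fun_gt_double[of n] by linarith

lemma zonotope_deep_lattice_point:
  fixes g :: "nat \<Rightarrow> real ^ 'n"
  assumes g: "\<forall>j\<in>{1..m}. lattice_point (g j)"
    and w: "w \<in> interior (zonotope m g)" "lattice_point w"
  shows "\<exists>w \<in> interior (zonotope m g). lattice_point w \<and>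
           coeff_asym (zonotope m g) w \<le> real (w_fun CARD('n)) - 1"
proof -
  let ?N = "real (w_fun CARD('n))"
  have "CARD('n) \<ge> 1" by (simp add: Suc_le_eq)
  then have N: "?N > 2" using w_fun_gt_2 by fastforce
  obtain t where t: "\<And>j. j \<in> {1..m} \<Longrightarrow> 0 < t j \<and> t j < 1" "w = (\<Sum>j\<in>{1..m}. t j *\<^sub>R g j)"
    using interior_zonotope_coords[OF w(1)] by blast
  have "\<exists>s. (\<forall>j\<in>{1..m}. 1 / ?N \<le> s j \<and> s j \<le> 1 - 1 / ?N) \<and> lattice_point (\<Sum>j\<in>{1..m}. s j *\<^sub>R g j)"
    using g t(1) w(2)[unfolded t(2)] by (intro deep_combination) auto
  then obtain s where s: "\<And>j. j \<in> {1..m} \<Longrightarrow> 1 / ?N \<le> s j \<and> s j \<le> 1 - 1 / ?N"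
    "lattice_point (\<Sum>j\<in>{1..m}. s j *\<^sub>R g j)" by blast
  have ne: "interior (zonotope m g) \<noteq> {}" using w(1) by blast
  show ?thesis
    using deep_point_coeff_asym[OF N ne s(1)] s(2) by (intro bexI[of _ "\<Sum>j\<in>{1..m}. s j *\<^sub>R g j"]) auto
qed

section \<open>Sharpness\<close>

text \<open>With b the inverse of k modulo z, one of b and z - b is below z / 2; a tie 2 * b = z
  would contradict z > 2, as b is a unit.\<close>

lemma unit_or_negative_below_half:
  fixes k z :: nat
  assumes z: "z > 2" and k: "coprime k z"
  obtains a where "a > 0" "2 * a < z" "coprime a z" "[int a * int k = 1] (mod int z) \<or> [int a * int k = -1] (mod int z)"
proof -
  obtain x where "[k * x = 1] (mod z)" using cong_solve_coprime_nat[OF k] by auto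
  define b where "b = x mod z"
  have kb: "[k * b = 1] (mod z)"
    using \<open>[k * x = 1] (mod z)\<close> by (simp add: b_def cong_def mod_mult_right_eq)
  have "coprime (k * b) z" using kb by (metis coprime_1_left cong_imp_coprime cong_sym)
  then have cop: "coprime b z" by simp
  have bz: "b < z" using z by (simp add: b_def)
  have b0: "b > 0" using cop z by (intro Nat.gr0I) auto
  have int_kb: "[int b * int k = 1] (mod int z)"
    using kb by (metis cong_int_iff mult.commute of_nat_1 of_nat_mult)
  have ne: "2 * b \<noteq> z"
  proof
    assume "2 * b = z"
    then have "b dvd z" by auto
    then have "b = 1" using cop by (metis coprime_absorb_left nat_dvd_1_iff_1)
    with \<open>2 * b = z\<close> z show False by simp
  qed
  show thesis
  proof (cases "2 * b < z")
    case True
    then show thesis using that[of b] b0 cop int_kb by blast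
  next
    case False
    have "gcd (z - b) z = gcd b z"
      using bz gcd_diff2_nat[of b z] by (metis gcd.commute gcd_diff1_nat less_imp_le)
    then have "coprime (z - b) z" using cop by (simp add: coprime_iff_gcd_eq_1)
    moreover have "[int (z - b) * int k = -1] (mod int z)"
    proof -
      have "int (z - b) * int k = int z * int k - int b * int k" using bz by (simp add: of_nat_diff algebra_simps)
      also have "[\<dots> = 0 - 1] (mod int z)" using int_kb by (intro cong_diff) (auto simp: cong_0_iff)
      finally show ?thesis by simp
    qed
    ultimately show thesis using that[of "z - b"] False bz ne by auto
  qed
qed

text \<open>
  The numerators of \<open>1 / p\<close> force a multiplier \<open>k\<close> that keeps all multiples non-integral to be a unit, and then some
  unit numerator is moved to \<open>1\<close> or \<open>-1\<close>.
\<close>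

definition witness_numerators :: "nat \<Rightarrow> nat set" where
  "witness_numerators z = {a. a > 0 \<and> 2 * a < z \<and> coprime a z} \<union>
     (if prime z then {} else (\<lambda>p. z div p) ` prime_factors z)"

text \<open>This count explains the condition \<phi>(z) / 2 + h(z) \<le> d: one numerator from each
  pair of opposite units, and one for each prime divisor of a composite z.\<close>

lemma card_witness_numerators:
  assumes "z > 0"
  shows "finite (witness_numerators z)" "2 * card (witness_numerators z) \<le> totient z + 2 * h_fun z"
proof -
  let ?A = "{a. a > 0 \<and> 2 * a < z \<and> coprime a z}"
  let ?B = "if prime z then {} else (\<lambda>p. z div p) ` prime_factors z"
  have fin: "finite ?A" by (rule finite_subset[of _ "{..z}"]) auto
  show "finite (witness_numerators z)" unfolding witness_numerators_def using fin by simp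
  have "card ?B \<le> h_fun z" by (simp add: h_fun_def card_image_le)
  moreover have "2 * card ?A \<le> totient z" using half_period_card[OF assms, of 1] by simp
  ultimately show "2 * card (witness_numerators z) \<le> totient z + 2 * h_fun z"
    unfolding witness_numerators_def using card_Un_le[of ?A ?B] by linarith
qed

lemma witness_numerators_less: "z > 0 \<Longrightarrow> a \<in> witness_numerators z \<Longrightarrow> 0 < a \<and> a < z"
  unfolding witness_numerators_def
  by (auto split: if_splits simp: prime_factors_dvd prime_gt_Suc_0_nat prime_gt_0_nat dvd_imp_le intro!: div_less_dividend)

lemma witness_numerators_force:
  fixes z k :: nat
  assumes z: "z > 2" and k: "k < z" "\<And>a. a \<in> witness_numerators z \<Longrightarrow> \<not> z dvd a * k"
  obtains a where "a \<in> witness_numerators z"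
    "[int a * int k = 1] (mod int z) \<or> [int a * int k = -1] (mod int z)"
proof -
  have k0: "k > 0"
  proof (rule Nat.gr0I)
    assume "k = 0"
    have "1 \<in> witness_numerators z" using z by (simp add: witness_numerators_def)
    then show False using k(2) \<open>k = 0\<close> by fastforce
  qed
  have "coprime k z"
  proof (cases "prime z")
    case True
    \<comment> \<open>Modulo a prime every nonzero residue is a unit, which explains h(z) = 0 for
      prime z.\<close>
    have "\<not> z dvd k" using k(1) k0 by (auto dest: dvd_imp_le)
    then show ?thesis using True by (metis coprime_commute prime_imp_coprime)
  next
    case False
    show ?thesis
    proof (rule coprime_if_no_common_prime)
      fix p assume p: "prime p" "p dvd z"
      then have "z div p \<in> witness_numerators z"
        using False z by (auto simp: witness_numerators_def prime_factors_dvd)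
      then have "\<not> z dvd (z div p) * k" by (rule k(2))
      moreover have "z = (z div p) * p" using p(2) by simp
      ultimately show "\<not> p dvd k" by (metis mult_dvd_mono dvd_refl)
    qed
  qed
  then obtain a where "a > 0" "2 * a < z" "coprime a z"
    "[int a * int k = 1] (mod int z) \<or> [int a * int k = -1] (mod int z)"
    using unit_or_negative_below_half[OF z] by blast
  then show thesis by (intro that[of a]) (auto simp: witness_numerators_def)
qed

lemma surjection_from_larger:
  assumes "finite S" "S \<noteq> {}" "card S \<le> CARD('a::finite)"
  obtains f :: "'a::finite \<Rightarrow> 'b" where "range f = S"
proof -
  obtain h :: "'b \<Rightarrow> 'a" where h: "inj_on h S" using card_le_inj[OF assms(1) finite assms(3)] by blast
  obtain s where s: "s \<in> S" using assms(2) by blast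
  define f where "f i = (if i \<in> h ` S then inv_into S h i else s)" for i
  have "range f \<subseteq> S" using s by (auto simp: f_def inv_into_into)
  moreover have "S \<subseteq> range f"
  proof
    fix x assume "x \<in> S"
    then have "f (h x) = x" using h by (simp add: f_def)
    then show "x \<in> range f" by (metis rangeI)
  qed
  ultimately show thesis by (intro that[of f]) auto
qed

section \<open>The extremal parallelepiped\<close>

context
  fixes z :: nat and f :: "'n::finite \<Rightarrow> nat" and i0 :: 'n
begin

text \<open>
  In the coordinates given by the generators, the integer lattice becomes the lattice spanned by
  the integer points and the point \<open>(f i / z)\<^sub>i\<close>; integrality of the generators needs \<open>f i0 = 1\<close>.
\<close>

definition extremal_gen :: "'n \<Rightarrow> real ^ 'n" where
  "extremal_gen i = (if i = i0 then (\<chi> k. if k = i0 then real z else - real (f k)) else axis i 1)"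

text \<open>For z > 0 the inverse of the coefficient map of \<open>extremal_gen\<close>; the
  coordinate \<open>i0\<close> is solved first and substituted into the others.\<close>

definition extremal_coord :: "real ^ 'n \<Rightarrow> 'n \<Rightarrow> real" where
  "extremal_coord x i = (if i = i0 then x $ i0 / z else x $ i + f i * (x $ i0 / z))"

lemma lattice_point_extremal_gen: "lattice_point (extremal_gen i)"
  by (auto simp: lattice_point_def extremal_gen_def axis_def)

lemma sum_extremal_gen_nth:
  fixes t :: "'n \<Rightarrow> real"
  shows "(\<Sum>i\<in>UNIV. t i *\<^sub>R extremal_gen i) $ k = (if k = i0 then z * t i0 else t k - f k * t i0)"
proof -
  have "(\<Sum>i\<in>UNIV. t i *\<^sub>R extremal_gen i) $ k = (\<Sum>i\<in>UNIV. t i * extremal_gen i $ k)"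
    by (simp add: sum_component)
  also have "\<dots> = t i0 * extremal_gen i0 $ k + (\<Sum>i\<in>UNIV - {i0}. t i * extremal_gen i $ k)"
    by (rule sum.remove) auto
  also have "(\<Sum>i\<in>UNIV - {i0}. t i * extremal_gen i $ k) = (\<Sum>i\<in>UNIV - {i0}. if i = k then t k else 0)"
    by (intro sum.cong) (auto simp: extremal_gen_def axis_def)
  also have "\<dots> = (if k = i0 then 0 else t k)" by (auto simp: sum.delta)
  finally show ?thesis by (auto simp: extremal_gen_def)
qed

lemma extremal_coord_sum:
  fixes t :: "'n \<Rightarrow> real"
  assumes "z > 0"
  shows "extremal_coord (\<Sum>i\<in>UNIV. t i *\<^sub>R extremal_gen i) k = t k"
  unfolding extremal_coord_def sum_extremal_gen_nth using assms by simp

lemma sum_extremal_coord: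
  assumes "z > 0"
  shows "(\<Sum>i\<in>UNIV. extremal_coord x i *\<^sub>R extremal_gen i) = x"
  unfolding vec_eq_iff sum_extremal_gen_nth using assms by (simp add: extremal_coord_def)

lemma extremal_coord_diff: "extremal_coord (x - y) i = extremal_coord x i - extremal_coord y i"
  by (simp add: extremal_coord_def diff_divide_distrib algebra_simps)

lemma extremal_coord_scaleR: "extremal_coord (c *\<^sub>R x) i = c * extremal_coord x i"
  by (simp add: extremal_coord_def algebra_simps)

lemma continuous_extremal_coord: "continuous_on UNIV (\<lambda>x. extremal_coord x i)"
  unfolding extremal_coord_def divide_inverse by (cases "i = i0") (auto intro!: continuous_intros)

definition extremal_zonotope :: "(real ^ 'n) set" where
  "extremal_zonotope = {x. \<forall>i. 0 \<le> extremal_coord x i \<and> extremal_coord x i \<le> 1}"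

lemma interior_extremal_zonotope:
  "{x. \<forall>i. 0 < extremal_coord x i \<and> extremal_coord x i < 1} \<subseteq> interior extremal_zonotope"
proof (rule interior_maximal)
  have "{x. \<forall>i. 0 < extremal_coord x i \<and> extremal_coord x i < 1}
      = (\<Inter>i. {x. 0 < extremal_coord x i} \<inter> {x. extremal_coord x i < 1})" by auto
  also have "open \<dots>"
    by (intro open_INT ballI open_Int open_Collect_less continuous_extremal_coord continuous_on_const) auto
  finally show "open {x. \<forall>i. 0 < extremal_coord x i \<and> extremal_coord x i < 1}" .
qed (auto simp: extremal_zonotope_def less_imp_le)

lemma zonotope_extremal:
  assumes "z > 0" and b: "bij_betw b {1..m} (UNIV :: 'n set)"
  shows "zonotope m (\<lambda>j. extremal_gen (b j)) = extremal_zonotope"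
proof (intro set_eqI iffI)
  have reindex: "(\<Sum>j\<in>{1..m}. t (b j) *\<^sub>R extremal_gen (b j)) = (\<Sum>i\<in>UNIV. t i *\<^sub>R extremal_gen i)" for t
    using b by (rule sum.reindex_bij_betw)
  {
    fix x assume "x \<in> zonotope m (\<lambda>j. extremal_gen (b j))"
    then obtain t where t: "\<forall>j\<in>{1..m}. 0 \<le> t j \<and> t j \<le> 1" "x = (\<Sum>j\<in>{1..m}. t j *\<^sub>R extremal_gen (b j))"
      unfolding mem_zonotope by blast
    define u where "u i = t (inv_into {1..m} b i)" for i
    have ub: "u (b j) = t j" if "j \<in> {1..m}" for j
      using b that by (simp add: u_def bij_betw_def)
    have "x = (\<Sum>j\<in>{1..m}. u (b j) *\<^sub>R extremal_gen (b j))" unfolding t(2) using ub by (intro sum.cong) auto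
    then have x: "x = (\<Sum>i\<in>UNIV. u i *\<^sub>R extremal_gen i)" unfolding reindex .
    have "0 \<le> u i \<and> u i \<le> 1" for i
    proof -
      have "i \<in> b ` {1..m}" using b by (simp add: bij_betw_def)
      then show ?thesis using t(1) ub by auto
    qed
    then show "x \<in> extremal_zonotope"
      unfolding extremal_zonotope_def x by (simp add: extremal_coord_sum[OF assms(1)])
  next
    fix x assume "x \<in> extremal_zonotope"
    then have "(\<Sum>j\<in>{1..m}. extremal_coord x (b j) *\<^sub>R extremal_gen (b j)) \<in> zonotope m (\<lambda>j. extremal_gen (b j))"
      by (intro mem_zonotopeI) (simp add: extremal_zonotope_def)
    then show "x \<in> zonotope m (\<lambda>j. extremal_gen (b j))"
      unfolding reindex sum_extremal_coord[OF assms(1)] .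
  }
qed

text \<open>Put k = \<open>w $ i0\<close>. Up to integers the coefficients of w are f i * k / z, and
  lying in (0, 1) they are non-integral. So \<open>witness_numerators_force\<close> makes one of
  them 1 / z or 1 - 1 / z, and its distances to 0 and 1 have ratio z - 1.\<close>

lemma extremal_asymmetry:
  assumes z: "z > 2" and f: "range f = witness_numerators z" "f i0 = 1"
    and w: "lattice_point w" "\<And>i. 0 < extremal_coord w i \<and> extremal_coord w i < 1"
    and l: "l \<ge> 1" "(\<lambda>x. w - x) ` extremal_zonotope \<subseteq> (\<lambda>x. l *\<^sub>R (x - w)) ` extremal_zonotope"
  shows "real z - 1 \<le> l"
proof -
  have z0: "z > 0" using z by simp
  let ?t = "extremal_coord w"
  have t0: "?t i0 = w $ i0 / z" by (simp add: extremal_coord_def)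
  have w_int: "w $ i \<in> \<int>" for i using w(1) by (simp add: lattice_point_def)
  obtain \<kappa> where \<kappa>: "w $ i0 = of_int \<kappa>" using w_int[of i0] by (rule Ints_cases)
  have "0 < real_of_int \<kappa> / real z" "real_of_int \<kappa> / real z < 1"
    using w(2)[of i0] unfolding t0 \<kappa> by blast+
  then have "0 < real_of_int \<kappa>" "real_of_int \<kappa> < real z"
    using z0 by (simp_all add: zero_less_divide_iff divide_less_eq)
  then have "0 < \<kappa>" "\<kappa> < int z" by linarith+
  then have "\<kappa> = int (nat \<kappa>)" "nat \<kappa> < z" by linarith+
  then obtain k where k: "\<kappa> = int k" "k < z" by blast
  have ti: "\<exists>j. ?t i = (int (f i) * int k + int z * j) / z" for i
  proof (cases "i = i0")
    case True
    then show ?thesis using t0 \<kappa> k f(2) by (intro exI[of _ 0]) simp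
  next
    case False
    obtain j where "w $ i = of_int j" using w_int[of i] by (rule Ints_cases)
    then have "?t i = real_of_int j + real (f i) * (real k / real z)"
      using False \<kappa> k(1) by (simp add: extremal_coord_def)
    also have "\<dots> = (int (f i) * int k + int z * j) / z"
      using z0 by (simp add: add_divide_distrib)
    finally show ?thesis by blast
  qed
  have ndvd: "\<not> int z dvd int (f i) * int k + int z * j" if "?t i = (int (f i) * int k + int z * j) / z" for i j
  proof
    assume "int z dvd int (f i) * int k + int z * j"
    then obtain c where c: "int (f i) * int k + int z * j = int z * c" by (elim dvdE)
    then have "?t i = of_int c" using that z by simp
    then have "0 < real_of_int c" "real_of_int c < 1" using w(2)[of i] by simp_all
    then have "0 < c" "c < 1" by simp_all
    then show False by linarith
  qed
  have "\<not> z dvd a * k" if "a \<in> witness_numerators z" for a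
  proof
    assume dvd: "z dvd a * k"
    have "a \<in> range f" unfolding f(1) by (rule that)
    then obtain i where "f i = a" by blast
    obtain j where "?t i = (int (f i) * int k + int z * j) / z" using ti by blast
    moreover have "int z dvd int (f i) * int k" unfolding \<open>f i = a\<close> of_nat_mult[symmetric] int_dvd_int_iff by (rule dvd)
    then have "int z dvd int (f i) * int k + int z * j" by (intro dvd_add) simp_all
    ultimately show False using ndvd by blast
  qed
  from witness_numerators_force[OF z k(2) this] obtain a where a: "a \<in> witness_numerators z"
    "[int a * int k = 1] (mod int z) \<or> [int a * int k = -1] (mod int z)" .
  have "a \<in> range f" unfolding f(1) by (rule a(1))
  then obtain i where i: "f i = a" by blast
  obtain j where j: "?t i = (int (f i) * int k + int z * j) / z" using ti by blast
  obtain e :: int where e: "e = 1 \<or> e = -1" "[int a * int k = e] (mod int z)" using a(2) by blast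
  then obtain c where "int a * int k - e = int z * c" unfolding cong_iff_dvd_diff by (elim conjE dvdE)
  then have c: "int a * int k = e + int z * c" by linarith
  have t: "?t i = e / z + of_int (c + j)"
    unfolding j i c using z by (simp add: field_simps)
  have frac_t: "?t i = 1 / z \<or> ?t i = 1 - 1 / z"
  proof (cases "e = 1")
    case True
    have "0 < 1 / real z" "1 / real z < 1" using z by auto
    moreover have "?t i = 1 / z + of_int (c + j)" using t True by simp
    ultimately have "- 1 < real_of_int (c + j)" "real_of_int (c + j) < 1" using w(2)[of i] by linarith+
    then have "c + j = 0" by linarith
    then show ?thesis using t True by simp
  next
    case False
    then have "e = -1" using e by blast
    moreover have "0 < 1 / real z" "1 / real z < 1" using z by auto
    moreover have "?t i = - (1 / z) + of_int (c + j)" using t \<open>e = -1\<close> by simp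
    ultimately have "0 < real_of_int (c + j)" "real_of_int (c + j) < 2" using w(2)[of i] by linarith+
    then have "c + j = 1" by linarith
    then show ?thesis using t \<open>e = -1\<close> by simp
  qed
  have key: "?t i - extremal_coord x i \<le> l * (1 - ?t i) \<and> - (l * ?t i) \<le> ?t i - extremal_coord x i"
    if "x \<in> extremal_zonotope" for x
  proof -
    have "w - x \<in> (\<lambda>x. l *\<^sub>R (x - w)) ` extremal_zonotope" using l(2) that by blast
    then obtain y where y: "y \<in> extremal_zonotope" "w - x = l *\<^sub>R (y - w)" by (elim imageE)
    have "extremal_coord (w - x) i = extremal_coord (l *\<^sub>R (y - w)) i" unfolding y(2) ..
    then have "?t i - extremal_coord x i = l * (extremal_coord y i - ?t i)"
      unfolding extremal_coord_diff extremal_coord_scaleR .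
    moreover have "0 \<le> extremal_coord y i" "extremal_coord y i \<le> 1"
      using y(1) by (simp_all add: extremal_zonotope_def)
    then have "l * (extremal_coord y i - ?t i) \<le> l * (1 - ?t i)" "l * (0 - ?t i) \<le> l * (extremal_coord y i - ?t i)"
      using l(1) by (intro mult_left_mono; linarith)+
    ultimately show ?thesis by simp
  qed
  from frac_t show ?thesis
  proof
    assume t: "?t i = 1 / z"
    \<comment> \<open>A vertex on the facet opposite to the one near w; for the coefficient 1 - 1 /
      z the vertex 0 plays this role.\<close>
    define x where "x = (\<Sum>i\<in>UNIV. 1 *\<^sub>R extremal_gen i)"
    have "extremal_coord x k = 1" for k
      unfolding x_def using extremal_coord_sum[OF z0, of "\<lambda>_. 1" k] .
    then have "x \<in> extremal_zonotope" "extremal_coord x i = 1" by (simp_all add: extremal_zonotope_def)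
    then have "- (l * (1 / z)) \<le> 1 / z - 1" using key[of x] unfolding t by simp
    then have "real z * (- (l * (1 / z))) \<le> real z * (1 / z - 1)" by (rule mult_left_mono) simp
    then show ?thesis using z0 by (simp add: right_diff_distrib)
  next
    assume t: "?t i = 1 - 1 / z"
    have "extremal_coord 0 k = 0" for k by (simp add: extremal_coord_def)
    then have "0 \<in> extremal_zonotope" "extremal_coord 0 i = 0" by (simp_all add: extremal_zonotope_def)
    then have "1 - 1 / z \<le> l * (1 - (1 - 1 / z))" using key[of 0] unfolding t by simp
    then have "real z * (1 - 1 / z) \<le> real z * (l * (1 - (1 - 1 / z)))" by (rule mult_left_mono) simp
    then show ?thesis using z0 by (simp add: right_diff_distrib)
  qed
qed

text \<open>The unit vector in direction \<open>i0\<close> has the coefficients f i / z.\<close>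

lemma extremal_unit_point:
  assumes z: "z > 2" and f: "range f = witness_numerators z" "f i0 = 1"
  shows "\<exists>w \<in> interior extremal_zonotope. lattice_point w"
proof
  have "0 < f i \<and> f i < z" for i using witness_numerators_less[of z "f i"] f(1) z by auto
  then have "0 < extremal_coord (axis i0 1) i \<and> extremal_coord (axis i0 1) i < 1" for i
    using z by (auto simp: extremal_coord_def axis_def)
  then show "axis i0 1 \<in> interior extremal_zonotope" using interior_extremal_zonotope by blast
  show "lattice_point (axis i0 1 :: real ^ 'n)" by (simp add: lattice_point_def axis_def)
qed

end

lemma zonotope_bound_sharp:
  fixes c :: real
  assumes c: "c < real (w_fun CARD('n)) - 1"
  shows "\<exists>(m :: nat) (g :: nat \<Rightarrow> real ^ 'n).
          m \<ge> CARD('n) \<and> (\<forall>j\<in>{1..m}. lattice_point (g j)) \<and>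
          (\<exists>w \<in> interior (zonotope m g). lattice_point w) \<and>
          \<not> (\<exists>w \<in> interior (zonotope m g). lattice_point w \<and> coeff_asym (zonotope m g) w \<le> c)"
proof -
  define n where "n = CARD('n)"
  have n: "n \<ge> 1" by (simp add: n_def Suc_le_eq)
  define z where "z = w_fun n"
  have z: "z > 2" using w_fun_gt_2[OF n] by (simp add: z_def)
  then have z0: "z > 0" by simp
  have one: "1 \<in> witness_numerators z" using z by (simp add: witness_numerators_def)
  have "2 * card (witness_numerators z) \<le> 2 * n"
    using card_witness_numerators(2)[OF z0] w_fun_attains[OF n] by (simp add: z_def)
  then have "card (witness_numerators z) \<le> CARD('n)" by (simp add: n_def)
  then obtain f :: "'n \<Rightarrow> nat" where f: "range f = witness_numerators z"
    using surjection_from_larger[OF card_witness_numerators(1)[OF z0]] one by blast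
  obtain i0 where i0: "f i0 = 1" using one f by (metis rangeE)
  obtain b where b: "bij_betw b {1..n} (UNIV :: 'n set)"
    using ex_bij_betw_nat_finite_1[of "UNIV :: 'n set"] by (auto simp: n_def)
  define g where "g j = extremal_gen z f i0 (b j)" for j
  have Z: "zonotope n g = extremal_zonotope z f i0"
    unfolding g_def using zonotope_extremal[OF z0 b] .
  have "\<not> coeff_asym (zonotope n g) w \<le> c" if w: "w \<in> interior (zonotope n g)" "lattice_point w" for w
  proof -
    have "0 < extremal_coord z f i0 w i \<and> extremal_coord z f i0 w i < 1" for i
    proof -
      obtain t where t: "\<And>j. j \<in> {1..n} \<Longrightarrow> 0 < t j \<and> t j < 1" "w = (\<Sum>j\<in>{1..n}. t j *\<^sub>R g j)"
        using interior_zonotope_coords[OF w(1)] by blast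
      define u where "u i = t (inv_into {1..n} b i)" for i
      have ub: "u (b j) = t j" if "j \<in> {1..n}" for j using b that by (simp add: u_def bij_betw_def)
      have "w = (\<Sum>j\<in>{1..n}. u (b j) *\<^sub>R extremal_gen z f i0 (b j))"
        unfolding t(2) g_def using ub by (intro sum.cong) auto
      also have "\<dots> = (\<Sum>i\<in>UNIV. u i *\<^sub>R extremal_gen z f i0 i)" using b by (rule sum.reindex_bij_betw)
      finally have "extremal_coord z f i0 w i = u i" by (simp add: extremal_coord_sum[OF z0])
      moreover have "i \<in> b ` {1..n}" using b by (simp add: bij_betw_def)
      ultimately show ?thesis using t(1) ub by auto
    qed
    moreover have "1 \<le> coeff_asym (zonotope n g) w \<and> (\<lambda>x. w - x) ` zonotope n g \<subseteq>
        (\<lambda>x. coeff_asym (zonotope n g) w *\<^sub>R (x - w)) ` zonotope n g"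
      using coeff_asym_least(1)[OF compact_zonotope w(1)] .
    ultimately have "real z - 1 \<le> coeff_asym (zonotope n g) w"
      using w(2) unfolding Z by (intro extremal_asymmetry[OF z f i0]) auto
    then show ?thesis using c by (simp add: z_def n_def)
  qed
  moreover have "\<exists>w \<in> interior (zonotope n g). lattice_point w"
    unfolding Z by (rule extremal_unit_point[OF z f i0])
  moreover have "\<forall>j\<in>{1..n}. lattice_point (g j)" by (simp add: g_def lattice_point_extremal_gen)
  ultimately show ?thesis by (intro exI[of _ n] exI[of _ g]) (auto simp: n_def)
qed

section \<open>Growth of w\<close>

definition primes_upto :: "nat \<Rightarrow> nat set" where "primes_upto n = {p. prime p \<and> p \<le> n}"

lemma finite_primes_upto [simp]: "finite (primes_upto n)"
  unfolding primes_upto_def by (rule finite_subset[of _ "{..n}"]) auto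

lemma primes_upto_Suc: "primes_upto (Suc n) = (if prime (Suc n) then insert (Suc n) (primes_upto n) else primes_upto n)"
  by (auto simp: primes_upto_def le_Suc_eq)

lemma prod_primes_dvd:
  fixes x :: nat
  assumes "finite A" "\<And>p. p \<in> A \<Longrightarrow> prime p \<and> p dvd x" shows "\<Prod>A dvd x"
  using assms
proof (induction A)
  case (insert p F)
  have "coprime p (\<Prod>F)" using insert by (intro prod_coprime_right) (auto intro!: primes_coprime)
  then show ?case using insert by (simp add: divides_mult)
qed simp

text \<open>The argument of Erdos: for n = 2 * m + 1, the primes in (m + 1, n] divide
  \<open>n choose m\<close>, which is at most 2 ^ n. With base 8 this crude bound passes the
  induction, since 3 * (m + 1) + n \<le> 3 * n for m \<ge> 1.\<close>

lemma primorial_le: "\<Prod>(primes_upto n) \<le> 8 ^ n"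
proof (induction n rule: less_induct)
  case (less n)
  consider "n < 2" | "n = 2" | "n > 2" "even n" | "n > 2" "odd n" by linarith
  then show ?case
  proof cases
    case 1
    then have "primes_upto n = {}" by (auto simp: primes_upto_def dest: prime_ge_2_nat)
    then show ?thesis by simp
  next
    case 2
    have "primes_upto n \<subseteq> {2}" using 2 by (auto simp: primes_upto_def dest: prime_ge_2_nat)
    then have "primes_upto n = {} \<or> primes_upto n = {2}" by blast
    then show ?thesis using 2 by auto
  next
    case 3
    then obtain k where k: "n = Suc k" by (cases n) auto
    have "\<not> prime n" using 3 primes_dvd_imp_eq[of 2 n] by auto
    then have "primes_upto n = primes_upto k" unfolding k by (simp add: primes_upto_Suc)
    also have "\<Prod>\<dots> \<le> 8 ^ k" using less k by simp
    finally show ?thesis using k by simp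
  next
    case 4
    then obtain m where m: "n = 2 * m + 1" by (elim oddE)
    let ?A = "{p. prime p \<and> m + 1 < p \<and> p \<le> n}"
    have fin: "finite ?A" by (rule finite_subset[of _ "{..n}"]) auto
    have "\<Prod>?A dvd n choose m"
    proof (rule prod_primes_dvd[OF fin])
      fix p assume p: "p \<in> ?A"
      have "fact m * fact (n - m) * (n choose m) = fact n" using m by (intro binomial_fact_lemma) simp
      moreover have "p dvd fact n" using p by (subst prime_dvd_fact_iff) auto
      moreover have "\<not> p dvd fact m" using p by (subst prime_dvd_fact_iff) auto
      moreover have "\<not> p dvd fact (n - m)" using p m by (subst prime_dvd_fact_iff) auto
      ultimately show "prime p \<and> p dvd n choose m" using p by (auto simp: prime_dvd_mult_iff dest!: sym[of _ "fact n"])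
    qed
    then have "\<Prod>?A \<le> n choose m" using m by (intro dvd_imp_le) auto
    also have "\<dots> \<le> 2 ^ n" by (rule binomial_le_pow2)
    finally have A: "\<Prod>?A \<le> 2 ^ n" .
    have "primes_upto n = primes_upto (m + 1) \<union> ?A" using m by (auto simp: primes_upto_def)
    then have "\<Prod>(primes_upto n) = \<Prod>(primes_upto (m + 1)) * \<Prod>?A"
      using fin by (simp add: prod.union_disjoint primes_upto_def disjoint_iff)
    also have "\<dots> \<le> 8 ^ (m + 1) * 2 ^ n"
      using less[of "m + 1"] 4 m A by (intro mult_le_mono) auto
    also have "(8::nat) ^ (m + 1) * 2 ^ n = 2 ^ (3 * (m + 1) + n)"
      by (simp add: power_add power_mult)
    also have "\<dots> \<le> 2 ^ (3 * n)" using m 4 by (intro power_increasing) auto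
    also have "\<dots> = 8 ^ n" by (simp add: power_mult)
    finally show ?thesis .
  qed
qed

definition log_prime_sum :: "nat \<Rightarrow> real" where
  "log_prime_sum n = (\<Sum>p\<in>primes_upto n. ln p / p)"

definition prime_recip_sum :: "nat \<Rightarrow> real" where
  "prime_recip_sum n = (\<Sum>p\<in>primes_upto n. 1 / p)"

lemma card_multiples: "p > 0 \<Longrightarrow> card {k \<in> {1..n}. p dvd k} = n div p" for p n :: nat
proof -
  assume p: "p > 0"
  have "{k \<in> {1..n}. p dvd k} = (\<lambda>j. p * j) ` {1..n div p}"
  proof safe
    fix k assume "k \<in> {1..n}" "p dvd k"
    then obtain j where "k = p * j" "1 \<le> k" "k \<le> n" by auto
    then show "k \<in> (\<lambda>j. p * j) ` {1..n div p}"
      using p by (intro image_eqI[of _ _ j]) (auto simp: less_eq_div_iff_mult_less_eq mult.commute Suc_le_eq)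
  qed (use p in \<open>auto simp: less_eq_div_iff_mult_less_eq mult.commute Suc_le_eq\<close>)
  then show ?thesis using p by (simp add: card_image inj_on_def)
qed

text \<open>Upper half of Mertens' first theorem. Summing ln p over all pairs p dividing k \<le> n
  gives at most n * ln n; replacing n div p by n / p costs at most the sum of ln p, which
  \<open>primorial_le\<close> bounds by n * ln 8.\<close>

lemma log_prime_sum_le:
  assumes "n > 0" shows "log_prime_sum n \<le> ln n + ln 8"
proof -
  have gt0: "p > 0" if "p \<in> primes_upto n" for p using that by (auto simp: primes_upto_def prime_gt_0_nat)
  have "(\<Sum>p\<in>primes_upto n. real (n div p) * ln p) = (\<Sum>p\<in>primes_upto n. \<Sum>k\<in>{k \<in> {1..n}. p dvd k}. ln p)"
    using gt0 by (intro sum.cong refl) (simp only: sum_constant card_multiples)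
  also have "\<dots> = (\<Sum>k\<in>{1..n}. \<Sum>p\<in>{p \<in> primes_upto n. p dvd k}. ln p)"
    by (rule sum.swap_restrict) auto
  also have "\<dots> \<le> (\<Sum>k\<in>{1..n}. ln n)"
  proof (rule sum_mono)
    fix k assume k: "k \<in> {1..n}"
    let ?A = "{p \<in> primes_upto n. p dvd k}"
    have A: "\<Prod>?A \<le> k" using k by (intro dvd_imp_le prod_primes_dvd) (auto simp: primes_upto_def)
    have pos: "\<Prod>?A > 0" using gt0 by (intro prod_pos) auto
    have "(\<Sum>p\<in>?A. ln (real p)) = ln (\<Prod>p\<in>?A. real p)" using gt0 by (intro ln_prod[symmetric]) auto
    also have "\<dots> = ln (real (\<Prod>?A))" by simp
    also have "\<dots> \<le> ln (real n)" using A pos k by (simp del: of_nat_prod)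
    finally show "(\<Sum>p\<in>?A. ln (real p)) \<le> ln (real n)" .
  qed
  also have "\<dots> = n * ln n" by simp
  finally have 1: "(\<Sum>p\<in>primes_upto n. real (n div p) * ln p) \<le> n * ln n" .
  have "(\<Sum>p\<in>primes_upto n. ln (real p)) = ln (\<Prod>p\<in>primes_upto n. real p)"
    using gt0 by (intro ln_prod[symmetric]) auto
  also have "\<dots> = ln (real (\<Prod>(primes_upto n)))" by simp
  also have "\<dots> \<le> ln (real (8 ^ n))"
    using primorial_le[of n] gt0 by (subst ln_le_cancel_iff) (auto intro!: prod_pos simp del: of_nat_prod of_nat_power)
  also have "\<dots> = n * ln 8" by (simp add: ln_realpow)
  finally have 2: "(\<Sum>p\<in>primes_upto n. ln (real p)) \<le> n * ln 8" .
  have "n * log_prime_sum n - (\<Sum>p\<in>primes_upto n. ln (real p)) = (\<Sum>p\<in>primes_upto n. (n / p - 1) * ln p)"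
    by (simp add: log_prime_sum_def sum_distrib_left sum_subtractf left_diff_distrib)
  also have "\<dots> \<le> (\<Sum>p\<in>primes_upto n. real (n div p) * ln p)"
  proof (intro sum_mono mult_right_mono)
    fix p assume p: "p \<in> primes_upto n"
    have "n < (n div p + 1) * p" using gt0[OF p] by (metis add.commute dividend_less_div_times mult.commute mult_Suc plus_1_eq_Suc)
    then have "real n < (real (n div p) + 1) * real p" by (metis of_nat_1 of_nat_add of_nat_less_iff of_nat_mult)
    then show "n / p - 1 \<le> real (n div p)" using gt0[OF p] by (simp add: field_simps)
    show "ln (real p) \<ge> 0" using gt0[OF p] by simp
  qed
  finally have "n * log_prime_sum n \<le> n * (ln n + ln 8)" using 1 2 by (simp add: distrib_left)
  then show ?thesis using assms by simp
qed

lemma prime_recip_sum_le: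
  obtains K where "\<And>n. n \<ge> 2 \<Longrightarrow> prime_recip_sum n \<le> ln (ln n) + K"
proof -
  define c where "c = ln (8 :: real)"
  \<comment> \<open>Both sides of the claim vanish at n = 2 for this K.\<close>
  define K where "K = c / ln 2 - ln (ln 2)"
  \<comment> \<open>Abel summation in incremental form: the left-hand side grows by \<open>log_prime_sum n * (1 / ln n - 1 / ln (n + 1))\<close>.\<close>
  have claim: "prime_recip_sum n - log_prime_sum n / ln n \<le> ln (ln n) - c / ln n + K" if "n \<ge> 2" for n
    using that
  proof (induction n rule: nat_induct_at_least)
    case base
    have "primes_upto 2 = {2}" by (auto simp: primes_upto_def dest: prime_ge_2_nat)
    then show ?case by (simp add: prime_recip_sum_def log_prime_sum_def K_def)
  next
    case (Suc n)
    define a b where "a = ln (real n)" and "b = ln (real (Suc n))"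
    have ab: "0 < a" "a < b" using Suc.hyps by (auto simp: a_def b_def)
    have "prime_recip_sum (Suc n) - log_prime_sum (Suc n) / b = prime_recip_sum n - log_prime_sum n / b"
    proof (cases "prime (Suc n)")
      case True
      have "Suc n \<notin> primes_upto n" by (simp add: primes_upto_def)
      moreover have "ln (real (Suc n)) / real (Suc n) / b = 1 / real (Suc n)"
        unfolding b_def[symmetric] using ab by (simp del: of_nat_Suc)
      ultimately show ?thesis using True
        by (simp add: prime_recip_sum_def log_prime_sum_def primes_upto_Suc add_divide_distrib del: of_nat_Suc)
    qed (simp add: prime_recip_sum_def log_prime_sum_def primes_upto_Suc)
    also have "\<dots> = (prime_recip_sum n - log_prime_sum n / a) + log_prime_sum n * (1 / a - 1 / b)"
      by (simp add: right_diff_distrib)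
    also have "\<dots> \<le> (ln a - c / a + K) + (a + c) * (1 / a - 1 / b)"
    proof (intro add_mono mult_right_mono)
      show "log_prime_sum n \<le> a + c" using log_prime_sum_le[of n] Suc.hyps by (simp add: a_def c_def)
      show "0 \<le> 1 / a - 1 / b" using ab by (simp add: frac_le)
    qed (use Suc.IH a_def in auto)
    also have "\<dots> = ln a + K + (1 - a / b) - c / b"
      using ab by (simp add: field_simps)
    also have "\<dots> \<le> ln a + K + (ln b - ln a) - c / b"
    proof -
      have "ln (a / b) \<le> a / b - 1" using ab by (intro ln_le_minus_one) auto
      then show ?thesis using ab by (simp add: ln_div)
    qed
    finally show ?case by (simp add: b_def)
  qed
  show thesis
  proof
    fix n :: nat assume n: "n \<ge> 2"
    have "log_prime_sum n / ln n \<le> (ln n + c) / ln n"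
      using n log_prime_sum_le[of n] by (intro divide_right_mono) (auto simp: c_def)
    also have "\<dots> = 1 + c / ln n" using n by (simp add: add_divide_distrib)
    finally show "prime_recip_sum n \<le> ln (ln n) + (K + 1)" using claim[OF n] by linarith
  qed
qed

section \<open>Totients from below and the upper bound on \<open>w_fun\<close>\<close>

lemma omega_le_ln:
  assumes "z > 0" shows "real (omega z) * ln 2 \<le> ln z"
proof -
  have "2 ^ omega z = (\<Prod>p\<in>prime_factors z. 2 :: nat)" by simp
  also have "\<dots> \<le> \<Prod>(prime_factors z)"
    by (rule prod_mono) (auto dest: in_prime_factors_imp_prime prime_ge_2_nat)
  also have "\<dots> \<le> z" using assms by (intro dvd_imp_le prod_primes_dvd) auto
  finally have "real (2 ^ omega z) \<le> real z" by (simp only: of_nat_le_iff)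
  then have "ln (2 ^ omega z) \<le> ln (real z)" using assms by (subst ln_le_cancel_iff) auto
  then show ?thesis by (simp add: ln_realpow)
qed

lemma sum_telescope_le: "(\<Sum>k\<in>{2..n}. 1 / (real k * (real k - 1))) \<le> 1"
proof -
  have "(\<Sum>k\<in>{2..n}. 1 / (real k * (real k - 1))) \<le> 1 - 1 / n" if "n \<ge> 1"
    using that
  proof (induction n rule: nat_induct_at_least)
    case (Suc n)
    have "{2..Suc n} = insert (Suc n) {2..n}" using Suc by auto
    then have "(\<Sum>k\<in>{2..Suc n}. 1 / (real k * (real k - 1)))
        = 1 / (real (Suc n) * (real (Suc n) - 1)) + (\<Sum>k\<in>{2..n}. 1 / (real k * (real k - 1)))" by simp
    also have "\<dots> \<le> 1 / (real (Suc n) * (real (Suc n) - 1)) + (1 - 1 / n)" using Suc by simp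
    also have "1 / (real (Suc n) * (real (Suc n) - 1)) = 1 / real n - 1 / real (Suc n)"
      using Suc.hyps by (simp add: diff_frac_eq mult.commute)
    also have "(1 / real n - 1 / real (Suc n)) + (1 - 1 / real n) = 1 - 1 / real (Suc n)" by simp
    finally show ?case .
  qed simp
  moreover have "1 - 1 / real n \<le> 1" by simp
  ultimately show ?thesis by (cases "n \<ge> 1") (blast intro: order_trans, simp)
qed

text \<open>z / \<phi>(z) is the product of 1 + 1 / (p - 1), at most the exponential of the sum of 1
  / (p - 1). Cut at y, about ln z: primes up to y contribute ln (ln y) + O(1) by Mertens, and the at
  most ln z / ln 2 larger ones contribute less than 1 / y each. The shift by 3 leaves room for
  rounding and for small z.\<close>

lemma totient_ge_loglog:
  obtains C :: real where "C > 0" "\<And>z. z > 0 \<Longrightarrow> real z \<le> C * totient z * ln (ln z + 3)"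
proof -
  obtain K where K: "\<And>n. n \<ge> 2 \<Longrightarrow> prime_recip_sum n \<le> ln (ln n) + K" by (rule prime_recip_sum_le) blast
  define C where "C = exp (K + 1 + 1 / ln 2)"
  show thesis
  proof
    show "C > 0" by (simp add: C_def)
    fix z :: nat assume z: "z > 0"
    define y where "y = nat \<lceil>ln (real z)\<rceil> + 2"
    have lnz: "ln (real z) \<ge> 0" using z by simp
    have "\<lceil>ln (real z)\<rceil> \<ge> 0" using lnz by linarith
    then have y_eq: "real y = of_int \<lceil>ln (real z)\<rceil> + 2" by (simp add: y_def)
    have y: "y \<ge> 2" "real y \<ge> ln z" "real y \<le> ln z + 3"
      using y_eq ceiling_correct[of "ln (real z)"] by (simp add: y_def, linarith, linarith)
    let ?P = "prime_factors z"
    have p2: "p \<ge> 2" if "p \<in> ?P" for p using that by (auto dest: in_prime_factors_imp_prime prime_ge_2_nat)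
    have small: "(\<Sum>p\<in>{p \<in> ?P. p \<le> y}. 1 / (real p - 1)) \<le> ln (ln y) + K + 1"
    proof -
      have "(\<Sum>p\<in>{p \<in> ?P. p \<le> y}. 1 / (real p - 1))
          = (\<Sum>p\<in>{p \<in> ?P. p \<le> y}. 1 / p) + (\<Sum>p\<in>{p \<in> ?P. p \<le> y}. 1 / (real p * (real p - 1)))"
        unfolding sum.distrib[symmetric] using p2 by (intro sum.cong) (auto simp: divide_simps dest!: p2)
      also have "(\<Sum>p\<in>{p \<in> ?P. p \<le> y}. 1 / p) \<le> prime_recip_sum y"
        unfolding prime_recip_sum_def by (intro sum_mono2) (auto simp: primes_upto_def)
      also have "\<dots> \<le> ln (ln y) + K" by (rule K[OF y(1)])
      also have "(\<Sum>p\<in>{p \<in> ?P. p \<le> y}. 1 / (real p * (real p - 1))) \<le> (\<Sum>k\<in>{2..y}. 1 / (real k * (real k - 1)))"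
        using p2 by (intro sum_mono2) auto
      also have "\<dots> \<le> 1" by (rule sum_telescope_le)
      finally show ?thesis by simp
    qed
    have large: "(\<Sum>p\<in>{p \<in> ?P. y < p}. 1 / (real p - 1)) \<le> 1 / ln 2"
    proof -
      have "(\<Sum>p\<in>{p \<in> ?P. y < p}. 1 / (real p - 1)) \<le> (\<Sum>p\<in>{p \<in> ?P. y < p}. 1 / y)"
        using y(1) by (intro sum_mono frac_le) auto
      also have "\<dots> = card {p \<in> ?P. y < p} / y" by simp
      also have "\<dots> \<le> omega z / y" by (intro divide_right_mono) (auto intro!: card_mono)
      also have "\<dots> \<le> (ln z / ln 2) / y"
        using omega_le_ln[OF z] by (intro divide_right_mono) (auto simp: pos_le_divide_eq)
      also have "\<dots> \<le> (y / ln 2) / y" using y by (intro divide_right_mono) auto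
      also have "\<dots> = 1 / ln 2" using y(1) by simp
      finally show ?thesis .
    qed
    have "?P = {p \<in> ?P. p \<le> y} \<union> {p \<in> ?P. y < p}" by auto
    then have "(\<Sum>p\<in>?P. 1 / (real p - 1)) =
        (\<Sum>p\<in>{p \<in> ?P. p \<le> y}. 1 / (real p - 1)) + (\<Sum>p\<in>{p \<in> ?P. y < p}. 1 / (real p - 1))"
      by (metis (no_types, lifting) sum.union_disjoint disjoint_iff finite_Un finite_set_mset leD mem_Collect_eq)
    then have sum: "(\<Sum>p\<in>?P. 1 / (real p - 1)) \<le> ln (ln y) + (K + 1 + 1 / ln 2)" using small large by linarith
    have z_eq: "real z = totient z * (\<Prod>p\<in>?P. 1 + 1 / (real p - 1))"
    proof -
      have "(\<Prod>p\<in>?P. 1 - 1 / real p) * (\<Prod>p\<in>?P. 1 + 1 / (real p - 1)) = (\<Prod>p\<in>?P. 1)"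
        unfolding prod.distrib[symmetric] by (intro prod.cong) (auto simp: field_simps dest!: p2)
      then show ?thesis by (simp add: totient_formula2)
    qed
    have "(\<Prod>p\<in>?P. 1 + 1 / (real p - 1)) \<le> (\<Prod>p\<in>?P. exp (1 / (real p - 1)))"
      by (intro prod_mono) (auto dest!: p2)
    also have "\<dots> = exp (\<Sum>p\<in>?P. 1 / (real p - 1))" by (simp add: exp_sum)
    also have "\<dots> \<le> exp (ln (ln y) + (K + 1 + 1 / ln 2))" using sum by simp
    also have "\<dots> = C * ln y" using y(1) by (simp add: exp_add C_def)
    also have "\<dots> \<le> C * ln (ln z + 3)" using y by (intro mult_left_mono) (auto simp: C_def)
    finally have "totient z * (\<Prod>p\<in>?P. 1 + 1 / (real p - 1)) \<le> totient z * (C * ln (ln z + 3))"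
      by (rule mult_left_mono) simp
    then show "real z \<le> C * totient z * ln (ln z + 3)" unfolding z_eq[symmetric] by (simp add: ac_simps)
  qed
qed

text \<open>For z = w(d), \<phi>(z) \<le> 2 * d gives z \<le> 2 * C * d * ln (ln z + 3), which still
  contains z. The crude estimate ln (ln z + 3) \<le> 4 * sqrt z yields z \<le> 64 * C^2 * d^2, so ln
  z + 3 \<le> 2 * ln d + K; substituting this back gives the true order.\<close>

lemma w_fun_bigo: "(\<lambda>d. real (w_fun d) - 1) \<in> O(\<lambda>d. real d * ln (ln (real d)))"
proof -
  obtain C :: real where C: "C > 0" "\<And>z. z > 0 \<Longrightarrow> real z \<le> C * totient z * ln (ln z + 3)"
    by (rule totient_ge_loglog) blast
  define K where "K = ln (64 * C\<^sup>2) + 3"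
  have "\<forall>\<^sub>F d in sequentially. ln (real d) \<ge> \<bar>K\<bar> + 3"
    using filterlim_compose[OF ln_at_top filterlim_real_sequentially] unfolding filterlim_at_top by blast
  then have "\<forall>\<^sub>F d in sequentially. 2 * ln (real d) + K > 0 \<and> ln (2 * ln (real d) + K) \<le> 2 * ln (ln (real d))"
  proof eventually_elim
    case (elim d)
    define L where "L = ln (real d)"
    have L: "L \<ge> \<bar>K\<bar> + 3" using elim by (simp add: L_def)
    then have pos: "2 * L + K > 0" by linarith
    have "(\<bar>K\<bar> + 3) * L \<le> L * L" using L by (intro mult_right_mono) auto
    moreover have "\<bar>K\<bar> * 1 \<le> \<bar>K\<bar> * L" using L by (intro mult_left_mono) auto
    ultimately have "2 * L + K \<le> L ^ 2" using L unfolding power2_eq_square distrib_right by linarith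
    then have "ln (2 * L + K) \<le> ln (L ^ 2)" using pos L by (subst ln_le_cancel_iff) auto
    then show ?case using pos L by (simp add: L_def[symmetric] ln_realpow)
  qed
  moreover have "\<forall>\<^sub>F d :: nat in sequentially. d \<ge> 3" by (rule eventually_ge_at_top)
  ultimately have "\<forall>\<^sub>F d in sequentially. norm (real (w_fun d) - 1) \<le> 4 * C * norm (real d * ln (ln (real d)))"
  proof eventually_elim
    case (elim d)
    define z where "z = w_fun d"
    have d: "d \<ge> 1" "real d \<ge> 1" using elim by auto
    have z: "z > 2" using w_fun_gt_2[OF d(1)] by (simp add: z_def)
    have "totient z \<le> 2 * d" using w_fun_attains[OF d(1)] by (simp add: z_def)
    then have tz: "real (totient z) \<le> 2 * d" by linarith
    have l3: "ln (ln z + 3) \<ge> 0" using z by (simp add: add_nonneg_nonneg)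
    have "real z \<le> C * totient z * ln (ln z + 3)" using C(2) z by simp
    also have "\<dots> \<le> C * (2 * d) * ln (ln z + 3)"
      using tz C(1) l3 by (intro mult_right_mono mult_left_mono) auto
    finally have le: "real z \<le> 2 * C * d * ln (ln z + 3)" by simp
    have "ln (ln z + 3) \<le> (ln z + 3) - 1" using z by (intro ln_le_minus_one) (simp add: add_nonneg_pos)
    moreover have "ln (real z) = 2 * ln (sqrt z)" using z by (simp add: ln_sqrt)
    moreover have "ln (sqrt z) \<le> sqrt z - 1" using z by (intro ln_le_minus_one) simp
    moreover have "sqrt z \<ge> 0" by simp
    ultimately have "ln (ln z + 3) \<le> 4 * sqrt z" by linarith
    then have "2 * C * d * ln (ln z + 3) \<le> 2 * C * d * (4 * sqrt z)"
      using C(1) by (intro mult_left_mono) auto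
    with le have "sqrt z * sqrt z \<le> (8 * C * d) * sqrt z" by simp
    then have "sqrt z \<le> 8 * C * d" by (rule mult_right_le_imp_le) (use z in simp)
    then have "(sqrt z)\<^sup>2 \<le> (8 * C * d)\<^sup>2" by (intro power_mono) auto
    then have "real z \<le> 64 * C\<^sup>2 * d ^ 2" by (simp add: power_mult_distrib)
    then have "ln (real z) \<le> ln (64 * C\<^sup>2 * d ^ 2)" using z C(1) d by (subst ln_le_cancel_iff) auto
    also have "\<dots> = ln (64 * C\<^sup>2) + 2 * ln d"
      using C(1) d by (subst ln_mult) (auto simp: ln_realpow)
    finally have "ln z + 3 \<le> 2 * ln (real d) + K" by (simp add: K_def)
    then have "ln (ln z + 3) \<le> ln (2 * ln (real d) + K)" using z elim by (subst ln_le_cancel_iff) (auto simp: add_nonneg_pos)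
    also have "\<dots> \<le> 2 * ln (ln (real d))" using elim by blast
    finally have ll: "ln (ln z + 3) \<le> 2 * ln (ln (real d))" .
    then have "2 * C * d * ln (ln z + 3) \<le> 2 * C * d * (2 * ln (ln (real d)))"
      using C(1) by (intro mult_left_mono) auto
    with le have "real z \<le> 4 * C * (real d * ln (ln (real d)))" by simp
    moreover have "0 \<le> ln (ln (real d))" using ll l3 by linarith
    ultimately show ?case using z C(1) by (simp add: z_def[symmetric] abs_mult)
  qed
  then show ?thesis by (rule bigoI)
qed

section \<open>The lower bound on \<open>w_fun\<close>\<close>

lemma totient_mult_sum_divisors_le: "totient n * (\<Sum>e | e dvd n. e) \<le> n * n"
proof -
  have "totient n * (\<Sum>e | e dvd n. e) = (\<Sum>e | e dvd n. totient n * e)" by (rule sum_distrib_left)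
  also have "\<dots> \<le> (\<Sum>e | e dvd n. n * totient e)"
  proof (rule sum_mono)
    fix e assume "e \<in> {e. e dvd n}"
    then obtain k where k: "n = k * e" by (metis dvdE mem_Collect_eq mult.commute)
    \<comment> \<open>For positive n this says \<phi>(n) / n \<le> \<phi>(e) / e for every divisor e
      of n.\<close>
    have "totient n * e \<le> k * totient e * e" unfolding k by (intro mult_le_mono1 totient_mult_le)
    then show "totient n * e \<le> n * totient e" unfolding k by (simp add: ac_simps)
  qed
  also have "\<dots> = n * n" by (simp add: sum_distrib_left[symmetric] totient_divisor_sum)
  finally show ?thesis .
qed

text \<open>The numbers n / k for k \<le> r are distinct divisors of n = r!, so the divisor sum of n
  is at least n times the harmonic number; \<open>totient_mult_sum_divisors_le\<close> turns this
  into a bound on \<phi>(n).\<close>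

lemma totient_fact_harm: "real (totient (fact r)) * harm r \<le> fact r"
proof -
  define n :: nat where "n = fact r"
  have n0: "n > 0" by (simp add: n_def)
  have dvd: "k dvd n" if "k \<in> {1..r}" for k using that by (auto simp: n_def intro: dvd_fact)
  have inj: "inj_on (\<lambda>k. n div k) {1..r}"
  proof (rule inj_onI)
    fix k l assume kl: "k \<in> {1..r}" "l \<in> {1..r}" "n div k = n div l"
    have k: "k * (n div k) = n" and l: "l * (n div l) = n" using dvd kl(1,2) by simp_all
    have "k * (n div k) = l * (n div k)" using k l[folded kl(3)] by linarith
    moreover have "n div k \<noteq> 0" using k n0 by (intro notI) simp
    ultimately show "k = l" by simp
  qed
  have "(\<Sum>k\<in>{1..r}. n div k) = (\<Sum>e\<in>(\<lambda>k. n div k) ` {1..r}. e)" by (subst sum.reindex[OF inj]) (simp only: o_def)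
  also have "\<dots> \<le> (\<Sum>e | e dvd n. e)"
    using n0 dvd by (intro sum_mono2) (auto simp: div_dvd_iff_mult)
  finally have "totient n * (\<Sum>k\<in>{1..r}. n div k) \<le> totient n * (\<Sum>e | e dvd n. e)" by (rule mult_le_mono2)
  also have "\<dots> \<le> n * n" by (rule totient_mult_sum_divisors_le)
  finally have "real (totient n * (\<Sum>k\<in>{1..r}. n div k)) \<le> real (n * n)" by (subst of_nat_le_iff)
  then have "real (totient n) * (\<Sum>k\<in>{1..r}. real (n div k)) \<le> real n * real n" by simp
  also have "(\<Sum>k\<in>{1..r}. real (n div k)) = n * harm r"
    unfolding harm_def sum_distrib_left
    by (intro sum.cong refl) (simp only: real_of_nat_div[OF dvd] divide_inverse)
  finally have "real n * (real (totient n) * harm r) \<le> real n * real n" by (simp add: ac_simps)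
  then have "real (totient n) * harm r \<le> real n" using n0 by simp
  then show ?thesis by (simp add: n_def)
qed

text \<open>With r about sqrt (ln d), r! \<le> exp (r * r) \<le> d, and still H = harm r \<ge> ln (r
  + 1) \<ge> ln (ln d) / 2. A multiple z of r! near d * H has \<phi>(z) \<le> d, and the other half
  of the budget 2 * d pays for its O(ln d) primes.\<close>

lemma w_fun_lower:
  assumes d: "d \<ge> 3" "4 * ln (real d) / ln 2 \<le> d" and r: "r = nat \<lfloor>sqrt (ln d)\<rfloor>"
  shows "real d * (ln (ln d) / 2) - d \<le> w_fun d"
proof -
  have "exp 1 \<le> (3::real)" using exp_le by simp
  then have "exp 1 \<le> real d" using d(1) by linarith
  then have lnd: "ln d \<ge> 1" using d(1) by (subst ln_ge_iff) auto
  then have "sqrt (ln d) \<ge> 1" by simp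
  then have r1: "r \<ge> 1" "real r \<le> sqrt (ln d)" "sqrt (ln d) < real r + 1" unfolding r by linarith+
  then have r2: "real r ^ 2 \<le> ln d" using lnd by (metis of_nat_0_le_iff power_mono real_sqrt_pow2 order_trans zero_le_one)
  define P :: nat where "P = fact r"
  have P0: "P > 0" by (simp add: P_def)
  have "P \<le> r ^ r" unfolding P_def using fact_le_power[of r, where 'a = nat] by simp
  then have "real P \<le> real (r ^ r)" by (subst of_nat_le_iff)
  also have "\<dots> = exp (r * ln r)" using r1 by (simp add: exp_of_nat_mult)
  also have "\<dots> \<le> exp (r * r)"
  proof -
    have "ln (real r) \<le> r" using ln_le_minus_one[of "real r"] r1(1) by simp
    then show ?thesis by (simp add: mult_left_mono)
  qed
  also have "\<dots> \<le> exp (ln d)" using r2 by (simp add: power2_eq_square)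
  also have "\<dots> = d" using d by simp
  finally have Pd: "real P \<le> d" .
  define H :: real where "H = harm r"
  have H1: "H \<ge> 1"
  proof -
    have "harm 1 \<le> (harm r :: real)" using r1(1) by (intro harm_mono)
    then show ?thesis by (simp add: H_def harm_def)
  qed
  have Hr: "H \<le> r"
    unfolding H_def harm_def using sum_mono[of "{1..r}" "\<lambda>k. inverse (real k)" "\<lambda>_. 1"] by (simp add: inverse_le_1_iff)
  have rd: "real r \<le> d"
  proof -
    have "real r \<le> real r ^ 2" using r1 by (simp add: power2_eq_square)
    also have "\<dots> \<le> d" using r2 ln_le_minus_one[of "real d"] d by linarith
    finally show ?thesis .
  qed
  \<comment> \<open>j * P is the largest multiple of P = r! up to d * H; rounding loses less than P
    \<le> d.\<close>
  define j where "j = nat \<lfloor>d * H / P\<rfloor>"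
  have "real P \<le> d * H" using Pd H1 mult_left_mono[of 1 H "real d"] by simp
  then have q1: "d * H / P \<ge> 1" using P0 by simp
  then have j: "j \<ge> 1" "real j \<le> d * H / P" "d * H / P < real j + 1" unfolding j_def by linarith+
  have jP: "j * real P \<le> d * H" "d * H < j * real P + P"
    using j(2,3) P0 by (simp_all add: field_simps)
  define z where "z = j * P"
  have z0: "z > 0" using j P0 by (simp add: z_def)
  have "real (totient z) \<le> j * totient P" unfolding z_def using totient_mult_le[of j P] by (metis of_nat_le_iff of_nat_mult)
  then have "real (totient z) * H \<le> j * totient P * H" using H1 by (intro mult_right_mono) auto
  also have "\<dots> \<le> j * real P"
    using totient_fact_harm[of r] mult_left_mono[of "real (totient P) * H" "real P" "real j"] by (simp add: P_def H_def mult.assoc)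
  also have "\<dots> \<le> d * H" by (rule jP)
  finally have tz: "real (totient z) \<le> d" using H1 by simp
  have "real z \<le> d * H" using jP by (simp add: z_def)
  also have "\<dots> \<le> real d * d" using Hr rd by (intro mult_left_mono) auto
  finally have "ln (real z) \<le> ln (real d * d)" using z0 d by (subst ln_le_cancel_iff) auto
  then have "ln (real z) \<le> 2 * ln d" using d by (simp add: ln_mult)
  then have "real (omega z) * ln 2 \<le> 2 * ln d" using omega_le_ln[OF z0] by linarith
  then have "real (omega z) \<le> 2 * ln (real d) / ln 2" by (subst pos_le_divide_eq) simp_all
  then have "2 * real (omega z) \<le> 4 * ln (real d) / ln 2" by simp
  then have "real (totient z + 2 * omega z) \<le> real (2 * d)" using tz d(2) by simp
  then have "totient z + 2 * omega z \<le> 2 * d" by (simp only: of_nat_le_iff)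
  then have "z \<le> w_fun d" by (rule w_fun_ge_omega[OF z0])
  then have "real z \<le> real (w_fun d)" by (subst of_nat_le_iff)
  moreover have "real z = j * real P" by (simp add: z_def)
  ultimately have w: "d * H - P \<le> w_fun d" using jP by linarith
  have "ln (ln d) / 2 = ln (sqrt (ln d))" using lnd by (simp add: ln_sqrt)
  also have "\<dots> \<le> ln (real r + 1)" using r1 lnd by (subst ln_le_cancel_iff) auto
  also have "\<dots> \<le> H" unfolding H_def by (rule harm_ge_ln)
  finally have "real d * (ln (ln d) / 2) \<le> d * H" by (intro mult_left_mono) auto
  with w Pd show ?thesis by linarith
qed

lemma w_fun_bigomega: "(\<lambda>d. real (w_fun d) - 1) \<in> \<Omega>(\<lambda>d. real d * ln (ln (real d)))"
proof -
  have "\<forall>\<^sub>F d in sequentially. 4 * ln (real d) / ln 2 \<le> d" by real_asymp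
  moreover have "\<forall>\<^sub>F d in sequentially. real d * ln (ln (real d)) / 4 \<le> real d * (ln (ln d) / 2) - d - 1" by real_asymp
  moreover have "\<forall>\<^sub>F d in sequentially. 0 \<le> real d * ln (ln (real d))" by real_asymp
  moreover have "\<forall>\<^sub>F d :: nat in sequentially. d \<ge> 3" by (rule eventually_ge_at_top)
  ultimately have "\<forall>\<^sub>F d in sequentially. (1 / 4) * norm (real d * ln (ln (real d))) \<le> norm (real (w_fun d) - 1)"
  proof eventually_elim
    case (elim d)
    then have "real d * (ln (ln d) / 2) - d \<le> w_fun d" by (intro w_fun_lower) auto
    with elim have "real d * ln (ln (real d)) / 4 \<le> real (w_fun d) - 1" by linarith
    with elim(3) show ?case by simp
  qed
  then show ?thesis by (intro landau_omega.bigI[of "1 / 4"]) auto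
qed

theorem theorem1:
  shows
    "(\<forall>(m :: nat) (g :: nat \<Rightarrow> real ^ 'n).
        m \<ge> CARD('n) \<and> (\<forall>j\<in>{1..m}. lattice_point (g j)) \<and>
        (\<exists>w \<in> interior (zonotope m g). lattice_point w) \<longrightarrow>
        (\<exists>w \<in> interior (zonotope m g). lattice_point w \<and>
           coeff_asym (zonotope m g) w \<le> real (w_fun CARD('n)) - 1))
     \<and> (\<lambda>d :: nat. real (w_fun d) - 1) \<in> \<Theta>(\<lambda>d. real d * ln (ln (real d)))
     \<and> (\<forall>c :: real. c < real (w_fun CARD('n)) - 1 \<longrightarrow>
        (\<exists>(m :: nat) (g :: nat \<Rightarrow> real ^ 'n).
          m \<ge> CARD('n) \<and> (\<forall>j\<in>{1..m}. lattice_point (g j)) \<and>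
          (\<exists>w \<in> interior (zonotope m g). lattice_point w) \<and>
          \<not> (\<exists>w \<in> interior (zonotope m g). lattice_point w \<and>
               coeff_asym (zonotope m g) w \<le> c)))"
proof (intro conjI allI impI)
  fix m :: nat and g :: "nat \<Rightarrow> real ^ 'n"
  assume "m \<ge> CARD('n) \<and> (\<forall>j\<in>{1..m}. lattice_point (g j)) \<and>
    (\<exists>w \<in> interior (zonotope m g). lattice_point w)"
  then show "\<exists>w \<in> interior (zonotope m g). lattice_point w \<and>
      coeff_asym (zonotope m g) w \<le> real (w_fun CARD('n)) - 1"
    using zonotope_deep_lattice_point by blast
next
  show "(\<lambda>d :: nat. real (w_fun d) - 1) \<in> \<Theta>(\<lambda>d. real d * ln (ln (real d)))"
    by (intro bigthetaI w_fun_bigo w_fun_bigomega)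
next
  fix c :: real
  assume "c < real (w_fun CARD('n)) - 1"
  then show "\<exists>(m :: nat) (g :: nat \<Rightarrow> real ^ 'n).
      m \<ge> CARD('n) \<and> (\<forall>j\<in>{1..m}. lattice_point (g j)) \<and>
      (\<exists>w \<in> interior (zonotope m g). lattice_point w) \<and>
      \<not> (\<exists>w \<in> interior (zonotope m g). lattice_point w \<and> coeff_asym (zonotope m g) w \<le> c)"
    by (rule zonotope_bound_sharp)
qed

end
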